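(* Let $w\in\mathcal S_n$. If $w$ has the form $n.v$ with $v\in\mathcal S_{n-1}$, then $\mathcal G_w(y,x_1,\dots,x_{n-1})=y^{n-1}\cdot\mathcal G_v(x)$. Otherwise, $$\mathcal G_w(y,x_1,\dots,x_{n-1})=\sum_{1\le j<n,\ v\in\mathcal S_{n-1}}c^{\,n.v}_{w,\,r_{[1,n-j]}}\,y^{j-1}\,\mathcal G_v(x)=\sum_{\gamma}(-1)^{\ell(\gamma)-m(\gamma)}\,y^{\,n-1-m(\gamma)}\,\mathcal G_{v}(x),$$ where the second sum is over all marked chains $\gamma$ in the $1$-Bruhat order on $\mathcal S_n$ that begin at $w$ and end in a permutation of the form $n.v$ with $v\in\mathcal S_{n-1}$ (and $v$ in the summand is the one determined by the endpoint of $\gamma$).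
   Context: Permutations are written in one-line notation, products are compositions $(uv)(i)=u(v(i))$, $s_i$ is the transposition of $i,i+1$, $t_{a,b}$ ($a<b$) the transposition of $a,b$, $\ell$ is the number of inversions, $\omega_n=[n,\dots,2,1]$, and $\mathcal S_\infty=\bigcup_n\mathcal S_n$. For $v\in\mathcal S_{n-1}$, $n.v:=[n,v_1,\dots,v_{n-1}]\in\mathcal S_n$. For positive integers $k,p$, $r_{[k,p]}=[1,\dots,k-1,k+p,k,k+1,\dots,\widehat{k+p},\dots]$; in particular $r_{[1,p]}=[p+1,1,2,\dots,p,p+2,\dots]$. Grothendieck polynomials: $s_i$ acts on $\mathbb Z[x_1,\dots,x_n]$ by exchanging $x_i,x_{i+1}$. Let $\pi_i f=\dfrac{(1-x_{i+1})f-s_i((1-x_{i+1})f)}{x_i-x_{i+1}}$ and $\pi_v=\pi_{i_1}\cdots\pi_{i_r}$ for any reduced word $v=s_{i_1}\cdots s_{i_r}$. Put $\mathcal G_{\omega_n}=x_1^{n-1}x_2^{n-2}\cdots x_{n-1}$ and $\mathcal G_w=\pi_{w^{-1}\omega_n}\mathcal G_{\omega_n}$ for $w\in\mathcal S_n$; $\mathcal G_w$ does not depend on the choice of $n$ with $w\in\mathcal S_n$, and $\{\mathcal G_w\mid w\in\mathcal S_\infty\}$ is a $\mathbb Z$-basis of $\mathbb Z[x_1,x_2,\dots]$. The Schubert structure constants $c^w_{u,v}\in\mathbb Z$ are defined by $\mathcal G_u\cdot\mathcal G_v=\sum_{w\in\mathcal S_\infty}c^w_{u,v}\,\mathcal G_w$.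 Chains: a cover in the $1$-Bruhat order on $\mathcal S_n$ is $w\xrightarrow{(1,b)}w\,t_{1,b}$ with $b>1$ and $\ell(w\,t_{1,b})=\ell(w)+1$. A chain $w\xrightarrow{(1,b_1)}w_1\xrightarrow{(1,b_2)}\cdots\xrightarrow{(1,b_j)}w_j$ of successive covers is increasing if $b_1>b_2>\cdots>b_j$. A marked chain is a chain together with a set of marked covers that includes the first cover, such that cutting the chain at the permutation before each marked cover decomposes it into increasing segments. $\ell(\gamma)$ is the number of covers and $m(\gamma)$ the number of marked covers of $\gamma$. *)

theory Defs
  imports "HOL-Library.Poly_Mapping" "HOL-Combinatorics.Permutations"
begin

section \<open>Polynomials\<close>

text \<open>
  Integer polynomials in the variables $x_0, x_1, x_2, \dots$.  Grothendieck polynomials only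
  involve $x_1, x_2, \dots$; the variable of index 0 plays the role of the extra variable $y$.
\<close>

type_synonym zpoly = "(nat \<Rightarrow>\<^sub>0 nat) \<Rightarrow>\<^sub>0 int"

definition X :: "nat \<Rightarrow> zpoly" where
  "X i = Poly_Mapping.single (Poly_Mapping.single i 1) 1"

definition Y :: zpoly where
  "Y = X 0"

definition poly_subst :: "(nat \<Rightarrow> zpoly) \<Rightarrow> zpoly \<Rightarrow> zpoly" where
  "poly_subst \<sigma> f =
     (\<Sum>m\<in>Poly_Mapping.keys f. of_int (Poly_Mapping.lookup f m) *
        (\<Prod>i\<in>Poly_Mapping.keys m. \<sigma> i ^ Poly_Mapping.lookup m i))"

text \<open>$f(y, x_1, x_2, \dots)$: the variable $x_1$ becomes $y$ and $x_{i+1}$ becomes $x_i$.\<close>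

definition subst_y_first :: "zpoly \<Rightarrow> zpoly" where
  "subst_y_first = poly_subst (\<lambda>i. if i = 1 then Y else X (i - 1))"

section \<open>Permutations\<close>

text \<open>
  The symmetric group on $n$ letters is \<open>{w. w permutes {1..n}}\<close>.  All its members are functions
  on \<open>nat\<close> that fix 0 and everything above \<open>n\<close>, so the groups are nested.
\<close>

definition S_inf :: "(nat \<Rightarrow> nat) set" where
  "S_inf = {w. \<exists>n. w permutes {1..n}}"

definition perm_length :: "(nat \<Rightarrow> nat) \<Rightarrow> nat" where
  "perm_length w = card {(i, j). i < j \<and> w j < w i}"

definition simple_transp :: "nat \<Rightarrow> nat \<Rightarrow> nat" where
  "simple_transp i = transpose i (i + 1)"

definition omega :: "nat \<Rightarrow> nat \<Rightarrow> nat" where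
  "omega n i = (if i \<in> {1..n} then n + 1 - i else i)"

text \<open>\<open>prepend n v\<close> is $n.v = [n, v_1, \dots, v_{n-1}]$.\<close>

definition prepend :: "nat \<Rightarrow> (nat \<Rightarrow> nat) \<Rightarrow> nat \<Rightarrow> nat" where
  "prepend n v i = (if i = 1 then n else if i \<in> {2..n} then v (i - 1) else i)"

text \<open>\<open>r_perm k p\<close> is $r_{[k,p]} = [1, \dots, k-1, k+p, k, k+1, \dots, \widehat{k+p}, \dots]$.\<close>

definition r_perm :: "nat \<Rightarrow> nat \<Rightarrow> nat \<Rightarrow> nat" where
  "r_perm k p i = (if i < k then i else if i = k then k + p else if i \<le> k + p then i - 1 else i)"

definition reduced_word :: "(nat \<Rightarrow> nat) \<Rightarrow> nat list \<Rightarrow> bool" where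
  "reduced_word v is \<longleftrightarrow>
     (\<forall>i\<in>set is. 1 \<le> i) \<and> v = foldr (\<lambda>i u. simple_transp i \<circ> u) is id \<and>
     length is = perm_length v"

section \<open>Grothendieck polynomials and structure constants\<close>

definition swap_vars :: "nat \<Rightarrow> zpoly \<Rightarrow> zpoly" where
  "swap_vars i = poly_subst (\<lambda>j. X (simple_transp i j))"

text \<open>The quotient by $x_i - x_{i+1}$ is the unique one in the integral domain \<open>zpoly\<close>.\<close>

definition demazure :: "nat \<Rightarrow> zpoly \<Rightarrow> zpoly" where
  "demazure i f =
     (THE g. (X i - X (i + 1)) * g =
        (1 - X (i + 1)) * f - swap_vars i ((1 - X (i + 1)) * f))"

text \<open>The result does not depend on the choice of the reduced word.\<close>

definition demazure_perm :: "(nat \<Rightarrow> nat) \<Rightarrow> zpoly \<Rightarrow> zpoly" where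
  "demazure_perm v f = foldr demazure (SOME is. reduced_word v is) f"

definition groth_in :: "nat \<Rightarrow> (nat \<Rightarrow> nat) \<Rightarrow> zpoly" where
  "groth_in n w = demazure_perm (inv w \<circ> omega n) (\<Prod>i\<in>{1..n}. X i ^ (n - i))"

text \<open>\<open>groth_in n w\<close> is the same for all \<open>n\<close> with \<open>w permutes {1..n}\<close>; we take the least one.\<close>

definition groth :: "(nat \<Rightarrow> nat) \<Rightarrow> zpoly" where
  "groth w = groth_in (LEAST n. w permutes {1..n}) w"

text \<open>
  \<open>struct_const w u v\<close> is $c^w_{u,v}$.  The Grothendieck polynomials form a basis of the
  polynomials in $x_1, x_2, \dots$, so the finitely supported coefficient function exists and is
  unique.
\<close>

definition struct_const :: "(nat \<Rightarrow> nat) \<Rightarrow> (nat \<Rightarrow> nat) \<Rightarrow> (nat \<Rightarrow> nat) \<Rightarrow> int" where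
  "struct_const w u v =
     (THE c. finite {w. c w \<noteq> 0} \<and> {w. c w \<noteq> 0} \<subseteq> S_inf \<and>
        groth u * groth v = (\<Sum>w | c w \<noteq> 0. of_int (c w) * groth w)) w"

section \<open>Marked chains in the 1-Bruhat order\<close>

definition cover1 :: "nat \<Rightarrow> (nat \<Rightarrow> nat) \<Rightarrow> nat \<Rightarrow> bool" where
  "cover1 n w b \<longleftrightarrow> w permutes {1..n} \<and> b \<in> {2..n} \<and>
     perm_length (w \<circ> transpose 1 b) = perm_length w + 1"

text \<open>A chain starting at \<open>w\<close> is determined by its list of labels $b_1, \dots, b_j$.\<close>

fun chain1 :: "nat \<Rightarrow> (nat \<Rightarrow> nat) \<Rightarrow> nat list \<Rightarrow> bool" where
  "chain1 n w [] \<longleftrightarrow> True"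
| "chain1 n w (b # bs) \<longleftrightarrow> cover1 n w b \<and> chain1 n (w \<circ> transpose 1 b) bs"

fun chain_end :: "(nat \<Rightarrow> nat) \<Rightarrow> nat list \<Rightarrow> nat \<Rightarrow> nat" where
  "chain_end w [] = w"
| "chain_end w (b # bs) = chain_end (w \<circ> transpose 1 b) bs"

text \<open>
  A marked chain is encoded as a list of pairs \<open>(b, m)\<close>, one for each cover, where \<open>m\<close> tells
  whether the cover is marked.  \<open>segments\<close> cuts it before each marked cover.
\<close>

function segments :: "(nat \<times> bool) list \<Rightarrow> nat list list" where
  "segments [] = []"
| "segments ((b, m) # \<gamma>) =
     (b # map fst (takeWhile (\<lambda>c. \<not> snd c) \<gamma>)) # segments (dropWhile (\<lambda>c. \<not> snd c) \<gamma>)"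
  by pat_completeness auto
termination
  by (relation "measure length") (auto simp: le_imp_less_Suc length_dropWhile_le)

text \<open>Segments are increasing in the sense $b_1 > b_2 > \cdots$.\<close>

definition marked_chain :: "nat \<Rightarrow> (nat \<Rightarrow> nat) \<Rightarrow> (nat \<times> bool) list \<Rightarrow> bool" where
  "marked_chain n w \<gamma> \<longleftrightarrow> chain1 n w (map fst \<gamma>) \<and> (\<gamma> \<noteq> [] \<longrightarrow> snd (hd \<gamma>)) \<and>
     (\<forall>bs\<in>set (segments \<gamma>). sorted_wrt (>) bs)"

definition num_marked :: "(nat \<times> bool) list \<Rightarrow> nat" where
  "num_marked \<gamma> = length (filter snd \<gamma>)"

text \<open>
  Marked chains from \<open>w\<close> whose endpoint has the form $n.v$, paired with the \<open>v\<close> determined by the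
  endpoint.
\<close>

definition marked_chains_to_top ::
  "nat \<Rightarrow> (nat \<Rightarrow> nat) \<Rightarrow> ((nat \<times> bool) list \<times> (nat \<Rightarrow> nat)) set" where
  "marked_chains_to_top n w =
     {(\<gamma>, v). marked_chain n w \<gamma> \<and> v permutes {1..n - 1} \<and>
        chain_end w (map fst \<gamma>) = prepend n v}"

end

theory Submission
  imports Defs
begin

text \<open>
  The whole theorem follows from a formula for the product of a Grothendieck polynomial with the
  first variable.  Write $T_b$ for the operator that sends \<open>w\<close> to $w t_{1,b}$ if this is a cover
  and to 0 otherwise.  For $w \in \mathcal S_n$ with $w(1) < n$,
  $$(1 - x_1) \mathcal G_w = \mathcal G_{w (1 - T_n) (1 - T_{n-1}) \cdots (1 - T_2)},$$
  where the operators act from the left to the right; expanding the product gives the alternating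
  sum over increasing chains (\<open>one_minus_X1_mult_groth\<close>), equivalently
  $x_1 \mathcal G_w = \sum_\gamma (-1)^{\ell(\gamma) - 1} \mathcal G_{\mathrm{end}(\gamma)}$ over the
  nonempty increasing chains from \<open>w\<close> (\<open>X1_mult_groth\<close>).

  The formula holds for the permutations whose entries after the first one decrease: there
  $\mathcal G_w = \pi_1 \cdots \pi_p\, x^\delta$ with $p = n - w(1)$, the Leibniz rule
  $(1 - x_i) \pi_i = (\pi_i - 1) (1 - x_{i+1})$ moves the factor $1 - x_1$ through the word, and
  $(\pi_1 - 1) \cdots (\pi_p - 1) x^\delta$ is the alternating sum because leaving out letters of
  $s_p \cdots s_1$ is the same as multiplying by transpositions $t_{1,b}$.  From these permutations
  the operators $\pi_i$ with $i \ge 2$ reach all others with the same first entry; they commute with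
  multiplication by $x_1$, and they commute with the product of the $1 - T_b$ because each factor
  is untouched except the adjacent pair $(1 - T_{i+1}) (1 - T_i)$, which is treated as a block
  (\<open>demazure_monk_sum\<close>).

  Every nonempty chain raises the first entry, so the formula can be iterated until the first
  entry is \<open>n\<close>; the successive increasing chains are the segments of a marked chain, and each
  segment costs one factor $x_1$.  Since $\mathcal G_{n.v} = x_1^{n-1} \mathcal G_v(x_2, x_3, \dots)$
  (\<open>groth_prepend\<close>), renaming the variables and cancelling \<open>y\<close> gives the sum over marked chains
  (\<open>subst_y_first_groth\<close>).  The same iteration, stopped after \<open>p\<close> segments, expands
  $x_1^p \mathcal G_w$ in Grothendieck polynomials; a chain that arrives at $n.v$ too early
  contributes $x_1^k \mathcal G_{n.v} = \mathcal G_{(n+k).v}$ with $k > 0$, which has a first entry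
  different from \<open>n\<close>.  Hence the coefficient of $\mathcal G_{n.v}$ is the signed number of marked chains from \<open>w\<close>
  to $n.v$ with exactly \<open>p\<close> marks (\<open>X1_power_mult_groth_expansion\<close>), and because
  $\mathcal G_{r_{[1,p]}} = x_1^p$ and the Grothendieck polynomials are linearly independent
  (\<open>groth_linear_independent\<close>), this coefficient is the structure constant.

  What has to be known about Grothendieck polynomials beforehand is that
  $\mathcal G_{w s_i} = \pi_i \mathcal G_w$ at a descent \<open>i\<close>, which rests on the independence of
  $\pi_v$ of the reduced word (\<open>reduced_words_agree\<close>), and that $\mathcal G_w$ is independent of the
  ambient symmetric group (\<open>groth_eq\<close>).
\<close>

section \<open>Substitution in integer polynomials\<close>

definition subst_monom :: "(nat \<Rightarrow> zpoly) \<Rightarrow> (nat \<Rightarrow>\<^sub>0 nat) \<Rightarrow> zpoly" where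
  "subst_monom \<sigma> m = (\<Prod>i\<in>Poly_Mapping.keys m. \<sigma> i ^ Poly_Mapping.lookup m i)"

lemma subst_monom_superset:
  assumes "finite A" "Poly_Mapping.keys m \<subseteq> A"
  shows "subst_monom \<sigma> m = (\<Prod>i\<in>A. \<sigma> i ^ Poly_Mapping.lookup m i)"
  unfolding subst_monom_def using assms
  by (intro prod.mono_neutral_left) (auto simp: in_keys_iff)

lemma subst_monom_add: "subst_monom \<sigma> (m + k) = subst_monom \<sigma> m * subst_monom \<sigma> k"
proof -
  let ?A = "Poly_Mapping.keys m \<union> Poly_Mapping.keys k"
  have "subst_monom \<sigma> (m + k) = (\<Prod>i\<in>?A. \<sigma> i ^ Poly_Mapping.lookup (m + k) i)"
    using keys_add[of m k] by (intro subst_monom_superset) auto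
  moreover have "subst_monom \<sigma> m = (\<Prod>i\<in>?A. \<sigma> i ^ Poly_Mapping.lookup m i)"
    "subst_monom \<sigma> k = (\<Prod>i\<in>?A. \<sigma> i ^ Poly_Mapping.lookup k i)"
    by (auto intro!: subst_monom_superset)
  ultimately show ?thesis
    by (simp add: lookup_add power_add prod.distrib)
qed

lemma poly_subst_superset:
  assumes "finite A" "Poly_Mapping.keys f \<subseteq> A"
  shows "poly_subst \<sigma> f = (\<Sum>m\<in>A. of_int (Poly_Mapping.lookup f m) * subst_monom \<sigma> m)"
  unfolding poly_subst_def subst_monom_def[symmetric] using assms
  by (intro sum.mono_neutral_left) (auto simp: in_keys_iff)

lemma poly_subst_add: "poly_subst \<sigma> (f + g) = poly_subst \<sigma> f + poly_subst \<sigma> g"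
proof -
  let ?A = "Poly_Mapping.keys f \<union> Poly_Mapping.keys g"
  have "poly_subst \<sigma> (f + g)
      = (\<Sum>m\<in>?A. of_int (Poly_Mapping.lookup (f + g) m) * subst_monom \<sigma> m)"
    using keys_add[of f g] by (intro poly_subst_superset) auto
  moreover have "poly_subst \<sigma> f = (\<Sum>m\<in>?A. of_int (Poly_Mapping.lookup f m) * subst_monom \<sigma> m)"
    "poly_subst \<sigma> g = (\<Sum>m\<in>?A. of_int (Poly_Mapping.lookup g m) * subst_monom \<sigma> m)"
    by (auto intro!: poly_subst_superset)
  ultimately show ?thesis
    by (simp add: lookup_add distrib_right sum.distrib)
qed

lemma poly_subst_single:
  "poly_subst \<sigma> (Poly_Mapping.single m c) = of_int c * subst_monom \<sigma> m"
  by (cases "c = 0") (simp_all add: poly_subst_def subst_monom_def)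

lemma poly_subst_zero [simp]: "poly_subst \<sigma> 0 = 0"
  by (simp add: poly_subst_def)

lemma zpoly_eq_sum_single:
  fixes f :: zpoly
  shows "f = (\<Sum>m\<in>Poly_Mapping.keys f. Poly_Mapping.single m (Poly_Mapping.lookup f m))"
proof (rule poly_mapping_eqI)
  fix k
  have "Poly_Mapping.lookup (\<Sum>m\<in>Poly_Mapping.keys f. Poly_Mapping.single m (Poly_Mapping.lookup f m)) k
      = (\<Sum>m\<in>Poly_Mapping.keys f. if m = k then Poly_Mapping.lookup f m else 0)"
    by (simp add: lookup_sum lookup_single when_def)
  also have "\<dots> = Poly_Mapping.lookup f k"
    by (auto simp: sum.delta in_keys_iff)
  finally show "Poly_Mapping.lookup f k
      = Poly_Mapping.lookup (\<Sum>m\<in>Poly_Mapping.keys f. Poly_Mapping.single m (Poly_Mapping.lookup f m)) k"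
    by simp
qed

lemma zpoly_additive_induct [case_names single add]:
  fixes f :: zpoly
  assumes s: "\<And>m c. P (Poly_Mapping.single m c)" and a: "\<And>f g. P f \<Longrightarrow> P g \<Longrightarrow> P (f + g)"
  shows "P f"
proof -
  have "P (\<Sum>m\<in>A. Poly_Mapping.single m (h m))" for A and h :: "(nat \<Rightarrow>\<^sub>0 nat) \<Rightarrow> int"
    using s[of 0 0] by (induction A rule: infinite_finite_induct) (auto intro: s a)
  then show ?thesis by (subst zpoly_eq_sum_single)
qed

lemma poly_subst_mult: "poly_subst \<sigma> (f * g) = poly_subst \<sigma> f * poly_subst \<sigma> g"
proof (induction f rule: zpoly_additive_induct)
  case (single m c)
  show ?case
    by (induction g rule: zpoly_additive_induct)
      (simp_all add: poly_subst_single mult_single subst_monom_add poly_subst_add distrib_left)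
next
  case (add f h)
  then show ?case by (simp add: poly_subst_add distrib_right)
qed

lemma poly_subst_one [simp]: "poly_subst \<sigma> 1 = 1"
  using poly_subst_single[of \<sigma> 0 1] by (simp add: subst_monom_def)

lemma of_int_zpoly: "(of_int c :: zpoly) = Poly_Mapping.single 0 c"
proof -
  have "Poly_Mapping.single 0 (of_int c :: int) = (of_int c :: zpoly)" by (rule single_of_int)
  then show ?thesis by simp
qed

lemma poly_subst_of_int [simp]: "poly_subst \<sigma> (of_int c) = of_int c"
  unfolding of_int_zpoly poly_subst_single by (simp add: subst_monom_def of_int_zpoly)

lemma poly_subst_uminus: "poly_subst \<sigma> (- f) = - poly_subst \<sigma> f"
  using poly_subst_add[of \<sigma> f "- f"] by (simp add: eq_neg_iff_add_eq_0 add.commute)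

lemma poly_subst_diff: "poly_subst \<sigma> (f - g) = poly_subst \<sigma> f - poly_subst \<sigma> g"
  using poly_subst_add[of \<sigma> f "- g"] by (simp add: poly_subst_uminus)

lemma poly_subst_power: "poly_subst \<sigma> (f ^ k) = poly_subst \<sigma> f ^ k"
  by (induction k) (simp_all add: poly_subst_mult)

lemma poly_subst_sum: "poly_subst \<sigma> (\<Sum>a\<in>A. F a) = (\<Sum>a\<in>A. poly_subst \<sigma> (F a))"
  by (induction A rule: infinite_finite_induct) (simp_all add: poly_subst_add)

lemma poly_subst_prod: "poly_subst \<sigma> (\<Prod>a\<in>A. F a) = (\<Prod>a\<in>A. poly_subst \<sigma> (F a))"
  by (induction A rule: infinite_finite_induct) (simp_all add: poly_subst_mult)

lemma poly_subst_X [simp]: "poly_subst \<sigma> (X i) = \<sigma> i"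
  by (simp add: X_def poly_subst_single subst_monom_def)

lemmas poly_subst_hom = poly_subst_add poly_subst_mult poly_subst_diff poly_subst_uminus
  poly_subst_power poly_subst_sum poly_subst_prod

lemma monomial_eq_prod:
  "Poly_Mapping.single m (1::int) = (\<Prod>i\<in>Poly_Mapping.keys m. X i ^ Poly_Mapping.lookup m i)"
proof -
  have power: "X i ^ k = Poly_Mapping.single (Poly_Mapping.single i k) 1" for i k
    by (induction k) (simp_all add: X_def mult_single single_add[symmetric])
  have "(\<Prod>i\<in>A. Poly_Mapping.single (h i) (1::int)) = Poly_Mapping.single (\<Sum>i\<in>A. h i) 1"
    for A and h :: "nat \<Rightarrow> (nat \<Rightarrow>\<^sub>0 nat)"
    by (induction A rule: infinite_finite_induct) (simp_all add: mult_single)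
  moreover have "m = (\<Sum>i\<in>Poly_Mapping.keys m. Poly_Mapping.single i (Poly_Mapping.lookup m i))"
  proof (rule poly_mapping_eqI)
    fix k
    have "Poly_Mapping.lookup (\<Sum>i\<in>Poly_Mapping.keys m. Poly_Mapping.single i (Poly_Mapping.lookup m i)) k
        = (\<Sum>i\<in>Poly_Mapping.keys m. if i = k then Poly_Mapping.lookup m i else 0)"
      by (simp add: lookup_sum lookup_single when_def)
    also have "\<dots> = Poly_Mapping.lookup m k" by (auto simp: sum.delta in_keys_iff)
    finally show "Poly_Mapping.lookup m k
        = Poly_Mapping.lookup (\<Sum>i\<in>Poly_Mapping.keys m. Poly_Mapping.single i (Poly_Mapping.lookup m i)) k"
      by simp
  qed
  ultimately show ?thesis by (simp add: power)
qed

lemma zpoly_induct [case_names const X add mult]: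
  fixes f :: zpoly
  assumes c: "\<And>k. P (of_int k)" and x: "\<And>i. P (X i)"
    and a: "\<And>f g. P f \<Longrightarrow> P g \<Longrightarrow> P (f + g)" and m: "\<And>f g. P f \<Longrightarrow> P g \<Longrightarrow> P (f * g)"
  shows "P f"
proof (induction f rule: zpoly_additive_induct)
  case (single k c)
  have one: "P 1" using c[of 1] by simp
  have pow: "P (X i ^ d)" for i d by (induction d) (auto intro: one m x)
  have "P (\<Prod>i\<in>A. X i ^ h i)" for A and h :: "nat \<Rightarrow> nat"
    by (induction A rule: infinite_finite_induct) (auto intro: one m pow)
  then have "P (of_int c * Poly_Mapping.single k 1)"
    unfolding monomial_eq_prod by (intro m c)
  moreover have "of_int c * Poly_Mapping.single k (1::int) = Poly_Mapping.single k c"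
    by (simp add: of_int_zpoly mult_single)
  ultimately show ?case by simp
qed (rule a)

lemma poly_subst_comp:
  "poly_subst \<sigma> (poly_subst \<tau> f) = poly_subst (\<lambda>i. poly_subst \<sigma> (\<tau> i)) f"
  by (induction f rule: zpoly_induct) (simp_all add: poly_subst_hom)

lemma poly_subst_ident: "poly_subst X f = f"
  by (induction f rule: zpoly_induct) (simp_all add: poly_subst_hom)

lemma X_eq_iff [simp]: "X i = X j \<longleftrightarrow> i = j"
  by (metis X_def keys_single singleton_inject zero_neq_one)

lemma X_neq_zero [simp]: "X i \<noteq> 0"
  by (metis X_def lookup_single_eq lookup_zero zero_neq_one)


section \<open>The order of vanishing at the origin\<close>

definition total_degree :: "(nat \<Rightarrow>\<^sub>0 nat) \<Rightarrow> nat" where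
  "total_degree m = (\<Sum>i\<in>Poly_Mapping.keys m. Poly_Mapping.lookup m i)"

lemma total_degree_superset:
  assumes "finite A" "Poly_Mapping.keys m \<subseteq> A"
  shows "total_degree m = (\<Sum>i\<in>A. Poly_Mapping.lookup m i)"
  unfolding total_degree_def using assms
  by (intro sum.mono_neutral_left) (auto simp: in_keys_iff)

lemma total_degree_add: "total_degree (m + k) = total_degree m + total_degree k"
proof -
  let ?A = "Poly_Mapping.keys m \<union> Poly_Mapping.keys k"
  have "total_degree (m + k) = (\<Sum>i\<in>?A. Poly_Mapping.lookup (m + k) i)"
    using keys_add[of m k] by (intro total_degree_superset) auto
  moreover have "total_degree m = (\<Sum>i\<in>?A. Poly_Mapping.lookup m i)"
    "total_degree k = (\<Sum>i\<in>?A. Poly_Mapping.lookup k i)"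
    by (auto intro!: total_degree_superset)
  ultimately show ?thesis by (simp add: lookup_add sum.distrib)
qed

text \<open>
  Membership in the $d$-th power of the ideal generated by all variables. Demazure operators
  lower this order by at most one, so that it bounds lengths of permutations from their
  polynomials.
\<close>

definition vanishes_to_order :: "nat \<Rightarrow> zpoly \<Rightarrow> bool" where
  "vanishes_to_order d f \<longleftrightarrow> (\<forall>m\<in>Poly_Mapping.keys f. d \<le> total_degree m)"

lemma vanishes_to_order_zero [simp]: "vanishes_to_order d 0"
  by (simp add: vanishes_to_order_def)

lemma vanishes_to_order_0 [simp]: "vanishes_to_order 0 f"
  by (simp add: vanishes_to_order_def)

lemma vanishes_to_order_mono: "vanishes_to_order d f \<Longrightarrow> e \<le> d \<Longrightarrow> vanishes_to_order e f"
  by (auto simp: vanishes_to_order_def)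

lemma vanishes_to_order_add:
  "vanishes_to_order d f \<Longrightarrow> vanishes_to_order d g \<Longrightarrow> vanishes_to_order d (f + g)"
  using keys_add[of f g] by (auto simp: vanishes_to_order_def)

lemma vanishes_to_order_mult:
  "vanishes_to_order d f \<Longrightarrow> vanishes_to_order e g \<Longrightarrow> vanishes_to_order (d + e) (f * g)"
  using keys_mult[of f g] by (fastforce simp: vanishes_to_order_def total_degree_add intro: add_mono)

lemma vanishes_to_order_X: "vanishes_to_order 1 (X i)"
  by (simp add: vanishes_to_order_def X_def total_degree_def)

lemma vanishes_to_order_X_power: "vanishes_to_order k (X i ^ k)"
  using vanishes_to_order_mult[OF vanishes_to_order_X] by (induction k) auto

lemma vanishes_to_order_prod:
  "(\<And>a. a \<in> A \<Longrightarrow> vanishes_to_order (d a) (F a)) \<Longrightarrow>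
     vanishes_to_order (\<Sum>a\<in>A. d a) (\<Prod>a\<in>A. F a)"
  by (induction A rule: infinite_finite_induct) (auto intro: vanishes_to_order_mult)

lemma constant_term_eq_0: "vanishes_to_order (Suc d) f \<Longrightarrow> Poly_Mapping.lookup f 0 = 0"
  by (force simp: vanishes_to_order_def in_keys_iff total_degree_def)

section \<open>Demazure operators\<close>

lemma swap_vars_X [simp]: "swap_vars i (X j) = X (simple_transp i j)"
  by (simp add: swap_vars_def)

lemma swap_vars_one [simp]: "swap_vars i 1 = 1"
  by (simp add: swap_vars_def)

lemma swap_vars_of_int [simp]: "swap_vars i (of_int k) = of_int k"
  by (simp add: swap_vars_def)

lemma swap_vars_add: "swap_vars i (f + g) = swap_vars i f + swap_vars i g"
  and swap_vars_mult: "swap_vars i (f * g) = swap_vars i f * swap_vars i g"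
  and swap_vars_diff: "swap_vars i (f - g) = swap_vars i f - swap_vars i g"
  and swap_vars_power: "swap_vars i (f ^ k) = swap_vars i f ^ k"
  and swap_vars_prod: "swap_vars i (\<Prod>a\<in>A. F a) = (\<Prod>a\<in>A. swap_vars i (F a))"
  by (simp_all add: swap_vars_def poly_subst_hom)

lemmas swap_vars_hom = swap_vars_add swap_vars_mult swap_vars_diff swap_vars_power swap_vars_prod

lemma simple_transp_simps [simp]:
  "simple_transp i i = Suc i" "simple_transp i (Suc i) = i"
  "j \<noteq> i \<Longrightarrow> j \<noteq> Suc i \<Longrightarrow> simple_transp i j = j"
  by (simp_all add: simple_transp_def)

lemma simple_transp_invol [simp]: "simple_transp i (simple_transp i j) = j"
  by (simp add: simple_transp_def)

lemma simple_transp_comp_self [simp]: "simple_transp i \<circ> simple_transp i = id"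
  by (simp add: fun_eq_iff)

lemma simple_transp_commute:
  "Suc i < j \<Longrightarrow> simple_transp i (simple_transp j k) = simple_transp j (simple_transp i k)"
  by (auto simp: simple_transp_def transpose_def)

lemma simple_transp_braid:
  "simple_transp i (simple_transp (Suc i) (simple_transp i k))
     = simple_transp (Suc i) (simple_transp i (simple_transp (Suc i) k))"
  by (auto simp: simple_transp_def transpose_def)

lemma swap_vars_invol [simp]: "swap_vars i (swap_vars i f) = f"
  by (simp add: swap_vars_def poly_subst_comp poly_subst_ident)

lemma swap_vars_commute:
  "Suc i < j \<Longrightarrow> swap_vars i (swap_vars j f) = swap_vars j (swap_vars i f)"
proof -
  assume "Suc i < j"
  then have "(\<lambda>k. X (simple_transp j (simple_transp i k))) = (\<lambda>k. X (simple_transp i (simple_transp j k)))"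
    by (intro ext arg_cong[of _ _ X]) (rule simple_transp_commute[symmetric])
  then show ?thesis by (simp add: swap_vars_def poly_subst_comp)
qed

lemma swap_vars_braid:
  "swap_vars i (swap_vars (Suc i) (swap_vars i f))
     = swap_vars (Suc i) (swap_vars i (swap_vars (Suc i) f))"
  by (simp add: swap_vars_def poly_subst_comp simple_transp_braid)

text \<open>
  The divided difference $(f - s_i f)/(x_i - x_{i+1})$ exists and has order at least $d - 1$.
  The orders of $f$ and $s_i f$ are part of the predicate because the product rule below mixes
  them.
\<close>

definition divisible_difference :: "nat \<Rightarrow> nat \<Rightarrow> zpoly \<Rightarrow> bool" where
  "divisible_difference i d f \<longleftrightarrow> vanishes_to_order d f \<and> vanishes_to_order d (swap_vars i f) \<and>
     (\<exists>g. vanishes_to_order (d - 1) g \<and> f - swap_vars i f = (X i - X (Suc i)) * g)"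

lemma divisible_difference_add:
  assumes "divisible_difference i d f" "divisible_difference i d h"
  shows "divisible_difference i d (f + h)"
proof -
  from assms obtain f' h' where *: "vanishes_to_order (d - 1) f'" "vanishes_to_order (d - 1) h'"
    "f - swap_vars i f = (X i - X (Suc i)) * f'" "h - swap_vars i h = (X i - X (Suc i)) * h'"
    unfolding divisible_difference_def by blast
  have "f + h - swap_vars i (f + h) = (X i - X (Suc i)) * (f' + h')"
    using *(3,4) by (simp add: swap_vars_add algebra_simps)
  with assms *(1,2) show ?thesis
    unfolding divisible_difference_def swap_vars_add by (blast intro: vanishes_to_order_add)
qed

text \<open>
  The twisted Leibniz rule $f h - s_i(f h) = f (h - s_i h) + (f - s_i f)\, s_i h$ passes the
  property to products, hence from single variables to all monomials.
\<close>

lemma divisible_difference_mult: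
  assumes "divisible_difference i d f" "divisible_difference i e h"
  shows "divisible_difference i (d + e) (f * h)"
proof -
  from assms obtain f' h' where *: "vanishes_to_order (d - 1) f'" "vanishes_to_order (e - 1) h'"
    "f - swap_vars i f = (X i - X (Suc i)) * f'" "h - swap_vars i h = (X i - X (Suc i)) * h'"
    unfolding divisible_difference_def by blast
  have "f * h - swap_vars i (f * h)
      = f * (h - swap_vars i h) + (f - swap_vars i f) * swap_vars i h"
    by (simp add: swap_vars_mult algebra_simps)
  also have "\<dots> = (X i - X (Suc i)) * (f * h' + f' * swap_vars i h)"
    unfolding *(3,4) by (simp add: algebra_simps)
  finally have eq: "f * h - swap_vars i (f * h)
      = (X i - X (Suc i)) * (f * h' + f' * swap_vars i h)" .
  have "vanishes_to_order (d + e - 1) (f * h')" "vanishes_to_order (d + e - 1) (f' * swap_vars i h)"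
    using assms vanishes_to_order_mult[OF _ *(2), of d f]
      vanishes_to_order_mult[OF *(1), of e "swap_vars i h"]
    by (auto simp: divisible_difference_def elim: vanishes_to_order_mono)
  then have "vanishes_to_order (d + e - 1) (f * h' + f' * swap_vars i h)"
    by (rule vanishes_to_order_add)
  with eq assms show ?thesis
    unfolding divisible_difference_def swap_vars_mult by (blast intro: vanishes_to_order_mult)
qed

lemma divisible_difference_of_int: "divisible_difference i 0 (of_int k)"
  by (auto simp: divisible_difference_def)

lemma divisible_difference_X: "divisible_difference i 1 (X j)"
proof -
  consider "j = i" | "j = Suc i" | "simple_transp i j = j"
    by (cases "j = i \<or> j = Suc i") auto
  then have "\<exists>g. X j - X (simple_transp i j) = (X i - X (Suc i)) * g"
  proof cases
    case 1
    then show ?thesis by (intro exI[of _ 1]) simp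
  next
    case 2
    then show ?thesis by (intro exI[of _ "-1"]) simp
  next
    case 3
    then show ?thesis by (intro exI[of _ 0]) simp
  qed
  then show ?thesis
    using vanishes_to_order_X by (simp add: divisible_difference_def)
qed

lemma divisible_difference_single: "divisible_difference i (total_degree m) (Poly_Mapping.single m c)"
proof -
  have pow: "divisible_difference i d (X j ^ d)" for j d
  proof (induction d)
    case 0
    show ?case using divisible_difference_of_int[of i 1] by simp
  next
    case (Suc d)
    then show ?case using divisible_difference_mult[OF divisible_difference_X] by fastforce
  qed
  have "divisible_difference i (\<Sum>j\<in>A. h j) (\<Prod>j\<in>A. X j ^ h j)"
    for A and h :: "nat \<Rightarrow> nat"
  proof (induction A rule: infinite_finite_induct)
    case (insert x F)
    then show ?case using divisible_difference_mult[OF pow] by simp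
  qed (use divisible_difference_of_int[of i 1] in simp_all)
  then have "divisible_difference i (0 + total_degree m) (of_int c * Poly_Mapping.single m 1)"
    unfolding monomial_eq_prod total_degree_def
    by (intro divisible_difference_mult divisible_difference_of_int)
  then show ?thesis by (simp add: of_int_zpoly mult_single)
qed

lemma divisible_difference:
  assumes "vanishes_to_order d f"
  shows "divisible_difference i d f"
proof -
  have mono: "divisible_difference i e g \<Longrightarrow> d \<le> e \<Longrightarrow> divisible_difference i d g" for e g
    by (force simp: divisible_difference_def intro: vanishes_to_order_mono)
  have zero: "divisible_difference i d 0"
    using swap_vars_of_int[of i 0] by (auto simp: divisible_difference_def intro: exI[of _ 0])
  have "divisible_difference i d (\<Sum>m\<in>A. Poly_Mapping.single m (h m))"
    if "\<And>m. m \<in> A \<Longrightarrow> d \<le> total_degree m" for A and h :: "(nat \<Rightarrow>\<^sub>0 nat) \<Rightarrow> int"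
    using that
    by (induction A rule: infinite_finite_induct)
      (auto intro!: zero divisible_difference_add mono[OF divisible_difference_single])
  with assms show ?thesis
    by (subst zpoly_eq_sum_single) (simp add: vanishes_to_order_def)
qed

lemma demazure_unique:
  assumes "(X i - X (Suc i)) * g = (1 - X (Suc i)) * f - (1 - X i) * swap_vars i f"
  shows "demazure i f = g"
  unfolding demazure_def
proof (rule the_equality)
  show eq: "(X i - X (i + 1)) * g = (1 - X (i + 1)) * f - swap_vars i ((1 - X (i + 1)) * f)"
    using assms by (simp add: swap_vars_hom)
  show "h = g" if "(X i - X (i + 1)) * h
      = (1 - X (i + 1)) * f - swap_vars i ((1 - X (i + 1)) * f)" for h
  proof -
    have "(X i - X (i + 1)) * h = (X i - X (i + 1)) * g" using that eq by simp
    then show ?thesis by simp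
  qed
qed

text \<open>
  With the divided difference $\partial_i$ one has $\pi_i f = f + (1 - x_i)\, \partial_i f$. In
  this form it is visible that the order of vanishing drops by at most one.
\<close>

lemma demazure_exists:
  assumes "vanishes_to_order d f"
  shows "\<exists>g. vanishes_to_order (d - 1) g \<and>
    (X i - X (Suc i)) * g = (1 - X (Suc i)) * f - (1 - X i) * swap_vars i f"
proof -
  from assms obtain h where h: "vanishes_to_order (d - 1) h"
    "f - swap_vars i f = (X i - X (Suc i)) * h"
    using divisible_difference[OF assms, of i] unfolding divisible_difference_def by blast
  \<comment> \<open>The formula $\pi_i f = f + (1 - x_i)\, \partial_i f$.\<close>
  let ?g = "f + (1 - X i) * h"
  have "(X i - X (Suc i)) * ?g = (X i - X (Suc i)) * f + (1 - X i) * ((X i - X (Suc i)) * h)"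
    by (simp add: algebra_simps)
  also have "\<dots> = (1 - X (Suc i)) * f - (1 - X i) * swap_vars i f"
    unfolding h(2)[symmetric] by (simp add: algebra_simps)
  finally have "(X i - X (Suc i)) * ?g = (1 - X (Suc i)) * f - (1 - X i) * swap_vars i f" .
  moreover have "vanishes_to_order (d - 1) ?g"
    using vanishes_to_order_mult[OF vanishes_to_order_0 h(1), of "1 - X i"] assms
    by (auto intro!: vanishes_to_order_add elim: vanishes_to_order_mono)
  ultimately show ?thesis by blast
qed

lemma demazure_eq:
  "(X i - X (Suc i)) * demazure i f = (1 - X (Suc i)) * f - (1 - X i) * swap_vars i f"
proof -
  obtain g where g: "(X i - X (Suc i)) * g = (1 - X (Suc i)) * f - (1 - X i) * swap_vars i f"
    using demazure_exists[OF vanishes_to_order_0, of i f] by blast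
  with demazure_unique[OF g] show ?thesis by simp
qed

lemma vanishes_to_order_demazure:
  assumes "vanishes_to_order d f"
  shows "vanishes_to_order (d - 1) (demazure i f)"
  using demazure_exists[OF assms, of i] demazure_unique by metis

lemma demazure_add: "demazure i (f + g) = demazure i f + demazure i g"
  by (rule demazure_unique) (simp add: demazure_eq distrib_left swap_vars_hom)

lemma demazure_symmetric_mult:
  "swap_vars i c = c \<Longrightarrow> demazure i (c * f) = c * demazure i f"
  by (rule demazure_unique)
    (simp add: demazure_eq mult.left_commute[of _ c] swap_vars_hom right_diff_distrib)

lemma demazure_diff: "demazure i (f - g) = demazure i f - demazure i g"
  by (rule demazure_unique) (simp add: demazure_eq right_diff_distrib swap_vars_hom)

lemma demazure_zero [simp]: "demazure i 0 = 0"
  using demazure_diff[of i 0 0] by simp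

lemma demazure_of_int_mult: "demazure i (of_int k * f) = of_int k * demazure i f"
  by (rule demazure_symmetric_mult) simp

lemma demazure_sum: "demazure i (\<Sum>a\<in>A. F a) = (\<Sum>a\<in>A. demazure i (F a))"
  by (induction A rule: infinite_finite_induct) (simp_all add: demazure_add)

lemma demazure_one: "demazure i 1 = 1"
  by (rule demazure_unique) simp

lemma demazure_symmetric: "swap_vars i f = f \<Longrightarrow> demazure i f = f"
  using demazure_symmetric_mult[of i f 1] by (simp add: demazure_one)

lemma swap_vars_demazure: "swap_vars i (demazure i f) = demazure i f"
proof -
  have "swap_vars i ((X i - X (Suc i)) * demazure i f)
      = swap_vars i ((1 - X (Suc i)) * f - (1 - X i) * swap_vars i f)"
    by (simp add: demazure_eq)
  then have "(X (Suc i) - X i) * swap_vars i (demazure i f)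
      = (1 - X i) * swap_vars i f - (1 - X (Suc i)) * f"
    by (simp add: swap_vars_hom)
  then have "- ((X (Suc i) - X i) * swap_vars i (demazure i f))
      = (1 - X (Suc i)) * f - (1 - X i) * swap_vars i f"
    by simp
  then have "(X i - X (Suc i)) * swap_vars i (demazure i f)
      = (1 - X (Suc i)) * f - (1 - X i) * swap_vars i f"
    by (simp only: mult_minus_left[symmetric] minus_diff_eq)
  then have "(X i - X (Suc i)) * swap_vars i (demazure i f) = (X i - X (Suc i)) * demazure i f"
    by (simp only: demazure_eq)
  then show ?thesis by simp
qed

lemma demazure_idem: "demazure i (demazure i f) = demazure i f"
  by (rule demazure_symmetric) (rule swap_vars_demazure)

lemma demazure_lowest: "swap_vars i h = h \<Longrightarrow> demazure i (X i * h) = h"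
  by (rule demazure_unique) (simp add: swap_vars_hom algebra_simps)

text \<open>
  The Leibniz rule $(1 - x_i) \pi_i = (\pi_i - 1) (1 - x_{i+1})$: a factor $1 - x_i$ moves
  through $\pi_i$ at the price of raising its index and replacing $\pi_i$ by $\pi_i - 1$.
\<close>

lemma one_minus_X_demazure:
  "(1 - X i) * demazure i f
     = demazure i ((1 - X (Suc i)) * f) - (1 - X (Suc i)) * f"
proof -
  have "demazure i ((1 - X (Suc i)) * f) = (1 - X i) * demazure i f + (1 - X (Suc i)) * f"
  proof (rule demazure_unique)
    have "(X i - X (Suc i)) * ((1 - X i) * demazure i f + (1 - X (Suc i)) * f)
        = (1 - X i) * ((X i - X (Suc i)) * demazure i f) + (X i - X (Suc i)) * ((1 - X (Suc i)) * f)"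
      by (simp add: algebra_simps)
    also have "\<dots> = (1 - X (Suc i)) * ((1 - X (Suc i)) * f)
        - (1 - X i) * swap_vars i ((1 - X (Suc i)) * f)"
      unfolding demazure_eq by (simp add: swap_vars_hom algebra_simps)
    finally show "(X i - X (Suc i)) * ((1 - X i) * demazure i f + (1 - X (Suc i)) * f)
        = (1 - X (Suc i)) * ((1 - X (Suc i)) * f)
        - (1 - X i) * swap_vars i ((1 - X (Suc i)) * f)" .
  qed
  then show ?thesis by simp
qed

lemma demazure_commute:
  assumes "Suc i < j"
  shows "demazure i (demazure j f) = demazure j (demazure i f)"
proof -
  let ?D = "X i - X (Suc i)" and ?E = "X j - X (Suc j)"
  have sw: "swap_vars i ?E = ?E" "swap_vars i (X j) = X j" "swap_vars i (X (Suc j)) = X (Suc j)"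
    "swap_vars j ?D = ?D" "swap_vars j (X i) = X i" "swap_vars j (X (Suc i)) = X (Suc i)"
    using assms by (simp_all add: swap_vars_diff)
  have "?D * (?E * swap_vars i (demazure j f)) = ?D * ((1 - X (Suc j)) * swap_vars i f
      - (1 - X j) * swap_vars i (swap_vars j f))"
    using arg_cong[OF demazure_eq[of j f], of "swap_vars i"] sw by (simp add: swap_vars_hom)
  then have 1: "?E * swap_vars i (demazure j f) = (1 - X (Suc j)) * swap_vars i f
      - (1 - X j) * swap_vars i (swap_vars j f)"
    by simp
  have 2: "?D * swap_vars j (demazure i f) = (1 - X (Suc i)) * swap_vars j f
      - (1 - X i) * swap_vars i (swap_vars j f)"
    using arg_cong[OF demazure_eq[of i f], of "swap_vars j"] sw
    by (simp add: swap_vars_hom swap_vars_commute[OF assms])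
  have "?E * (?D * demazure i (demazure j f))
      = (1 - X (Suc i)) * (?E * demazure j f) - (1 - X i) * (?E * swap_vars i (demazure j f))"
    unfolding demazure_eq[of i] by (simp only: right_diff_distrib mult.left_commute)
  also have "\<dots> = (1 - X (Suc j)) * (?D * demazure i f) - (1 - X j) * (?D * swap_vars j (demazure i f))"
    unfolding 1 2 demazure_eq by (simp only: right_diff_distrib mult.left_commute) (simp add: algebra_simps)
  also have "\<dots> = ?D * (?E * demazure j (demazure i f))"
    unfolding demazure_eq[of j] by (simp only: right_diff_distrib mult.left_commute)
  finally show ?thesis using assms by (simp add: mult.left_commute)
qed

text \<open>
  Multiplied by the Vandermonde product $(a - b)(a - c)(b - c)$ of the three variables involved,
  both sides become the same alternating sum over the six permutations of these variables.
\<close>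

lemma demazure_braid:
  "demazure i (demazure (Suc i) (demazure i f)) = demazure (Suc i) (demazure i (demazure (Suc i) f))"
proof -
  let ?j = "Suc i"
  define a b c where "a = X i" and "b = X ?j" and "c = X (Suc ?j)"
  have sw: "swap_vars i a = b" "swap_vars i b = a" "swap_vars i c = c"
    "swap_vars ?j a = a" "swap_vars ?j b = c" "swap_vars ?j c = b"
    by (simp_all add: a_def b_def c_def)
  have I: "(a - b) * demazure i h = (1 - b) * h - (1 - a) * swap_vars i h" for h
    unfolding a_def b_def by (rule demazure_eq)
  have J: "(b - c) * demazure ?j h = (1 - c) * h - (1 - b) * swap_vars ?j h" for h
    unfolding b_def c_def by (rule demazure_eq)
  have IJ: "(a - c) * swap_vars i (demazure ?j h)
      = (1 - c) * swap_vars i h - (1 - a) * swap_vars i (swap_vars ?j h)" for h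
    using arg_cong[OF J[of h], of "swap_vars i"] by (simp add: swap_vars_hom sw)
  have JI: "(a - c) * swap_vars ?j (demazure i h)
      = (1 - c) * swap_vars ?j h - (1 - a) * swap_vars ?j (swap_vars i h)" for h
    using arg_cong[OF I[of h], of "swap_vars ?j"] by (simp add: swap_vars_hom sw)
  have IJI: "(b - c) * swap_vars i (swap_vars ?j (demazure i h))
      = (1 - c) * swap_vars i (swap_vars ?j h) - (1 - b) * swap_vars i (swap_vars ?j (swap_vars i h))" for h
    using arg_cong[OF JI[of h], of "swap_vars i"] by (simp add: swap_vars_hom sw)
  have JIJ: "(a - b) * swap_vars ?j (swap_vars i (demazure ?j h))
      = (1 - b) * swap_vars ?j (swap_vars i h) - (1 - a) * swap_vars ?j (swap_vars i (swap_vars ?j h))" for h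
    using arg_cong[OF IJ[of h], of "swap_vars ?j"] by (simp add: swap_vars_hom sw)
  define alt where "alt = (1 - b) * (1 - c) * (1 - c) * f
        - (1 - a) * (1 - c) * (1 - c) * swap_vars i f
        - (1 - b) * (1 - b) * (1 - c) * swap_vars ?j f
        + (1 - a) * (1 - a) * (1 - c) * swap_vars i (swap_vars ?j f)
        + (1 - a) * (1 - b) * (1 - b) * swap_vars ?j (swap_vars i f)
        - (1 - a) * (1 - a) * (1 - b) * swap_vars i (swap_vars ?j (swap_vars i f))"
  \<comment> \<open>Apply the defining equations from the outside to the inside; $s_i \pi_i f = \pi_i f$ merges two terms.\<close>
  have "(a - c) * (b - c) * ((a - b) * demazure i (demazure ?j (demazure i f))) = alt"
  proof -
    define g where "g = demazure i f"
    have s: "swap_vars i g = g" unfolding g_def by (rule swap_vars_demazure)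
    have "(a - c) * (b - c) * ((a - b) * demazure i (demazure ?j g))
        = (1 - b) * (a - c) * ((b - c) * demazure ?j g)
          - (1 - a) * (b - c) * ((a - c) * swap_vars i (demazure ?j g))"
      unfolding I by (simp add: ring_distribs mult_ac)
    also have "\<dots> = (1 - c) * (1 - c) * ((a - b) * g) - (1 - b) * (1 - b) * ((a - c) * swap_vars ?j g)
        + (1 - a) * (1 - a) * ((b - c) * swap_vars i (swap_vars ?j g))"
      unfolding J IJ s by (simp add: algebra_simps)
    also have "\<dots> = alt"
      unfolding g_def I JI IJI alt_def by (simp add: algebra_simps)
    finally show ?thesis unfolding g_def .
  qed
  moreover have "(a - b) * (a - c) * ((b - c) * demazure ?j (demazure i (demazure ?j f))) = alt"
  proof -
    define g where "g = demazure ?j f"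
    have s: "swap_vars ?j g = g" unfolding g_def by (rule swap_vars_demazure)
    have "(a - b) * (a - c) * ((b - c) * demazure ?j (demazure i g))
        = (1 - c) * (a - c) * ((a - b) * demazure i g)
          - (1 - b) * (a - b) * ((a - c) * swap_vars ?j (demazure i g))"
      unfolding J by (simp add: ring_distribs mult_ac)
    also have "\<dots> = (1 - c) * (1 - b) * ((b - c) * g) - (1 - c) * (1 - a) * ((a - c) * swap_vars i g)
        + (1 - b) * (1 - a) * ((a - b) * swap_vars ?j (swap_vars i g))"
      unfolding I JI s by (simp add: algebra_simps)
    also have "\<dots> = alt"
      unfolding g_def J IJ JIJ alt_def swap_vars_braid by (simp add: algebra_simps)
    finally show ?thesis unfolding g_def .
  qed
  moreover have "a - b \<noteq> 0" "a - c \<noteq> 0" "b - c \<noteq> 0"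
    unfolding a_def b_def c_def by simp_all
  ultimately have "((a - b) * (a - c) * (b - c)) * demazure i (demazure ?j (demazure i f))
      = ((a - b) * (a - c) * (b - c)) * demazure ?j (demazure i (demazure ?j f))"
    "(a - b) * (a - c) * (b - c) \<noteq> 0"
    by (simp_all add: mult_ac)
  then show ?thesis by (simp only: mult_cancel_left) simp
qed

section \<open>Length and descents\<close>

definition inversions :: "(nat \<Rightarrow> nat) \<Rightarrow> (nat \<times> nat) set" where
  "inversions w = {(i, j). i < j \<and> w j < w i}"

lemma perm_length_eq: "perm_length w = card (inversions w)"
  by (simp add: perm_length_def inversions_def)

lemma permutes_le: "w permutes {1..n::nat} \<Longrightarrow> i \<le> n \<Longrightarrow> w i \<le> n"
  by (metis atLeastAtMost_iff not_less_eq_eq One_nat_def le_zero_eq permutes_in_image permutes_not_in zero_le)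

lemma permutes_ge: "w permutes {1..n::nat} \<Longrightarrow> n < i \<Longrightarrow> w i = i"
  by (simp add: permutes_not_in)

lemma permutes_zero: "w permutes {1..n::nat} \<Longrightarrow> w 0 = 0"
  by (simp add: permutes_not_in)

lemma inversions_subset:
  assumes "w permutes {1..n}"
  shows "inversions w \<subseteq> {1..n} \<times> {1..n}"
proof
  fix p assume "p \<in> inversions w"
  then obtain i j where ij: "p = (i, j)" "i < j" "w j < w i" by (auto simp: inversions_def)
  have "j \<le> n"
  proof (rule ccontr)
    assume "\<not> j \<le> n"
    then show False
      using ij permutes_ge[OF assms, of j] permutes_ge[OF assms, of i] permutes_le[OF assms, of i]
      by (cases "i \<le> n") auto
  qed
  moreover have "i \<noteq> 0" using ij permutes_zero[OF assms] by (metis not_less_zero)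
  ultimately show "p \<in> {1..n} \<times> {1..n}" using ij by auto
qed

lemma S_infI: "w permutes {1..n} \<Longrightarrow> w \<in> S_inf"
  by (auto simp: S_inf_def)

lemma permutes_mono: "w permutes {1..n::nat} \<Longrightarrow> n \<le> m \<Longrightarrow> w permutes {1..m}"
  by (rule permutes_subset) auto

lemma finite_inversions: "w \<in> S_inf \<Longrightarrow> finite (inversions w)"
  unfolding S_inf_def using inversions_subset finite_subset by blast

lemma S_inf_bij: "w \<in> S_inf \<Longrightarrow> bij w"
  by (auto simp: S_inf_def permutes_bij)

lemma S_inf_inj: "w \<in> S_inf \<Longrightarrow> w i = w j \<longleftrightarrow> i = j"
  by (meson S_inf_bij bij_is_inj inj_eq)

lemma S_inf_common:
  assumes "u \<in> S_inf" "v \<in> S_inf"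
  obtains n where "u permutes {1..n}" "v permutes {1..n}"
proof -
  from assms obtain k m where "u permutes {1..k}" "v permutes {1..m}" by (auto simp: S_inf_def)
  then show ?thesis using permutes_mono[of u k "max k m"] permutes_mono[of v m "max k m"] that by simp
qed

lemma S_inf_comp: "u \<in> S_inf \<Longrightarrow> v \<in> S_inf \<Longrightarrow> u \<circ> v \<in> S_inf"
  by (metis S_inf_common S_infI permutes_compose)

lemma S_inf_inv: "u \<in> S_inf \<Longrightarrow> inv u \<in> S_inf"
  unfolding S_inf_def using permutes_inv by blast

lemma S_inf_id [simp]: "id \<in> S_inf"
  by (auto simp: S_inf_def permutes_id)

lemma simple_transp_permutes: "1 \<le> i \<Longrightarrow> i < n \<Longrightarrow> simple_transp i permutes {1..n}"
  unfolding simple_transp_def by (rule permutes_swap_id) auto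

lemma simple_transp_S_inf: "1 \<le> i \<Longrightarrow> simple_transp i \<in> S_inf"
  using simple_transp_permutes[of i "Suc i"] by (auto intro: S_infI)

lemma simple_transp_less:
  "a < b \<Longrightarrow> (a, b) \<noteq> (i, Suc i) \<Longrightarrow> simple_transp i a < simple_transp i b"
  by (auto simp: simple_transp_def transpose_def)

lemma inv_simple_transp_comp:
  assumes "w \<in> S_inf" "1 \<le> i"
  shows "inv (simple_transp i \<circ> w) = inv w \<circ> simple_transp i"
    and "inv (w \<circ> simple_transp i) = simple_transp i \<circ> inv w"
proof -
  have inv: "inv (simple_transp i) = simple_transp i"
    unfolding simple_transp_def by simp
  have "bij (simple_transp i)" using simple_transp_S_inf[OF assms(2)] by (rule S_inf_bij)
  then show "inv (simple_transp i \<circ> w) = inv w \<circ> simple_transp i"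
    and "inv (w \<circ> simple_transp i) = simple_transp i \<circ> inv w"
    using S_inf_bij[OF assms(1)] by (simp_all add: o_inv_distrib inv)
qed

text \<open>
  Exchanging the positions $i$ and $i+1$ keeps the relative position of every pair of positions
  except $(i, i+1)$ itself, which becomes an inversion.
\<close>

lemma perm_length_comp_simple_transp:
  assumes "w \<in> S_inf" "w i < w (Suc i)"
  shows "perm_length (w \<circ> simple_transp i) = Suc (perm_length w)"
proof -
  let ?s = "simple_transp i"
  have mem: "(?s a, ?s b) \<in> inversions w" if "(a, b) \<in> inversions (w \<circ> ?s)" "(a, b) \<noteq> (i, Suc i)" for a b
    using that simple_transp_less[of a b i] by (auto simp: inversions_def)
  have mem': "(?s a, ?s b) \<in> inversions (w \<circ> ?s)" if "(a, b) \<in> inversions w" for a b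
    using that simple_transp_less[of a b i] assms(2)
    by (cases "(a, b) = (i, Suc i)") (auto simp: inversions_def)
  have "inversions (w \<circ> ?s) = insert (i, Suc i) (map_prod ?s ?s ` inversions w)"
  proof (intro equalityI subsetI)
    fix p assume p: "p \<in> inversions (w \<circ> ?s)"
    obtain a b where ab: "p = (a, b)" by force
    show "p \<in> insert (i, Suc i) (map_prod ?s ?s ` inversions w)"
    proof (cases "(a, b) = (i, Suc i)")
      case False
      then have "(?s a, ?s b) \<in> inversions w" using p ab mem by blast
      moreover have "p = map_prod ?s ?s (?s a, ?s b)" using ab by simp
      ultimately show ?thesis by blast
    qed (use ab in simp)
  next
    fix p assume "p \<in> insert (i, Suc i) (map_prod ?s ?s ` inversions w)"
    then show "p \<in> inversions (w \<circ> ?s)"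
    proof
      assume "p = (i, Suc i)"
      then show ?thesis using assms(2) by (simp add: inversions_def)
    qed (use mem' in auto)
  qed
  moreover have "(i, Suc i) \<notin> map_prod ?s ?s ` inversions w"
  proof
    assume "(i, Suc i) \<in> map_prod ?s ?s ` inversions w"
    then obtain a b where *: "(a, b) \<in> inversions w" "?s a = i" "?s b = Suc i" by auto
    have "a = Suc i" using arg_cong[OF *(2), of ?s] by simp
    moreover have "b = i" using arg_cong[OF *(3), of ?s] by simp
    ultimately show False using *(1) by (simp add: inversions_def)
  qed
  moreover have "inj (map_prod ?s ?s)"
    by (rule prod.inj_map; rule inj_on_inverseI[of _ ?s]) simp_all
  ultimately show ?thesis
    using finite_inversions[OF assms(1)]
    by (simp add: perm_length_eq card_image inj_on_subset[of "map_prod ?s ?s" UNIV])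
qed

lemma perm_length_descent:
  assumes "w \<in> S_inf" "1 \<le> i" "w (Suc i) < w i"
  shows "perm_length w = Suc (perm_length (w \<circ> simple_transp i))"
  using perm_length_comp_simple_transp[of "w \<circ> simple_transp i" i] assms
    S_inf_comp[OF assms(1) simple_transp_S_inf[OF assms(2)]]
  by (simp add: comp_assoc)

text \<open>
  Exchanging the values $i$ and $i+1$ changes the comparison of values only for the pair of
  positions that hold them.
\<close>

lemma perm_length_simple_transp_comp:
  assumes "w \<in> S_inf" "inv w i < inv w (Suc i)"
  shows "perm_length (simple_transp i \<circ> w) = Suc (perm_length w)"
proof -
  let ?s = "simple_transp i"
  have w: "w (inv w k) = k" "inv w (w k) = k" for k
    using S_inf_bij[OF assms(1)] by (simp_all add: bij_is_surj surj_f_inv_f bij_is_inj)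
  have "inversions (?s \<circ> w) = insert (inv w i, inv w (Suc i)) (inversions w)"
  proof (intro equalityI subsetI)
    fix p assume p: "p \<in> inversions (?s \<circ> w)"
    obtain a b where ab: "p = (a, b)" by force
    show "p \<in> insert (inv w i, inv w (Suc i)) (inversions w)"
    proof (cases "p = (inv w i, inv w (Suc i))")
      case False
      have "a < b" "?s (w b) < ?s (w a)" using p ab by (auto simp: inversions_def)
      moreover have "(?s (w b), ?s (w a)) \<noteq> (i, Suc i)"
      proof
        assume "(?s (w b), ?s (w a)) = (i, Suc i)"
        then have "?s (w b) = i" "?s (w a) = Suc i" by simp_all
        then have "w b = Suc i \<and> w a = i"
          using simple_transp_invol[of i "w b"] simple_transp_invol[of i "w a"] by simp
        then have "b = inv w (Suc i)" "a = inv w i" using w(2) by metis+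
        then show False using False ab by simp
      qed
      ultimately show ?thesis
        using simple_transp_less[of "?s (w b)" "?s (w a)" i] ab by (simp add: inversions_def)
    qed simp
  next
    fix p assume p: "p \<in> insert (inv w i, inv w (Suc i)) (inversions w)"
    show "p \<in> inversions (?s \<circ> w)"
    proof (cases "p = (inv w i, inv w (Suc i))")
      case True
      then show ?thesis using assms(2) by (simp add: inversions_def w)
    next
      case False
      then obtain a b where ab: "p = (a, b)" "a < b" "w b < w a" using p by (auto simp: inversions_def)
      have "(w b, w a) \<noteq> (i, Suc i)" using ab assms(2) w by (metis Pair_inject order_less_asym)
      then show ?thesis using ab simple_transp_less[of "w b" "w a" i] by (simp add: inversions_def)
    qed
  qed
  moreover have "(inv w i, inv w (Suc i)) \<notin> inversions w"
    by (simp add: inversions_def w)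
  ultimately show ?thesis
    using finite_inversions[OF assms(1)] by (simp add: perm_length_eq)
qed

lemma perm_length_left_descent:
  assumes "w \<in> S_inf" "1 \<le> i" "inv w (Suc i) < inv w i"
  shows "perm_length w = Suc (perm_length (simple_transp i \<circ> w))"
proof -
  have "perm_length (simple_transp i \<circ> (simple_transp i \<circ> w)) = Suc (perm_length (simple_transp i \<circ> w))"
    using assms by (intro perm_length_simple_transp_comp)
      (simp_all add: S_inf_comp simple_transp_S_inf inv_simple_transp_comp)
  then show ?thesis by (simp add: o_assoc)
qed

lemma perm_length_left_cases:
  assumes "w \<in> S_inf" "1 \<le> i"
  shows "perm_length (simple_transp i \<circ> w) = Suc (perm_length w) \<and> inv w i < inv w (Suc i) \<or>
    perm_length w = Suc (perm_length (simple_transp i \<circ> w)) \<and> inv w (Suc i) < inv w i"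
proof -
  have "inv w i \<noteq> inv w (Suc i)" using S_inf_inj[OF S_inf_inv[OF assms(1)]] by simp
  then show ?thesis
    using perm_length_simple_transp_comp[OF assms(1)] perm_length_left_descent[OF assms] by (metis nat_neq_iff)
qed

lemma descent_bounds:
  assumes "w permutes {1..n}" "w (Suc i) < w i"
  shows "1 \<le> i" "i < n"
proof -
  have "(i, Suc i) \<in> inversions w" using assms by (simp add: inversions_def)
  with inversions_subset[OF assms(1)] show "1 \<le> i" "i < n" by auto
qed

lemma perm_length_le:
  assumes "w permutes {1..n}"
  shows "perm_length w \<le> n * n"
  using card_mono[OF _ inversions_subset[OF assms]] by (simp add: perm_length_eq card_cartesian_product)

text \<open>
  A decreasing function is determined by its image: at the first place of disagreement, the
  larger of the two values would be missing from the image of the other function.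
\<close>

lemma decreasing_functions_equal:
  fixes f g :: "nat \<Rightarrow> nat"
  assumes "\<And>i j. a \<le> i \<Longrightarrow> i < j \<Longrightarrow> j \<le> n \<Longrightarrow> f j < f i"
    and "\<And>i j. a \<le> i \<Longrightarrow> i < j \<Longrightarrow> j \<le> n \<Longrightarrow> g j < g i"
    and "f ` {a..n} = g ` {a..n}" "a \<le> i" "i \<le> n"
  shows "f i = g i"
  using assms(4,5)
proof (induction i rule: less_induct)
  case (less i)
  have *: "\<not> p i < q i"
    if p: "\<And>i j. a \<le> i \<Longrightarrow> i < j \<Longrightarrow> j \<le> n \<Longrightarrow> p j < p i"
      and q: "\<And>i j. a \<le> i \<Longrightarrow> i < j \<Longrightarrow> j \<le> n \<Longrightarrow> q j < q i"
      and im: "q ` {a..n} = p ` {a..n}" and eq: "\<And>j. a \<le> j \<Longrightarrow> j < i \<Longrightarrow> p j = q j"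
    for p q :: "nat \<Rightarrow> nat"
  proof
    assume lt: "p i < q i"
    have "q i \<in> p ` {a..n}" using im less.prems by (metis atLeastAtMost_iff imageI)
    then obtain j where j: "a \<le> j" "j \<le> n" "q i = p j" by auto
    consider "j < i" | "j = i" | "i < j" by linarith
    then show False
    proof cases
      case 1
      then have "q i < p j" using eq[of j] q[of j i] j less.prems by simp
      then show False using j by simp
    next
      case 3
      then show False using p[of i j] j less.prems lt by simp
    qed (use j lt in simp)
  qed
  have "\<not> f i < g i"
    by (rule *[of f g]) (use assms(1-3) less in auto)
  moreover have "\<not> g i < f i"
    by (rule *[of g f]) (use assms(1-3) less in auto)
  ultimately show ?case by simp
qed

lemma decreasing_from_steps:
  fixes f :: "nat \<Rightarrow> nat"
  assumes "\<And>i. a \<le> i \<Longrightarrow> i < n \<Longrightarrow> f (Suc i) < f i"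
  shows "a \<le> i \<Longrightarrow> i < j \<Longrightarrow> j \<le> n \<Longrightarrow> f j < f i"
proof (induction j)
  case (Suc j)
  then show ?case
    using assms[of j] by (cases "i = j") (auto intro: less_trans)
qed simp

text \<open>
  Sorting the entries at the positions $a, a+1, \dots, n$ into decreasing order by adjacent
  exchanges, read backwards. For $a = 1$ the only base case is $\omega_n$; for $a = 2$ the first
  entry stays fixed, which is what the multiplication by $x_1$ needs.
\<close>

lemma permutes_descending_induct [consumes 2, case_names base step]:
  assumes "w permutes {1..n}" and "1 \<le> a"
    and base: "\<And>u. u permutes {1..n} \<Longrightarrow> (\<And>i j. a \<le> i \<Longrightarrow> i < j \<Longrightarrow> j \<le> n \<Longrightarrow> u j < u i) \<Longrightarrow>
        (\<And>i. i < a \<Longrightarrow> u i = w i) \<Longrightarrow> P u"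
    and step: "\<And>u i. u permutes {1..n} \<Longrightarrow> a \<le> i \<Longrightarrow> i < n \<Longrightarrow> u (Suc i) < u i \<Longrightarrow>
        (\<And>j. j < a \<Longrightarrow> u j = w j) \<Longrightarrow> P u \<Longrightarrow> P (u \<circ> simple_transp i)"
  shows "P w"
proof -
  have "P u" if "u permutes {1..n}" "\<And>i. i < a \<Longrightarrow> u i = w i" for u
    using that
  proof (induction "n * n - perm_length u" arbitrary: u rule: less_induct)
    case less
    show ?case
    proof (cases "\<exists>i. a \<le> i \<and> i < n \<and> u i < u (Suc i)")
      case True
      then obtain i where i: "a \<le> i" "i < n" "u i < u (Suc i)" by blast
      let ?v = "u \<circ> simple_transp i"
      have v: "?v permutes {1..n}"
        using less.prems(1) i \<open>1 \<le> a\<close> by (intro permutes_compose simple_transp_permutes) auto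
      have len: "perm_length ?v = Suc (perm_length u)"
        using perm_length_comp_simple_transp[OF S_infI[OF less.prems(1)] i(3)] .
      have agree: "?v j = w j" if "j < a" for j using that i less.prems(2) by simp
      have "n * n - perm_length ?v < n * n - perm_length u"
        using len perm_length_le[OF v] by linarith
      then have Pv: "P ?v" using v agree by (rule less.hyps)
      have "P (?v \<circ> simple_transp i)"
      proof (rule step[OF v i(1,2)])
        show "?v (Suc i) < ?v i" using i(3) by simp
        show "?v j = w j" if "j < a" for j using that by (rule agree)
        show "P ?v" by (rule Pv)
      qed
      then show ?thesis by (simp add: comp_assoc)
    next
      case False
      have "u (Suc i) < u i" if "a \<le> i" "i < n" for i
      proof -
        have "u i \<noteq> u (Suc i)" using S_inf_inj[OF S_infI[OF less.prems(1)], of i "Suc i"] by simp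
        then show ?thesis using False that by (meson nat_neq_iff)
      qed
      then have dec: "u j < u i" if "a \<le> i" "i < j" "j \<le> n" for i j
        using decreasing_from_steps[of a n u i j] that by blast
      show ?thesis using less.prems(1) dec less.prems(2) by (rule base)
    qed
  qed
  then show ?thesis using assms(1) by blast
qed

lemma omega_permutes: "omega n permutes {1..n}"
proof (rule bij_imp_permutes)
  show "bij_betw (omega n) {1..n} {1..n}"
    by (rule bij_betw_byWitness[where f' = "omega n"]) (auto simp: omega_def)
qed (auto simp: omega_def)

lemma permutes_image_tail:
  assumes "u permutes {1..n::nat}" "v permutes {1..n}" "u 1 = v 1"
  shows "u ` {2..n} = v ` {2..n}"
proof -
  have "{2..n} = {1..n} - {1}" by auto
  then show ?thesis
    using assms by (simp add: image_set_diff[OF permutes_inj] permutes_image)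
qed

lemma decreasing_imp_omega:
  assumes "u permutes {1..n}" "\<And>i j. 1 \<le> i \<Longrightarrow> i < j \<Longrightarrow> j \<le> n \<Longrightarrow> u j < u i"
  shows "u = omega n"
proof
  fix i
  show "u i = omega n i"
  proof (cases "i \<in> {1..n}")
    case True
    then show ?thesis
      using assms(2) permutes_image[OF assms(1)] permutes_image[OF omega_permutes[of n]]
      by (intro decreasing_functions_equal[of 1 n]) (auto simp: omega_def)
  next
    case False
    then have "u i = i" by (rule permutes_not_in[OF assms(1)])
    with False show ?thesis by (auto simp: omega_def)
  qed
qed

text \<open>
  Induction through $t_{1,b+1} = s_b\, t_{1,b}\, s_b$: each of the two adjacent exchanges
  changes the length by one, with a sign that depends on the position of $w(b)$ relative to
  $w(1)$ and $w(b+1)$. The signs cancel unless $w(b)$ lies between the other two values.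
\<close>

lemma perm_length_transpose:
  assumes "2 \<le> b" "w \<in> S_inf" "w 1 < w b"
  shows "perm_length (w \<circ> transpose 1 b)
    = Suc (perm_length w) + 2 * card {c. 1 < c \<and> c < b \<and> w 1 < w c \<and> w c < w b}"
  using assms
proof (induction b arbitrary: w rule: nat_induct_at_least)
  case base
  have "{c. 1 < c \<and> c < 2 \<and> w 1 < w c \<and> w c < w 2} = {}" by auto
  then have c: "card {c. 1 < c \<and> c < 2 \<and> w 1 < w c \<and> w c < w 2} = 0" by (simp only: card.empty)
  have "perm_length (w \<circ> simple_transp 1) = Suc (perm_length w)"
    using base by (intro perm_length_comp_simple_transp) (simp_all add: numeral_2_eq_2)
  then show ?case
    unfolding c by (simp only: simple_transp_def one_add_one mult_0_right add_0_right)
next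
  case (Suc b)
  let ?s = "simple_transp b"
  let ?B = "\<lambda>w b. {c. 1 < c \<and> c < b \<and> w 1 < w c \<and> w c < w b}"
  let ?w = "w \<circ> ?s" and ?u = "w \<circ> ?s \<circ> transpose 1 b"
  have b: "1 \<le> b" "b \<noteq> 1" using Suc by auto
  have w: "?w \<in> S_inf" using Suc b by (intro S_inf_comp simple_transp_S_inf)
  have w1: "?w 1 = w 1" "?w b = w (Suc b)" "?w (Suc b) = w b" using b by auto
  have "transpose 1 (Suc b) = ?s \<circ> transpose 1 b \<circ> ?s"
    using b by (auto simp: fun_eq_iff simple_transp_def transpose_def)
  then have eq: "w \<circ> transpose 1 (Suc b) = ?u \<circ> ?s" by (simp add: comp_assoc)
  have "transpose 1 b permutes {1..b}" using b by (intro permutes_swap_id) auto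
  then have u: "?u \<in> S_inf" by (intro S_inf_comp[OF w] S_infI)
  have u1: "?u b = w 1" "?u (Suc b) = w b" using b w1 by (auto simp: transpose_def)
  have "?w 1 < ?w b" using w1 Suc.prems by simp
  with w have lu: "perm_length ?u = Suc (perm_length ?w) + 2 * card (?B ?w b)"
    by (rule Suc.IH)
  have sub: "?B ?w b = {c. 1 < c \<and> c < b \<and> w 1 < w c \<and> w c < w (Suc b)}"
    using w1 b by auto
  have fin: "finite {c. 1 < c \<and> c < b \<and> w 1 < w c \<and> w c < w (Suc b)}"
    by (rule finite_subset[of _ "{..b}"]) auto
  have B: "?B w (Suc b) = (if w 1 < w b \<and> w b < w (Suc b)
      then insert b (?B ?w b) else ?B ?w b)"
    unfolding sub using b by (auto simp: less_Suc_eq)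
  have ne: "w 1 \<noteq> w b" "w b \<noteq> w (Suc b)"
    using S_inf_inj[OF Suc.prems(1)] b by auto
  have "b \<notin> ?B ?w b" by auto
  with B fin sub have cB: "card (?B w (Suc b))
      = card (?B ?w b) + (if w 1 < w b \<and> w b < w (Suc b) then 1 else 0)"
    by auto
  have lw: "w b < w (Suc b) \<Longrightarrow> perm_length ?w = Suc (perm_length w)"
    "w (Suc b) < w b \<Longrightarrow> perm_length w = Suc (perm_length ?w)"
    using perm_length_comp_simple_transp[OF Suc.prems(1)] perm_length_descent[OF Suc.prems(1) b(1)] by auto
  have lus: "w 1 < w b \<Longrightarrow> perm_length (?u \<circ> ?s) = Suc (perm_length ?u)"
    "w b < w 1 \<Longrightarrow> perm_length ?u = Suc (perm_length (?u \<circ> ?s))"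
    using perm_length_comp_simple_transp[OF u, of b] perm_length_descent[OF u b(1)] unfolding u1 by auto
  consider "w 1 < w b" "w b < w (Suc b)" | "w b < w 1" "w b < w (Suc b)"
    | "w 1 < w b" "w (Suc b) < w b"
    using ne Suc.prems(2) by (metis nat_neq_iff less_trans)
  then show ?case
  proof cases
    case 1
    then have "card (?B w (Suc b)) = Suc (card (?B ?w b))" unfolding cB by simp
    then show ?thesis unfolding eq using lw(1)[OF 1(2)] lus(1)[OF 1(1)] lu by linarith
  next
    case 2
    then have "card (?B w (Suc b)) = card (?B ?w b)" unfolding cB by simp
    then show ?thesis unfolding eq using lw(1)[OF 2(2)] lus(2)[OF 2(1)] lu by linarith
  next
    case 3
    then have "card (?B w (Suc b)) = card (?B ?w b)" unfolding cB by simp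
    then show ?thesis unfolding eq using lw(2)[OF 3(2)] lus(1)[OF 3(1)] lu by linarith
  qed
qed

text \<open>
  If $w(1) > w(b)$, then $w$ arises from the shorter permutation $w t_{1,b}$ by the same
  transposition, so that only $w(1) < w(b)$ can give a cover.
\<close>

lemma cover1_iff:
  assumes "w permutes {1..n}"
  shows "cover1 n w b \<longleftrightarrow>
    2 \<le> b \<and> b \<le> n \<and> w 1 < w b \<and> (\<forall>c. 1 < c \<and> c < b \<longrightarrow> \<not> (w 1 < w c \<and> w c < w b))"
proof (cases "2 \<le> b \<and> b \<le> n")
  case True
  have w: "w \<in> S_inf" using assms by (rule S_infI)
  let ?B = "\<lambda>w::nat \<Rightarrow> nat. {c. 1 < c \<and> c < b \<and> w 1 < w c \<and> w c < w b}"
  have fin: "finite (?B w)" by (rule finite_subset[of _ "{..b}"]) auto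
  show ?thesis
  proof (cases "w 1 < w b")
    case less: True
    have "cover1 n w b \<longleftrightarrow> card (?B w) = 0"
      using perm_length_transpose[OF _ w less] True assms by (auto simp: cover1_def)
    also have "\<dots> \<longleftrightarrow> ?B w = {}" using fin by simp
    finally show ?thesis using True less by blast
  next
    case False
    define u where "u = w \<circ> transpose 1 b"
    have "transpose 1 b permutes {1..n}" using True by (intro permutes_swap_id) auto
    then have u: "u \<in> S_inf" unfolding u_def by (intro S_inf_comp[OF w] S_infI)
    have "w 1 \<noteq> w b" using S_inf_inj[OF w] True by auto
    then have "u 1 < u b" using False by (simp add: u_def)
    from perm_length_transpose[OF _ u this] True
    have "perm_length (u \<circ> transpose 1 b) > perm_length u" by linarith
    moreover have "u \<circ> transpose 1 b = w" by (simp add: u_def fun_eq_iff)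
    ultimately have "\<not> cover1 n w b" by (simp add: cover1_def u_def)
    with False show ?thesis by blast
  qed
qed (auto simp: cover1_def)

section \<open>Reduced words\<close>

definition word_prod :: "nat list \<Rightarrow> nat \<Rightarrow> nat" where
  "word_prod is = foldr (\<lambda>i u. simple_transp i \<circ> u) is id"

lemma word_prod_simps [simp]:
  "word_prod [] = id" "word_prod (i # is) = simple_transp i \<circ> word_prod is"
  by (simp_all add: word_prod_def)

lemma reduced_word_iff:
  "reduced_word v is \<longleftrightarrow> (\<forall>i\<in>set is. 1 \<le> i) \<and> v = word_prod is \<and> length is = perm_length v"
  by (simp add: reduced_word_def word_prod_def)

lemma word_prod_S_inf: "\<forall>i\<in>set is. 1 \<le> i \<Longrightarrow> word_prod is \<in> S_inf"
  by (induction "is") (auto intro: S_inf_comp simple_transp_S_inf simp del: One_nat_def)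

lemma perm_length_id [simp]: "perm_length id = 0"
proof -
  have "inversions id = {}" by (auto simp: inversions_def)
  then show ?thesis by (simp add: perm_length_eq)
qed

lemma perm_length_word_prod: "\<forall>i\<in>set is. 1 \<le> i \<Longrightarrow> perm_length (word_prod is) \<le> length is"
proof (induction "is")
  case (Cons i "is")
  then have "perm_length (word_prod is) \<le> length is" "word_prod is \<in> S_inf" "1 \<le> i"
    using word_prod_S_inf by simp_all
  then show ?case
    unfolding word_prod_simps list.size using perm_length_left_cases[of "word_prod is" i] by linarith
qed simp

lemma reduced_word_ConsI:
  assumes "v \<in> S_inf" "1 \<le> i" "inv v (Suc i) < inv v i" "reduced_word (simple_transp i \<circ> v) is"
  shows "reduced_word v (i # is)"
proof -
  have ks: "\<forall>i\<in>set is. 1 \<le> i" "word_prod is = simple_transp i \<circ> v"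
    "length is = perm_length (simple_transp i \<circ> v)"
    using assms(4) unfolding reduced_word_iff by metis+
  have "word_prod (i # is) = v" unfolding word_prod_simps ks(2) by (simp add: fun_eq_iff)
  then show ?thesis
    unfolding reduced_word_iff
    using assms(2) ks(1,3) perm_length_left_descent[OF assms(1-3)] by simp
qed

lemma reduced_word_ConsD:
  assumes "reduced_word v (i # is)"
  shows "1 \<le> i" "inv v (Suc i) < inv v i" "reduced_word (simple_transp i \<circ> v) is"
proof -
  from assms show i: "1 \<le> i" by (simp add: reduced_word_iff)
  from assms have v: "v = simple_transp i \<circ> word_prod is" "Suc (length is) = perm_length v"
    and pos: "\<forall>i\<in>set is. 1 \<le> i" by (auto simp: reduced_word_iff)
  have u: "simple_transp i \<circ> v = word_prod is" unfolding v(1) by (simp add: o_assoc)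
  have S: "v \<in> S_inf" unfolding v(1) using i pos by (intro S_inf_comp simple_transp_S_inf word_prod_S_inf)
  have "perm_length (simple_transp i \<circ> v) \<le> length is"
    unfolding u using pos by (rule perm_length_word_prod)
  with perm_length_left_cases[OF S i] v(2)
  have *: "perm_length v = Suc (perm_length (simple_transp i \<circ> v))" "inv v (Suc i) < inv v i" by auto
  show "inv v (Suc i) < inv v i" by (rule *(2))
  show "reduced_word (simple_transp i \<circ> v) is"
    using u v(2) pos *(1) by (simp add: reduced_word_iff)
qed

text \<open>
  Without a descent, $v^{-1}$ is strictly increasing, and so is $v$; a strictly increasing
  function satisfies $k \le v(k)$, which applied to both leaves only the identity.
\<close>

lemma ex_left_descent:
  assumes "v \<in> S_inf" "v \<noteq> id"
  shows "\<exists>i\<ge>1. inv v (Suc i) < inv v i"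
proof (rule ccontr)
  let ?u = "inv v"
  have Su: "?u \<in> S_inf" using assms(1) by (rule S_inf_inv)
  then obtain n where u: "?u permutes {1..n}" unfolding S_inf_def by blast
  assume no: "\<not> ?thesis"
  have "?u i < ?u (Suc i)" for i
  proof (cases "i = 0")
    case True
    then show ?thesis using permutes_zero[OF u] S_inf_inj[OF Su, of 0 "Suc 0"] by simp
  next
    case False
    then have "\<not> ?u (Suc i) < ?u i" using no by simp
    then show ?thesis using S_inf_inj[OF Su, of i "Suc i"] by simp
  qed
  then have mono: "strict_mono ?u" by (simp add: strict_mono_Suc_iff)
  have uv: "?u (v k) = k" "v (?u k) = k" for k
    using S_inf_bij[OF assms(1)] by (simp_all add: bij_is_inj bij_is_surj surj_f_inv_f)
  have "strict_mono v"
  proof (rule strict_monoI)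
    fix a b :: nat assume "a < b"
    then have "?u (v a) < ?u (v b)" by (simp add: uv)
    then show "v a < v b" using mono by (simp add: strict_mono_less)
  qed
  then have "?u k \<le> k" "k \<le> ?u k" for k
    using strict_mono_imp_increasing[of v "?u k"] strict_mono_imp_increasing[OF mono, of k]
    by (simp_all add: uv)
  then have "?u k = k" for k by (simp add: antisym)
  then have "v k = k" for k using uv(2)[of k] by simp
  then show False using assms(2) by auto
qed

lemma ex_reduced_word: "v \<in> S_inf \<Longrightarrow> \<exists>is. reduced_word v is"
proof (induction "perm_length v" arbitrary: v rule: less_induct)
  case less
  show ?case
  proof (cases "v = id")
    case True
    then have "reduced_word v []" by (simp add: reduced_word_iff)
    then show ?thesis by blast
  next
    case False
    then obtain i where i: "1 \<le> i" "inv v (Suc i) < inv v i"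
      using ex_left_descent[OF less.prems] by blast
    have "perm_length (simple_transp i \<circ> v) < perm_length v"
      using perm_length_left_descent[OF less.prems i] by simp
    then obtain ks where "reduced_word (simple_transp i \<circ> v) ks"
      using less.hyps S_inf_comp[OF simple_transp_S_inf[OF i(1)] less.prems] by blast
    then show ?thesis using reduced_word_ConsI[OF less.prems i] by blast
  qed
qed

definition demazure_word :: "nat list \<Rightarrow> zpoly \<Rightarrow> zpoly" where
  "demazure_word is f = foldr demazure is f"

lemma demazure_word_simps [simp]:
  "demazure_word [] f = f" "demazure_word (i # is) f = demazure i (demazure_word is f)"
  by (simp_all add: demazure_word_def)

text \<open>
  Matsumoto's theorem for the Demazure operators. If two reduced words of $v$ begin with
  different letters $a < b$, then $v$ has both as left descents, and so has a reduced word that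
  begins with $a\,b$ and one that begins with $b\,a$ (if $b > a+1$), or with $a\,b\,a$ and
  $b\,a\,b$ (if $b = a+1$), followed by the same word in both cases. The induction hypothesis
  compares each given word with the new one that shares its first letter, and the two new ones
  agree by the commutation or the braid relation.
\<close>

lemma reduced_words_agree:
  assumes "v \<in> S_inf" "reduced_word v is" "reduced_word v js"
  shows "demazure_word is f = demazure_word js f"
  using assms
proof (induction "length is" arbitrary: v "is" js rule: less_induct)
  case less
  note S = \<open>v \<in> S_inf\<close>
  have len: "length is = length js" using less.prems by (simp add: reduced_word_iff)
  show ?case
  proof (cases "is")
    case Nil
    then show ?thesis using len by simp
  next
    case (Cons i is')
    then obtain j js' where js: "js = j # js'" using len by (cases js) auto
    note I = reduced_word_ConsD[OF less.prems(2)[unfolded Cons]]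
    note J = reduced_word_ConsD[OF less.prems(3)[unfolded js]]
    have Sk: "simple_transp k \<circ> u \<in> S_inf" if "u \<in> S_inf" "1 \<le> k" for u k
      using that by (intro S_inf_comp simple_transp_S_inf)
    have IH: "demazure_word p f = demazure_word q f"
      if "1 \<le> k" "length p = length is'" "reduced_word (simple_transp k \<circ> v) p"
        "reduced_word (simple_transp k \<circ> v) q" for k p q
      using less.hyps[OF _ Sk[OF S that(1)] that(3,4)] that(2) Cons by simp
    have len': "length js' = length is'" using len Cons js by simp
    have main: "demazure a (demazure_word p f) = demazure b (demazure_word q f)"
      if ab: "a < b" and a: "1 \<le> a" "inv v (Suc a) < inv v a" "reduced_word (simple_transp a \<circ> v) p"
        and b: "1 \<le> b" "inv v (Suc b) < inv v b" "reduced_word (simple_transp b \<circ> v) q"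
        and lens: "length p = length is'" "length q = length is'"
      for a b p q
    proof (cases "b = Suc a")
      case False
      let ?u = "simple_transp a \<circ> (simple_transp b \<circ> v)"
      have u: "?u = simple_transp b \<circ> (simple_transp a \<circ> v)"
        using simple_transp_commute[of a b] ab False by (simp add: fun_eq_iff)
      obtain ks where ks: "reduced_word ?u ks"
        using ex_reduced_word[OF Sk[OF Sk[OF S b(1)] a(1)]] by blast
      have "reduced_word (simple_transp a \<circ> v) (b # ks)"
        using ks[unfolded u] a b ab False
        by (intro reduced_word_ConsI Sk S) (simp_all add: inv_simple_transp_comp[OF S])
      moreover have "reduced_word (simple_transp b \<circ> v) (a # ks)"
        using ks a b ab False
        by (intro reduced_word_ConsI Sk S) (simp_all add: inv_simple_transp_comp[OF S])
      ultimately have "demazure_word p f = demazure b (demazure_word ks f)"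
        "demazure_word q f = demazure a (demazure_word ks f)"
        using IH[OF a(1) lens(1) a(3), of "b # ks"] IH[OF b(1) lens(2) b(3), of "a # ks"] by simp_all
      then show ?thesis using demazure_commute[of a b] ab False by simp
    next
      case b_eq: True
      let ?a = "simple_transp a" and ?b = "simple_transp b"
      let ?u = "?a \<circ> (?b \<circ> (?a \<circ> v))"
      have u: "?u = ?b \<circ> (?a \<circ> (?b \<circ> v))"
        using simple_transp_braid[of a] b_eq by (simp add: fun_eq_iff)
      have Sa: "?a \<circ> v \<in> S_inf" and Sb: "?b \<circ> v \<in> S_inf" using Sk S a b by auto
      have Sba: "?b \<circ> (?a \<circ> v) \<in> S_inf" and Sab: "?a \<circ> (?b \<circ> v) \<in> S_inf"
        using Sk Sa Sb a b by auto
      have invs: "inv (?a \<circ> v) = inv v \<circ> ?a" "inv (?b \<circ> v) = inv v \<circ> ?b"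
        "inv (?b \<circ> (?a \<circ> v)) = inv v \<circ> ?a \<circ> ?b" "inv (?a \<circ> (?b \<circ> v)) = inv v \<circ> ?b \<circ> ?a"
        by (simp_all only: inv_simple_transp_comp(1)[OF S] inv_simple_transp_comp(1)[OF Sa]
            inv_simple_transp_comp(1)[OF Sb] a(1) b(1))
      obtain ks where ks: "reduced_word ?u ks"
        using ex_reduced_word[OF Sk[OF Sba a(1)]] by blast
      have "reduced_word (?b \<circ> (?a \<circ> v)) (a # ks)"
        using ks a b by (intro reduced_word_ConsI Sba) (simp_all only: invs, simp add: b_eq)
      then have "reduced_word (?a \<circ> v) (b # a # ks)"
        using a b by (intro reduced_word_ConsI[OF Sa]) (simp_all only: invs, simp add: b_eq)
      moreover have "reduced_word (?a \<circ> (?b \<circ> v)) (b # ks)"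
        using ks[unfolded u] a b
        by (intro reduced_word_ConsI Sab) (simp_all only: invs, simp add: b_eq)
      then have "reduced_word (?b \<circ> v) (a # b # ks)"
        using a b by (intro reduced_word_ConsI[OF Sb]) (simp_all only: invs, simp add: b_eq)
      ultimately have "demazure_word p f = demazure b (demazure a (demazure_word ks f))"
        "demazure_word q f = demazure a (demazure b (demazure_word ks f))"
        using IH[OF a(1) lens(1) a(3), of "b # a # ks"] IH[OF b(1) lens(2) b(3), of "a # b # ks"]
        by simp_all
      then show ?thesis using demazure_braid[of a] b_eq by simp
    qed
    consider "i = j" | "i < j" | "j < i" by linarith
    then show ?thesis
    proof cases
      case 1
      then show ?thesis using IH[OF I(1) _ I(3)] J(3) Cons js by simp
    next
      case 2
      then show ?thesis using main[OF _ I J] len' Cons js by simp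
    next
      case 3
      then show ?thesis using main[OF _ J I] len' Cons js by simp
    qed
  qed
qed

lemma demazure_perm_eq:
  assumes "v \<in> S_inf" "reduced_word v is"
  shows "demazure_perm v f = demazure_word is f"
  unfolding demazure_perm_def demazure_word_def[symmetric]
  by (rule reduced_words_agree[OF assms(1) someI[of "reduced_word v", OF assms(2)] assms(2)])

lemma demazure_perm_id: "demazure_perm id f = f"
  using demazure_perm_eq[of id "[]" f] by (simp add: reduced_word_iff)

lemma demazure_perm_left_descent:
  assumes "v \<in> S_inf" "1 \<le> i" "inv v (Suc i) < inv v i"
  shows "demazure_perm v f = demazure i (demazure_perm (simple_transp i \<circ> v) f)"
proof -
  have S: "simple_transp i \<circ> v \<in> S_inf" using assms by (intro S_inf_comp simple_transp_S_inf)
  then obtain ks where ks: "reduced_word (simple_transp i \<circ> v) ks" using ex_reduced_word by blast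
  then show ?thesis
    using demazure_perm_eq[OF assms(1) reduced_word_ConsI[OF assms ks]] demazure_perm_eq[OF S ks]
    by simp
qed

section \<open>Grothendieck polynomials under the Demazure operators\<close>

lemma omega_omega: "omega n \<circ> omega n = id"
  by (rule ext) (auto simp: omega_def)

lemma groth_in_omega: "groth_in n (omega n) = (\<Prod>i\<in>{1..n}. X i ^ (n - i))"
proof -
  have "inv (omega n) = omega n" by (rule inv_unique_comp) (rule omega_omega)+
  then show ?thesis by (simp add: groth_in_def omega_omega demazure_perm_id del: One_nat_def)
qed

text \<open>
  The permutation $(w s_i)^{-1} \omega_n = s_i (w^{-1} \omega_n)$ is longer than $w^{-1}
  \omega_n$ by one, so that a reduced word of it may start with $i$.
\<close>

lemma groth_in_descent:
  assumes "w permutes {1..n}" "w (Suc i) < w i"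
  shows "groth_in n (w \<circ> simple_transp i) = demazure i (groth_in n w)"
proof -
  note i = descent_bounds[OF assms]
  have S: "w \<in> S_inf" using assms(1) by (rule S_infI)
  let ?v = "inv (w \<circ> simple_transp i) \<circ> omega n"
  have v: "?v = simple_transp i \<circ> (inv w \<circ> omega n)"
    by (simp add: inv_simple_transp_comp[OF S i(1)] comp_assoc)
  have Sws: "w \<circ> simple_transp i \<in> S_inf" by (intro S_inf_comp simple_transp_S_inf S i)
  have Sv: "?v \<in> S_inf"
    by (intro S_inf_comp S_inf_inv[OF Sws] S_infI[OF omega_permutes])
  have "inv (omega n) = omega n" by (rule inv_unique_comp) (rule omega_omega)+
  then have inv: "inv ?v = omega n \<circ> (w \<circ> simple_transp i)"
    using S_inf_bij[OF S_inf_inv[OF Sws]] S_inf_bij[OF S_infI[OF omega_permutes]] S_inf_bij[OF Sws]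
    by (simp add: o_inv_distrib inv_inv_eq)
  have "w (Suc i) \<in> {1..n}" "w i \<in> {1..n}"
    using i permutes_in_image[OF assms(1)] by auto
  then have "inv ?v (Suc i) < inv ?v i" unfolding inv using assms(2) by (simp add: omega_def)
  from demazure_perm_left_descent[OF Sv i(1) this] show ?thesis
    unfolding groth_in_def v by (simp add: o_assoc)
qed

lemma swap_vars_monomial:
  assumes "1 \<le> i" "i < n" "a i = a (Suc i)"
  shows "swap_vars i (\<Prod>j\<in>{1..n}. X j ^ a j) = (\<Prod>j\<in>{1..n}. X j ^ a j)"
proof -
  have a: "a (simple_transp i j) = a j" for j
    using assms(3) by (cases "j = i \<or> j = Suc i") auto
  have "(\<Prod>j\<in>{1..n}. X j ^ a j) = (\<Prod>j\<in>{1..n}. X (simple_transp i j) ^ a (simple_transp i j))"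
    using prod.permute[OF simple_transp_permutes[OF assms(1,2)], of "\<lambda>j. X j ^ a j"] by (simp add: comp_def)
  then show ?thesis by (simp add: swap_vars_hom a)
qed

text \<open>
  If the exponent of $x_i$ is one larger than that of $x_{i+1}$, the monomial is $x_i$ times a
  polynomial symmetric in $x_i, x_{i+1}$, and $\pi_i x_i = 1$.
\<close>

lemma monomial_demazure:
  assumes "1 \<le> i" "i < n" "a i = Suc (a (Suc i))"
  shows "demazure i (\<Prod>j\<in>{1..n}. X j ^ a j) = (\<Prod>j\<in>{1..n}. X j ^ (a(i := a (Suc i))) j)"
    and "X i * demazure i (\<Prod>j\<in>{1..n}. X j ^ a j) = (\<Prod>j\<in>{1..n}. X j ^ a j)"
proof -
  let ?b = "a(i := a (Suc i))"
  have "(\<Prod>j\<in>{1..n}. X j ^ a j) = X i ^ a i * (\<Prod>j\<in>{1..n} - {i}. X j ^ a j)"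
    "(\<Prod>j\<in>{1..n}. X j ^ ?b j) = X i ^ ?b i * (\<Prod>j\<in>{1..n} - {i}. X j ^ ?b j)"
    using assms(1,2) by (intro prod.remove; simp)+
  moreover have "(\<Prod>j\<in>{1..n} - {i}. X j ^ ?b j) = (\<Prod>j\<in>{1..n} - {i}. X j ^ a j)"
    by (intro prod.cong) auto
  ultimately have eq: "(\<Prod>j\<in>{1..n}. X j ^ a j) = X i * (\<Prod>j\<in>{1..n}. X j ^ ?b j)"
    using assms(3) by (simp add: mult.assoc)
  have "swap_vars i (\<Prod>j\<in>{1..n}. X j ^ ?b j) = (\<Prod>j\<in>{1..n}. X j ^ ?b j)"
    using assms by (intro swap_vars_monomial) auto
  then show 1: "demazure i (\<Prod>j\<in>{1..n}. X j ^ a j) = (\<Prod>j\<in>{1..n}. X j ^ ?b j)"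
    unfolding eq by (rule demazure_lowest)
  show "X i * demazure i (\<Prod>j\<in>{1..n}. X j ^ a j) = (\<Prod>j\<in>{1..n}. X j ^ a j)"
    unfolding 1 by (rule eq[symmetric])
qed

text \<open>
  In one-line notation $[n, n-1, \dots, n-m+1, n+1, n-m, \dots, 1]$, that is $\omega_{n+1} s_1
  \cdots s_m$. These permutations lead from $\omega_{n+1}$ for $m = 0$ to $\omega_n$ for $m =
  n$.
\<close>

definition omega_insert :: "nat \<Rightarrow> nat \<Rightarrow> nat \<Rightarrow> nat" where
  "omega_insert n m i = (if i = 0 \<or> n + 1 < i then i else if i \<le> m then n + 1 - i
     else if i = m + 1 then n + 1 else n + 2 - i)"

text \<open>
  The operator $\pi_{m+1}$ lowers the exponent of $x_{m+1}$ from $n - m$ to $n - m - 1$, so that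
  the staircase monomial of $\mathcal S_{n+1}$ turns into that of $\mathcal S_n$ one variable at
  a time.
\<close>

lemma groth_in_omega_insert:
  "m \<le> n \<Longrightarrow> omega_insert n m permutes {1..Suc n} \<and>
     groth_in (Suc n) (omega_insert n m)
       = (\<Prod>i\<in>{1..Suc n}. X i ^ (if i \<le> m then n - i else Suc n - i))"
proof (induction m)
  case 0
  have "omega_insert n 0 = omega (Suc n)"
    by (rule ext) (auto simp: omega_insert_def omega_def)
  moreover have "(\<Prod>i\<in>{1..Suc n}. X i ^ (Suc n - i))
      = (\<Prod>i\<in>{1..Suc n}. X i ^ (if i \<le> 0 then n - i else Suc n - i))"
    by (intro prod.cong) auto
  ultimately show ?case
    using omega_permutes[of "Suc n"] groth_in_omega[of "Suc n"] by (simp only:)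
next
  case (Suc m)
  let ?w = "omega_insert n m" and ?a = "\<lambda>i. if i \<le> m then n - i else Suc n - i"
  have w: "?w permutes {1..Suc n}" and G: "groth_in (Suc n) ?w = (\<Prod>i\<in>{1..Suc n}. X i ^ ?a i)"
    using Suc by auto
  have next_w: "omega_insert n (Suc m) = ?w \<circ> simple_transp (Suc m)"
    using Suc.prems by (auto simp: omega_insert_def simple_transp_def transpose_def fun_eq_iff)
  have p: "omega_insert n (Suc m) permutes {1..Suc n}"
    unfolding next_w using Suc.prems by (intro permutes_compose[OF _ w] simple_transp_permutes) auto
  have "groth_in (Suc n) (omega_insert n (Suc m)) = demazure (Suc m) (\<Prod>i\<in>{1..Suc n}. X i ^ ?a i)"
    unfolding next_w G[symmetric] using Suc.prems
    by (intro groth_in_descent w) (simp add: omega_insert_def)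
  also have "\<dots> = (\<Prod>j\<in>{1..Suc n}. X j ^ (?a(Suc m := ?a (Suc (Suc m)))) j)"
    using Suc.prems by (intro monomial_demazure) auto
  also have "\<dots> = (\<Prod>i\<in>{1..Suc n}. X i ^ (if i \<le> Suc m then n - i else Suc n - i))"
    by (intro prod.cong) (auto simp: le_Suc_eq)
  finally show ?case using p by blast
qed

lemma groth_in_Suc:
  assumes "w permutes {1..n}"
  shows "groth_in (Suc n) w = groth_in n w"
  using assms order_refl[of 1]
proof (induction rule: permutes_descending_induct)
  case (base u)
  have u: "u = omega n" using base(1,2) by (rule decreasing_imp_omega)
  have "omega_insert n n = omega n"
    by (rule ext) (auto simp: omega_insert_def omega_def)
  then have "groth_in (Suc n) u = (\<Prod>i\<in>{1..Suc n}. X i ^ (if i \<le> n then n - i else Suc n - i))"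
    using groth_in_omega_insert[of n n] u by simp
  also have "\<dots> = (\<Prod>i\<in>{1..n}. X i ^ (n - i))"
    by (simp add: atLeastAtMostSuc_conv)
  finally show ?case unfolding u by (simp only: groth_in_omega)
next
  case (step u i)
  have u: "u permutes {1..Suc n}" using permutes_mono[OF step(1)] by simp
  show ?case
    unfolding groth_in_descent[OF step(1,4)] groth_in_descent[OF u step(4)] step(6) ..
qed

lemma groth_eq:
  assumes "w permutes {1..n}"
  shows "groth w = groth_in n w"
proof -
  define k where "k = (LEAST n. w permutes {1..n})"
  have k: "w permutes {1..k}" "k \<le> n"
    unfolding k_def using assms by (auto intro: LeastI Least_le)
  from k(2) have "groth_in n w = groth_in k w"
  proof (induction n rule: dec_induct)
    case (step m)
    then show ?case using groth_in_Suc[OF permutes_mono[OF k(1)]] by simp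
  qed simp
  then show ?thesis by (simp add: groth_def k_def)
qed

lemma groth_omega: "groth (omega n) = (\<Prod>i\<in>{1..n}. X i ^ (n - i))"
  unfolding groth_eq[OF omega_permutes] by (rule groth_in_omega)

lemma groth_id: "groth id = 1"
proof -
  have "omega 0 = id" by (rule ext) (simp add: omega_def)
  then show ?thesis using groth_omega[of 0] by simp
qed

lemma groth_descent:
  assumes "w \<in> S_inf" "w (Suc i) < w i"
  shows "groth (w \<circ> simple_transp i) = demazure i (groth w)"
proof -
  obtain n where w: "w permutes {1..n}" using assms(1) by (auto simp: S_inf_def)
  have "w \<circ> simple_transp i permutes {1..n}"
    using descent_bounds[OF w assms(2)] by (intro permutes_compose[OF _ w] simple_transp_permutes)
  then show ?thesis using groth_in_descent[OF w assms(2)] groth_eq w by metis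
qed

text \<open>
  The right action of the generators of the 0-Hecke monoid on permutations, under which $\pi_i$
  sends $\mathcal G_w$ to $\mathcal G_{w \cdot i}$ for every $w$.
\<close>

definition demazure_act :: "nat \<Rightarrow> (nat \<Rightarrow> nat) \<Rightarrow> nat \<Rightarrow> nat" where
  "demazure_act i w = (if w (Suc i) < w i then w \<circ> simple_transp i else w)"

lemma demazure_act_S_inf: "w \<in> S_inf \<Longrightarrow> 1 \<le> i \<Longrightarrow> demazure_act i w \<in> S_inf"
  unfolding demazure_act_def by (auto intro!: S_inf_comp simple_transp_S_inf simp del: One_nat_def)

text \<open>
  At an ascent $i$ of $w$, the polynomial $\mathcal G_w$ is itself a value of $\pi_i$, and
  $\pi_i$ is idempotent.
\<close>

lemma demazure_groth:
  assumes "w \<in> S_inf" "1 \<le> i"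
  shows "demazure i (groth w) = groth (demazure_act i w)"
proof (cases "w (Suc i) < w i")
  case True
  then show ?thesis using groth_descent[OF assms(1)] by (simp add: demazure_act_def)
next
  case False
  let ?u = "w \<circ> simple_transp i"
  have u: "?u \<in> S_inf" using assms by (intro S_inf_comp simple_transp_S_inf)
  have "w i \<noteq> w (Suc i)" using S_inf_inj[OF assms(1)] by simp
  then have "?u (Suc i) < ?u i" using False by simp
  then have "groth (?u \<circ> simple_transp i) = demazure i (groth ?u)" by (rule groth_descent[OF u])
  moreover have "?u \<circ> simple_transp i = w" by (simp add: fun_eq_iff)
  ultimately have G: "groth w = demazure i (groth ?u)" by (simp only:)
  have act: "demazure_act i w = w" using False by (simp add: demazure_act_def)
  show ?thesis unfolding act G by (rule demazure_idem)
qed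

lemma prepend_permutes:
  assumes "v permutes {1..n - 1}" "1 \<le> n"
  shows "prepend n v permutes {1..n}"
proof (rule bij_imp_permutes)
  have inj: "inj_on (prepend n v) {1..n}"
  proof (rule inj_onI)
    fix i j assume ij: "i \<in> {1..n}" "j \<in> {1..n}" "prepend n v i = prepend n v j"
    have "v (k - 1) \<noteq> n" if "k \<le> n" for k
      using permutes_le[OF assms(1), of "k - 1"] that assms(2) by linarith
    moreover have "v a = v b \<longleftrightarrow> a = b" for a b using S_inf_inj[OF S_infI[OF assms(1)]] .
    ultimately show "i = j" using ij by (auto simp: prepend_def split: if_splits)
  qed
  have "prepend n v i \<in> {1..n}" if "i \<in> {1..n}" for i
    using that assms(2) permutes_in_image[OF assms(1), of "i - 1"] by (auto simp: prepend_def)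
  then have "prepend n v ` {1..n} \<subseteq> {1..n}" by blast
  then show "bij_betw (prepend n v) {1..n} {1..n}"
    using inj endo_inj_surj[of "{1..n}" "prepend n v"] by (simp add: bij_betw_def)
qed (use assms(2) in \<open>auto simp: prepend_def\<close>)

definition shift_vars :: "zpoly \<Rightarrow> zpoly" where
  "shift_vars = poly_subst (\<lambda>i. X (Suc i))"

lemma swap_vars_shift: "1 \<le> i \<Longrightarrow> swap_vars (Suc i) (shift_vars f) = shift_vars (swap_vars i f)"
proof -
  have "simple_transp (Suc i) (Suc j) = Suc (simple_transp i j)" for j
    by (auto simp: simple_transp_def transpose_def)
  then show ?thesis by (simp add: swap_vars_def shift_vars_def poly_subst_comp)
qed

lemma demazure_shift:
  assumes "1 \<le> i"
  shows "demazure (Suc i) (shift_vars f) = shift_vars (demazure i f)"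
proof (rule demazure_unique)
  have "shift_vars ((X i - X (Suc i)) * demazure i f)
      = shift_vars ((1 - X (Suc i)) * f - (1 - X i) * swap_vars i f)"
    by (simp only: demazure_eq)
  then show "(X (Suc i) - X (Suc (Suc i))) * shift_vars (demazure i f)
      = (1 - X (Suc (Suc i))) * shift_vars f - (1 - X (Suc i)) * swap_vars (Suc i) (shift_vars f)"
    unfolding swap_vars_shift[OF assms] by (simp add: shift_vars_def poly_subst_hom)
qed

text \<open>
  Both sides satisfy the same recursion: the operator $\pi_{i+1}$ does not see $x_1$ and acts on
  the shifted variables as $\pi_i$ acts on the original ones.
\<close>

lemma groth_prepend:
  assumes "v permutes {1..n - 1}" "1 \<le> n"
  shows "groth (prepend n v) = X 1 ^ (n - 1) * shift_vars (groth v)"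
  using assms(1) order_refl[of 1]
proof (induction rule: permutes_descending_induct)
  case (base u)
  have u: "u = omega (n - 1)" using base(1,2) by (rule decreasing_imp_omega)
  have "prepend n u = omega n"
    unfolding u using assms(2) by (intro ext) (auto simp: prepend_def omega_def)
  then have "groth (prepend n u) = (\<Prod>i\<in>{1..n}. X i ^ (n - i))" by (simp only: groth_omega)
  also have "\<dots> = X 1 ^ (n - 1) * (\<Prod>i\<in>{2..n}. X i ^ (n - i))"
    using assms(2) by (simp add: prod.atLeast_Suc_atMost numeral_2_eq_2)
  also have "(\<Prod>i\<in>{2..n}. X i ^ (n - i)) = (\<Prod>i\<in>{1..n-1}. X (Suc i) ^ (n - Suc i))"
    using assms(2) prod.shift_bounds_cl_Suc_ivl[of "\<lambda>i. X i ^ (n - i)" 1 "n - 1"]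
    by (simp add: numeral_2_eq_2)
  also have "\<dots> = shift_vars (groth u)"
    unfolding u groth_omega by (simp add: shift_vars_def poly_subst_hom)
  finally show ?case .
next
  case (step u i)
  have S: "u \<in> S_inf" "prepend n u \<in> S_inf"
    using step(1) prepend_permutes[OF step(1) assms(2)] by (auto intro: S_infI simp del: One_nat_def)
  have "prepend n (u \<circ> simple_transp i) = prepend n u \<circ> simple_transp (Suc i)"
    using step(2,3) by (intro ext) (auto simp: prepend_def simple_transp_def transpose_def)
  moreover have "prepend n u (Suc (Suc i)) < prepend n u (Suc i)"
  proof -
    have "Suc (Suc i) \<le> n" using step(3) by linarith
    then show ?thesis using step(2,4) by (simp add: prepend_def)
  qed
  ultimately have "groth (prepend n (u \<circ> simple_transp i)) = demazure (Suc i) (groth (prepend n u))"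
    using groth_descent[OF S(2)] by simp
  also have "\<dots> = X 1 ^ (n - 1) * demazure (Suc i) (shift_vars (groth u))"
    unfolding step.IH step(6) using step(2)
    by (intro demazure_symmetric_mult) (simp add: swap_vars_power)
  also have "demazure (Suc i) (shift_vars (groth u)) = shift_vars (groth (u \<circ> simple_transp i))"
    unfolding groth_descent[OF S(1) step(4)] by (rule demazure_shift[OF step(2)])
  finally show ?case .
qed

section \<open>Linear independence of Grothendieck polynomials\<close>

lemma perm_length_omega_le: "perm_length (omega n) \<le> (\<Sum>i\<in>{1..n}. n - i)"
proof -
  have "inversions (omega n) \<subseteq> (SIGMA i:{1..n}. {i<..n})"
    using inversions_subset[OF omega_permutes[of n]] by (auto simp: inversions_def)
  then have "card (inversions (omega n)) \<le> card (SIGMA i:{1..n}. {i<..n})"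
    by (intro card_mono) auto
  then show ?thesis by (simp add: perm_length_eq)
qed

text \<open>
  The staircase monomial has degree $\ell(\omega_n)$, and every Demazure operator on the way
  down to $w$ lowers both the length by one and the order by at most one.
\<close>

lemma groth_vanishes_to_length:
  assumes "w permutes {1..n}"
  shows "vanishes_to_order (perm_length w) (groth w)"
  using assms order_refl[of 1]
proof (induction rule: permutes_descending_induct)
  case (base u)
  have u: "u = omega n" using base(1,2) by (rule decreasing_imp_omega)
  have "vanishes_to_order (\<Sum>i\<in>{1..n}. n - i) (groth u)"
    unfolding u groth_omega by (intro vanishes_to_order_prod vanishes_to_order_X_power)
  then show ?case using perm_length_omega_le[of n] u vanishes_to_order_mono by blast
next
  case (step u i)
  have S: "u \<in> S_inf" using step(1) by (rule S_infI)
  have "vanishes_to_order (perm_length u - 1) (demazure i (groth u))"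
    using step(6) by (rule vanishes_to_order_demazure)
  moreover have "perm_length u - 1 = perm_length (u \<circ> simple_transp i)"
    using perm_length_descent[OF S step(2,4)] by linarith
  ultimately show ?case unfolding groth_descent[OF S step(4)] by (simp only:)
qed

lemma perm_length_pos: "w \<in> S_inf \<Longrightarrow> w \<noteq> id \<Longrightarrow> 0 < perm_length w"
  using ex_left_descent[of w] perm_length_left_descent[of w] by auto

text \<open>
  Evaluation at the origin therefore separates $\mathcal G_{\mathrm{id}} = 1$ from all other
  Grothendieck polynomials.
\<close>

lemma groth_constant_term:
  assumes "w \<in> S_inf" "w \<noteq> id"
  shows "Poly_Mapping.lookup (of_int c * groth w) 0 = 0"
proof -
  obtain n where "w permutes {1..n}" using assms(1) by (auto simp: S_inf_def)
  then have "vanishes_to_order (perm_length w) (groth w)" by (rule groth_vanishes_to_length)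
  then have "vanishes_to_order (Suc 0) (groth w)"
    using perm_length_pos[OF assms] by (auto elim: vanishes_to_order_mono)
  then have "vanishes_to_order (0 + Suc 0) (of_int c * groth w)"
    by (intro vanishes_to_order_mult) auto
  then show ?thesis using constant_term_eq_0[of 0] by simp
qed

lemma demazure_word_groth:
  assumes "\<forall>i\<in>set ks. 1 \<le> i" "w \<in> S_inf"
  shows "foldr demazure_act ks w \<in> S_inf"
    and "demazure_word ks (groth w) = groth (foldr demazure_act ks w)"
  using assms by (induction ks) (simp_all add: demazure_act_S_inf demazure_groth del: One_nat_def)

lemma demazure_word_sum:
  "demazure_word ks (\<Sum>a\<in>A. of_int (c a) * F a) = (\<Sum>a\<in>A. of_int (c a) * demazure_word ks (F a))"
  by (induction ks) (simp_all add: demazure_sum demazure_of_int_mult)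

text \<open>
  Each letter lowers the length by at most one. If the word is just long enough, every letter
  acts at a descent, hence by multiplication, and can be undone.
\<close>

lemma demazure_act_length:
  assumes "\<forall>i\<in>set ks. 1 \<le> i" "w \<in> S_inf"
  shows "perm_length w \<le> perm_length (foldr demazure_act ks w) + length ks \<and>
    (perm_length w = perm_length (foldr demazure_act ks w) + length ks \<longrightarrow>
       foldr demazure_act ks w \<circ> word_prod ks = w)"
  using assms(1)
proof (induction ks)
  case (Cons i ks)
  let ?u = "foldr demazure_act ks w"
  have u: "?u \<in> S_inf" using Cons.prems by (intro demazure_word_groth assms(2)) simp
  have IH: "perm_length w \<le> perm_length ?u + length ks"
    "perm_length w = perm_length ?u + length ks \<longrightarrow> ?u \<circ> word_prod ks = w"
    using Cons.IH Cons.prems by (metis list.set_intros(2))+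
  show ?case
  proof (cases "?u (Suc i) < ?u i")
    case True
    then have act: "foldr demazure_act (i # ks) w = ?u \<circ> simple_transp i"
      by (simp add: demazure_act_def)
    have len: "perm_length ?u = Suc (perm_length (?u \<circ> simple_transp i))"
      using Cons.prems True by (intro perm_length_descent[OF u]) simp_all
    have "?u \<circ> simple_transp i \<circ> word_prod (i # ks) = ?u \<circ> word_prod ks"
      by (simp add: fun_eq_iff)
    moreover have "perm_length w = perm_length ?u + length ks"
      if "perm_length w = perm_length (?u \<circ> simple_transp i) + (length ks + Suc 0)"
      using that len by linarith
    moreover have "perm_length w \<le> perm_length (?u \<circ> simple_transp i) + (length ks + Suc 0)"
      using IH(1) len by linarith
    ultimately show ?thesis unfolding act list.size using IH(2) by metis
  next
    case False
    then have act: "foldr demazure_act (i # ks) w = ?u" by (simp add: demazure_act_def)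
    show ?thesis unfolding act list.size using IH(1) by linarith
  qed
qed simp

lemma ex_demazure_act_id:
  "w \<in> S_inf \<Longrightarrow> \<exists>ks. (\<forall>i\<in>set ks. 1 \<le> i) \<and> length ks = perm_length w \<and> foldr demazure_act ks w = id"
proof (induction "perm_length w" arbitrary: w rule: less_induct)
  case less
  show ?case
  proof (cases "w = id")
    case True
    then show ?thesis by (intro exI[of _ "[]"]) simp
  next
    case False
    have "inv w \<noteq> id" using False S_inf_bij[OF less.prems] by (metis inv_id inv_inv_eq)
    then obtain i where i: "1 \<le> i" "w (Suc i) < w i"
      using ex_left_descent[OF S_inf_inv[OF less.prems]] S_inf_bij[OF less.prems] by (metis inv_inv_eq)
    let ?u = "w \<circ> simple_transp i"
    have len: "perm_length w = Suc (perm_length ?u)" using perm_length_descent[OF less.prems i] .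
    obtain ks where ks: "\<forall>i\<in>set ks. 1 \<le> i" "length ks = perm_length ?u" "foldr demazure_act ks ?u = id"
      using less.hyps[of ?u] len S_inf_comp[OF less.prems simple_transp_S_inf[OF i(1)]] by auto
    have "foldr demazure_act (ks @ [i]) w = id"
      using ks(3) i(2) by (simp add: demazure_act_def)
    then show ?thesis using ks(1,2) i(1) len by (intro exI[of _ "ks @ [i]"]) simp
  qed
qed

text \<open>
  In a relation, take $u$ of minimal length with a nonzero coefficient and apply Demazure
  operators that take $u$ down to the identity in $\ell(u)$ steps. No other permutation in the
  relation reaches the identity: a longer one needs more steps, and one of the same length is
  determined by the word. So the constant term of the resulting relation is the coefficient of
  $u$.
\<close>

lemma groth_linear_independent:
  assumes "finite A" "A \<subseteq> S_inf" "(\<Sum>w\<in>A. of_int (c w) * groth w) = 0"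
  shows "\<forall>w\<in>A. c w = 0"
proof (rule ccontr)
  let ?B = "{w \<in> A. c w \<noteq> 0}"
  assume "\<not> ?thesis"
  then have "\<exists>w. w \<in> ?B" by blast
  then obtain u where u: "u \<in> ?B" and min: "\<And>w. w \<in> ?B \<Longrightarrow> perm_length u \<le> perm_length w"
    using ex_has_least_nat[of "\<lambda>w. w \<in> ?B" _ perm_length] by blast
  have S: "w \<in> S_inf" if "w \<in> ?B" for w using that assms(2) by blast
  obtain ks where ks: "\<forall>i\<in>set ks. 1 \<le> i" "length ks = perm_length u" "foldr demazure_act ks u = id"
    using ex_demazure_act_id[OF S[OF u]] by blast
  have unique: "w = u" if "w \<in> ?B" "foldr demazure_act ks w = id" for w
  proof -
    have "word_prod ks = u"
      using demazure_act_length[OF ks(1) S[OF u]] ks(2,3) by simp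
    moreover have "perm_length w = length ks"
      using demazure_act_length[OF ks(1) S[OF that(1)]] min[OF that(1)] ks(2) that(2) by simp
    then have "word_prod ks = w"
      using demazure_act_length[OF ks(1) S[OF that(1)]] that(2) by simp
    ultimately show ?thesis by simp
  qed
  have "(\<Sum>w\<in>?B. of_int (c w) * groth w) = (\<Sum>w\<in>A. of_int (c w) * groth w)"
    using assms(1) by (intro sum.mono_neutral_left) auto
  also have "\<dots> = 0" by (rule assms(3))
  finally have zero: "(\<Sum>w\<in>?B. of_int (c w) * groth w) = 0" .
  have "0 = demazure_word ks (\<Sum>w\<in>?B. of_int (c w) * groth w)"
    unfolding zero using demazure_word_sum[of ks c groth "{}"] by simp
  also have "\<dots> = (\<Sum>w\<in>?B. of_int (c w) * groth (foldr demazure_act ks w))"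
    unfolding demazure_word_sum
    by (intro sum.cong refl arg_cong2[of _ _ _ _ "(*)"] demazure_word_groth(2)[OF ks(1)] S)
  finally have "0 = (\<Sum>w\<in>?B. Poly_Mapping.lookup (of_int (c w) * groth (foldr demazure_act ks w)) 0)"
    by (simp add: lookup_sum[symmetric])
  also have "\<dots> = (\<Sum>w\<in>?B. if w = u then c u else 0)"
  proof (intro sum.cong refl)
    fix w assume w: "w \<in> ?B"
    show "Poly_Mapping.lookup (of_int (c w) * groth (foldr demazure_act ks w)) 0 = (if w = u then c u else 0)"
    proof (cases "w = u")
      case True
      then show ?thesis using ks(3) by (simp add: groth_id of_int_zpoly)
    next
      case False
      then have "foldr demazure_act ks w \<noteq> id" using unique[OF w] by blast
      then show ?thesis
        using groth_constant_term[OF demazure_word_groth(1)[OF ks(1) S[OF w]]] False by simp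
    qed
  qed
  also have "\<dots> = c u" using assms(1) u by (simp add: sum.delta)
  finally show False using u by simp
qed

section \<open>Multiplication by the first variable\<close>

text \<open>
  The Grothendieck polynomial of $w (1 - T_m) \cdots (1 - T_2)$, where $T_b$ sends $w$ to $w
  t_{1,b}$ if this is a cover and to 0 otherwise. The factor of the largest label acts first,
  which makes the labels of the chains decrease. The labels 0 and 1 are never covers.
\<close>

primrec monk_sum :: "nat \<Rightarrow> nat \<Rightarrow> (nat \<Rightarrow> nat) \<Rightarrow> zpoly" where
  "monk_sum n 0 w = groth w"
| "monk_sum n (Suc m) w = monk_sum n m w
     - (if cover1 n w (Suc m) then monk_sum n m (w \<circ> transpose 1 (Suc m)) else 0)"

text \<open>
  The exchange of $i$ and $i+1$ maps the positions strictly between 1 and $b$ to themselves.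
\<close>

lemma cover1_comp_simple_transp:
  assumes w: "w permutes {1..n}" and i: "2 \<le> i" "i < n" and b: "b < i \<or> Suc i < b" and c: "cover1 n w b"
  shows "cover1 n (w \<circ> simple_transp i) b"
proof -
  have p: "w \<circ> simple_transp i permutes {1..n}"
    using i by (intro permutes_compose[OF _ w] simple_transp_permutes) auto
  have e: "(w \<circ> simple_transp i) 1 = w 1" "(w \<circ> simple_transp i) b = w b" using i b by auto
  have "1 < simple_transp i c \<and> simple_transp i c < b" if "1 < c" "c < b" for c
    using that i b by (auto simp: simple_transp_def transpose_def)
  then show ?thesis
    using c unfolding cover1_iff[OF w] cover1_iff[OF p] e by (metis comp_apply)
qed

text \<open>
  All permutations that occur when $\pi_i$ meets the labels $i$ and $i+1$ differ from $w$ only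
  at the positions $1, i, i+1$.
\<close>

definition triple_at :: "nat \<Rightarrow> (nat \<Rightarrow> nat) \<Rightarrow> nat \<Rightarrow> nat \<Rightarrow> nat \<Rightarrow> nat \<Rightarrow> nat" where
  "triple_at i w x y z = w(1 := x, i := y, Suc i := z)"

text \<open>
  The one place where $\pi_i$ does not commute with the single factors: it has to pass the block
  $(1 - T_{i+1})(1 - T_i)$. With $a, c, d$ the values at the positions $1, i, i+1$, expand the
  block into at most four terms. If $c < d$, every term that survives has an ascent at $i$ and
  is fixed. If $d < c$, the terms correspond to those of $w s_i$, except when $a < d < c$: then
  the terms of $w t_{1,i}$ and $w t_{1,i+1} t_{1,i}$ become equal under $\pi_i$ and cancel, and
  the two others form the block for $w s_i$.
\<close>

lemma demazure_monk_sum_step: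
  assumes w: "w permutes {1..n}" and i: "2 \<le> i" "i < n"
    and IH: "\<And>u. u permutes {1..n} \<Longrightarrow>
      demazure i (monk_sum n (i - 1) u) = monk_sum n (i - 1) (demazure_act i u)"
  shows "demazure i (monk_sum n (Suc i) w) = monk_sum n (Suc i) (demazure_act i w)"
proof -
  define R where "R = monk_sum n (i - 1)"
  define p where "p = triple_at i w"
  define P where "P x y z \<longleftrightarrow> p x y z permutes {1..n}" for x y z
  define B where "B x y \<longleftrightarrow> (\<forall>k. 1 < k \<and> k < i \<longrightarrow> \<not> (x < w k \<and> w k < y))" for x y
  have i1: "i \<noteq> 1" "i \<noteq> 0" using i by auto
  have comp: "p x y z \<circ> transpose 1 i = p y x z" "p x y z \<circ> transpose 1 (Suc i) = p z y x"
    "p x y z \<circ> simple_transp i = p x z y" for x y z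
    using i1 by (auto simp: p_def triple_at_def transpose_def simple_transp_def fun_eq_iff)
  have at: "p x y z 1 = x" "p x y z i = y" "p x y z (Suc i) = z" for x y z
    using i1 by (auto simp: p_def triple_at_def)
  have below: "p x y z k = w k" if "1 < k" "k < i" for x y z k
    using that by (auto simp: p_def triple_at_def)
  have P1: "P y x z" if "P x y z" for x y z
  proof -
    have "transpose 1 i permutes {1..n}" using i by (intro permutes_swap_id) auto
    from permutes_compose[OF this that[unfolded P_def]] show ?thesis unfolding P_def comp .
  qed
  have P2: "P z y x" if "P x y z" for x y z
  proof -
    have "transpose 1 (Suc i) permutes {1..n}" using i by (intro permutes_swap_id) auto
    from permutes_compose[OF this that[unfolded P_def]] show ?thesis unfolding P_def comp .
  qed
  have cov: "cover1 n (p x y z) i \<longleftrightarrow> x < y \<and> B x y"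
    "cover1 n (p x y z) (Suc i) \<longleftrightarrow> x < z \<and> B x z \<and> \<not> (x < y \<and> y < z)" if "P x y z" for x y z
  proof -
    note iff = cover1_iff[OF that[unfolded P_def]]
    show "cover1 n (p x y z) i \<longleftrightarrow> x < y \<and> B x y"
      unfolding iff at B_def using i below by auto
    have split: "(\<forall>c. 1 < c \<and> c < Suc i \<longrightarrow> Q c) \<longleftrightarrow> (\<forall>c. 1 < c \<and> c < i \<longrightarrow> Q c) \<and> Q i" for Q
      using i by (auto simp: less_Suc_eq)
    show "cover1 n (p x y z) (Suc i) \<longleftrightarrow> x < z \<and> B x z \<and> \<not> (x < y \<and> y < z)"
      unfolding iff at B_def split using i below by auto
  qed
  have act: "demazure_act i (p x y z) = (if z < y then p x z y else p x y z)" for x y z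
    unfolding demazure_act_def at comp ..
  have R_act: "demazure i (R (p x y z)) = (if z < y then R (p x z y) else R (p x y z))"
    if "P x y z" for x y z
    using IH[of "p x y z"] that unfolding P_def R_def act by auto
  have unfold: "monk_sum n (Suc i) (p x y z)
      = R (p x y z) - (if x < y \<and> B x y then R (p y x z) else 0)
        - (if x < z \<and> B x z \<and> \<not> (x < y \<and> y < z)
           then R (p z y x) - (if z < y \<and> B z y then R (p y z x) else 0) else 0)"
    if "P x y z" for x y z
  proof -
    have one: "monk_sum n i u = R u - (if cover1 n u i then R (u \<circ> transpose 1 i) else 0)" for u
      using monk_sum.simps(2)[of n "i - 1" u] i1 unfolding R_def by simp
    show ?thesis
      unfolding monk_sum.simps(2)[of n i] one comp cov[OF that] cov[OF P2[OF that]] by simp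
  qed
  define a c d where "a = w 1" and "c = w i" and "d = w (Suc i)"
  have w_eq: "w = p a c d"
    by (auto simp: p_def triple_at_def a_def c_def d_def)
  have acd: "P a c d" using w unfolding P_def w_eq[symmetric] .
  note cad = P1[OF acd] and dca = P2[OF acd]
  note dac = P2[OF cad] and cda = P1[OF dca]
  note adc = P1[OF dac]
  note P = adc cad cda dac dca
  have ne: "a \<noteq> c" "a \<noteq> d" "c \<noteq> d"
    unfolding a_def c_def d_def using S_inf_inj[OF S_infI[OF w]] i1 by auto
  \<comment> \<open>The value $d$ splits the interval from $a$ to $c$, and no position before $i$ holds it.\<close>
  have Bsplit: "B a c \<longleftrightarrow> B a d \<and> B d c" if "a < d" "d < c"
  proof -
    have wk: "w k \<noteq> d" if "k < i" for k
      unfolding d_def using S_inf_inj[OF S_infI[OF w], of k "Suc i"] that by auto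
    have "d < w k" if "k < i" "\<not> w k < d" for k using that wk[of k] by linarith
    then show ?thesis
      unfolding B_def using that by (meson less_trans)
  qed
  have "demazure i (monk_sum n (Suc i) (p a c d))
      = monk_sum n (Suc i) (if d < c then p a d c else p a c d)"
  proof (cases "d < c")
    case False
    then show ?thesis
      using ne unfolding if_not_P[OF False] unfold[OF acd] by (auto simp: demazure_diff R_act acd P)
  next
    case True
    then show ?thesis
      using ne Bsplit unfolding if_P[OF True] unfold[OF acd] unfold[OF P(1)]
      by (auto simp: demazure_diff R_act acd P)
  qed
  then show ?thesis unfolding act[of a c d, symmetric] by (simp only: w_eq[symmetric])
qed

text \<open>
  The excluded value $m = i$ would cut the block of the labels $i$ and $i+1$ in two.
\<close>

lemma demazure_monk_sum:
  assumes "w permutes {1..n}" "2 \<le> i" "i < n" "m < i \<or> i < m"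
  shows "demazure i (monk_sum n m w) = monk_sum n m (demazure_act i w)"
  using assms
proof (induction m arbitrary: w rule: less_induct)
  case (less m)
  have i: "1 \<le> i" using less.prems(2) by simp
  show ?case
  proof (cases m)
    case 0
    then show ?thesis using demazure_groth[OF S_infI[OF less.prems(1)] i] by simp
  next
    case (Suc k)
    show ?thesis
    proof (cases "k = i")
      case True
      have "demazure i (monk_sum n (i - 1) u) = monk_sum n (i - 1) (demazure_act i u)"
        if "u permutes {1..n}" for u
        using less.IH[of "i - 1" u] that less.prems(2,3) Suc True by simp
      then show ?thesis
        using demazure_monk_sum_step[OF less.prems(1-3)] Suc True by simp
    next
      case False
      let ?t = "transpose 1 m" and ?s = "simple_transp i"
      have b: "m < i \<or> Suc i < m" using False Suc less.prems(4) by auto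
      have IH: "demazure i (monk_sum n k u) = monk_sum n k (demazure_act i u)"
        if "u permutes {1..n}" for u
        using less.IH[of k u] that less.prems(2,3) b Suc by auto
      have comm: "w \<circ> ?s \<circ> ?t = w \<circ> ?t \<circ> ?s"
        using b Suc less.prems(2) by (auto simp: fun_eq_iff simple_transp_def transpose_def)
      have fixed: "(w \<circ> ?t) i = w i" "(w \<circ> ?t) (Suc i) = w (Suc i)"
        using b Suc less.prems(2) by (auto simp: transpose_def)
      have act_t: "demazure_act i w \<circ> ?t = demazure_act i (w \<circ> ?t)"
        unfolding demazure_act_def fixed using comm by simp
      have ws: "w \<circ> ?s permutes {1..n}"
        using i less.prems by (intro permutes_compose[OF _ less.prems(1)] simple_transp_permutes) auto
      have cov: "cover1 n (demazure_act i w) m \<longleftrightarrow> cover1 n w m"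
      proof -
        have "w \<circ> ?s \<circ> ?s = w" by (simp add: fun_eq_iff)
        then show ?thesis
          unfolding demazure_act_def
          using cover1_comp_simple_transp[OF less.prems(1-3) b] cover1_comp_simple_transp[OF ws less.prems(2,3) b]
          by auto
      qed
      show ?thesis
      proof (cases "cover1 n w m")
        case True
        then have "?t permutes {1..n}"
          by (intro permutes_swap_id) (auto simp: cover1_def)
        then have wt: "w \<circ> ?t permutes {1..n}" by (rule permutes_compose[OF _ less.prems(1)])
        show ?thesis
          using True cov unfolding Suc monk_sum.simps
          by (simp only: if_True demazure_diff IH[OF less.prems(1)] IH[OF wt[unfolded Suc]] act_t[unfolded Suc])
      next
        case False
        then show ?thesis
          using cov unfolding Suc monk_sum.simps
          by (simp only: if_False diff_zero IH[OF less.prems(1)])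
      qed
    qed
  qed
qed

text \<open>
  The operator $\pi_1 \pi_2 \cdots \pi_m$.
\<close>

primrec demazure_prefix :: "nat \<Rightarrow> zpoly \<Rightarrow> zpoly" where
  "demazure_prefix 0 f = f"
| "demazure_prefix (Suc m) f = demazure_prefix m (demazure (Suc m) f)"

text \<open>
  The operator $(\pi_1 - 1)(\pi_2 - 1) \cdots (\pi_m - 1)$.
\<close>

primrec demazure_minus_prefix :: "nat \<Rightarrow> zpoly \<Rightarrow> zpoly" where
  "demazure_minus_prefix 0 f = f"
| "demazure_minus_prefix (Suc m) f = demazure_minus_prefix m (demazure (Suc m) f - f)"

lemma demazure_minus_prefix_diff:
  "demazure_minus_prefix m (f - g) = demazure_minus_prefix m f - demazure_minus_prefix m g"
proof (induction m arbitrary: f g)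
  case (Suc m)
  have "demazure (Suc m) (f - g) - (f - g) = (demazure (Suc m) f - f) - (demazure (Suc m) g - g)"
    by (simp add: demazure_diff)
  then show ?case by (simp only: demazure_minus_prefix.simps Suc)
qed simp

lemma one_minus_X1_demazure_prefix:
  "(1 - X 1) * demazure_prefix m f = demazure_minus_prefix m ((1 - X (Suc m)) * f)"
proof (induction m arbitrary: f)
  case (Suc m)
  then show ?case
    by (simp only: demazure_prefix.simps demazure_minus_prefix.simps one_minus_X_demazure)
qed simp

lemma r_perm_1_0: "r_perm 1 0 = id"
  by (rule ext) (auto simp: r_perm_def)

text \<open>
  The cycle $r_{[1,m]}$ is thus $s_m \cdots s_1$; multiplying by it on the right moves the entry
  at position $m + 1$ to the front.
\<close>

lemma r_perm_1_Suc: "r_perm 1 (Suc m) = simple_transp (Suc m) \<circ> r_perm 1 m"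
  by (rule ext) (auto simp: r_perm_def simple_transp_def transpose_def)

lemma r_perm_1_Suc_transpose: "r_perm 1 (Suc m) \<circ> transpose 1 (Suc (Suc m)) = r_perm 1 m"
  by (rule ext) (auto simp: r_perm_def transpose_def)

lemma r_perm_1_permutes: "m < n \<Longrightarrow> r_perm 1 m permutes {1..n}"
proof (induction m)
  case 0
  show ?case unfolding r_perm_1_0 by (rule permutes_id)
next
  case (Suc m)
  then show ?case unfolding r_perm_1_Suc by (intro permutes_compose simple_transp_permutes) auto
qed

text \<open>
  As the first $m+1$ entries of $u$ decrease, $u \mapsto u s_m \cdots s_1$ goes down at every
  step, which gives $\pi_1 \cdots \pi_m$. In $u\, r_{[1,m]}$ the label $m+1$ is a cover, and
  following it gives $u\, r_{[1,m-1]}$: the letter $s_m$ is left out. The recursion of the chain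
  sum thus distinguishes whether $s_m$ is kept or left out, as does the factor $\pi_m - 1$.
\<close>

lemma groth_comp_r_perm:
  assumes "u permutes {1..n}" "\<And>i j. 1 \<le> i \<Longrightarrow> i < j \<Longrightarrow> j \<le> Suc m \<Longrightarrow> u j < u i" "m < n"
  shows "groth (u \<circ> r_perm 1 m) = demazure_prefix m (groth u)
    \<and> monk_sum n (Suc m) (u \<circ> r_perm 1 m) = demazure_minus_prefix m (groth u)"
  using assms
proof (induction m arbitrary: u)
  case 0
  have "\<not> cover1 n u 1" by (simp add: cover1_def)
  then show ?case unfolding r_perm_1_0 by simp
next
  case (Suc m)
  let ?s = "simple_transp (Suc m)"
  have S: "u \<in> S_inf" using Suc.prems(1) by (rule S_infI)
  have desc: "u (Suc (Suc m)) < u (Suc m)" using Suc.prems(2)[of "Suc m" "Suc (Suc m)"] by simp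
  have us: "u \<circ> ?s permutes {1..n}"
    using Suc.prems(3) by (intro permutes_compose[OF _ Suc.prems(1)] simple_transp_permutes) auto
  have eq: "u \<circ> r_perm 1 (Suc m) = u \<circ> ?s \<circ> r_perm 1 m"
    unfolding r_perm_1_Suc comp_assoc ..
  have dec: "(u \<circ> ?s) j < (u \<circ> ?s) i" if "1 \<le> i" "i < j" "j \<le> Suc m" for i j
  proof (cases "j = Suc m")
    case True
    then show ?thesis using that Suc.prems(2)[of i "Suc (Suc m)"] by simp
  next
    case False
    then show ?thesis using that Suc.prems(2)[of i j] by simp
  qed
  have "groth (u \<circ> ?s \<circ> r_perm 1 m) = demazure_prefix m (groth (u \<circ> ?s))
    \<and> monk_sum n (Suc m) (u \<circ> ?s \<circ> r_perm 1 m) = demazure_minus_prefix m (groth (u \<circ> ?s))"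
  proof (rule Suc.IH[OF us])
    show "(u \<circ> ?s) j < (u \<circ> ?s) i" if "1 \<le> i" "i < j" "j \<le> Suc m" for i j
      using that by (rule dec)
    show "m < n" using Suc.prems(3) by simp
  qed
  then have IH: "groth (u \<circ> r_perm 1 (Suc m)) = demazure_prefix m (groth (u \<circ> ?s))"
    "monk_sum n (Suc m) (u \<circ> r_perm 1 (Suc m)) = demazure_minus_prefix m (groth (u \<circ> ?s))"
    unfolding eq by blast+
  have IH2: "monk_sum n (Suc m) (u \<circ> r_perm 1 m) = demazure_minus_prefix m (groth u)"
  proof (rule conjunct2[OF Suc.IH[OF Suc.prems(1)]])
    show "u j < u i" if "1 \<le> i" "i < j" "j \<le> Suc m" for i j
      using that by (intro Suc.prems(2)) simp_all
    show "m < n" using Suc.prems(3) by simp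
  qed
  have G: "groth (u \<circ> ?s) = demazure (Suc m) (groth u)" by (rule groth_descent[OF S desc])
  have p: "u \<circ> r_perm 1 (Suc m) permutes {1..n}"
    using Suc.prems(3) by (intro permutes_compose[OF _ Suc.prems(1)] r_perm_1_permutes)
  have cov: "cover1 n (u \<circ> r_perm 1 (Suc m)) (Suc (Suc m))"
    unfolding cover1_iff[OF p]
  proof (intro conjI allI impI)
    show "(u \<circ> r_perm 1 (Suc m)) 1 < (u \<circ> r_perm 1 (Suc m)) (Suc (Suc m))"
      using desc by (simp add: r_perm_def)
    show "\<not> ((u \<circ> r_perm 1 (Suc m)) 1 < (u \<circ> r_perm 1 (Suc m)) c
        \<and> (u \<circ> r_perm 1 (Suc m)) c < (u \<circ> r_perm 1 (Suc m)) (Suc (Suc m)))"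
      if "1 < c \<and> c < Suc (Suc m)" for c
      using that Suc.prems(2)[of "c - 1" "Suc m"] by (simp add: r_perm_def) linarith
  qed (use Suc.prems(3) in auto)
  have undo: "u \<circ> r_perm 1 (Suc m) \<circ> transpose 1 (Suc (Suc m)) = u \<circ> r_perm 1 m"
    unfolding comp_assoc r_perm_1_Suc_transpose ..
  have "monk_sum n (Suc (Suc m)) (u \<circ> r_perm 1 (Suc m))
      = demazure_minus_prefix m (demazure (Suc m) (groth u)) - demazure_minus_prefix m (groth u)"
    unfolding monk_sum.simps(2)[of n "Suc m"] if_P[OF cov] undo IH(2) IH2 G ..
  then show ?case
    unfolding IH(1) G demazure_prefix.simps demazure_minus_prefix.simps demazure_minus_prefix_diff
    by (intro conjI refl)
qed

text \<open>
  Such a permutation is $\omega_n\, r_{[1,p]}$ with $p = n - u(1)$. The positions after $p + 1$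
  hold values below $u(1)$ and contribute no covers. The Leibniz rule turns $(1 - x_1) \pi_1
  \cdots \pi_p$ into $(\pi_1 - 1) \cdots (\pi_{p-1} - 1) (1 - x_p) \pi_p$, and $x_p \pi_p$ fixes
  the staircase monomial.
\<close>

lemma one_minus_X1_mult_groth_decreasing_tail:
  assumes u: "u permutes {1..n}" and dec: "\<And>i j. 2 \<le> i \<Longrightarrow> i < j \<Longrightarrow> j \<le> n \<Longrightarrow> u j < u i"
    and u1: "u 1 < n"
  shows "(1 - X 1) * groth u = monk_sum n n u"
proof -
  have "u 1 \<in> {1..n}" using permutes_in_image[OF u, of 1] u1 by simp
  then obtain q where q: "n - u 1 = Suc q" "Suc q < n" using u1 by (cases "n - u 1") auto
  let ?r = "omega n \<circ> r_perm 1 (Suc q)"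
  have r: "?r permutes {1..n}"
    using q by (intro permutes_compose[OF _ omega_permutes] r_perm_1_permutes)
  have r1: "?r 1 = u 1" using q u1 by (simp add: r_perm_def omega_def)
  have r_gt: "?r b = n + 1 - b" if "Suc (Suc q) < b" "b \<le> n" for b
    using that by (simp add: r_perm_def omega_def)
  have r_dec: "?r j < ?r i" if "2 \<le> i" "i < j" "j \<le> n" for i j
    using that q by (auto simp: r_perm_def omega_def)
  have "u i = ?r i" for i
  proof -
    consider "i = 1" | "2 \<le> i" "i \<le> n" | "i \<notin> {1..n}" by force
    then show ?thesis
    proof cases
      case 2
      then show ?thesis
        by (intro decreasing_functions_equal[of 2 n, OF dec r_dec permutes_image_tail[OF u r r1[symmetric]]])
    next
      case 3
      then show ?thesis using permutes_not_in[OF u 3] permutes_not_in[OF r 3] by simp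
    qed (simp only: r1)
  qed
  then have u_eq: "u = ?r" by (rule ext)
  let ?G = "groth (omega n)"
  have "groth ?r = demazure_prefix (Suc q) ?G
      \<and> monk_sum n (Suc (Suc q)) ?r = demazure_minus_prefix (Suc q) ?G"
    by (rule groth_comp_r_perm[OF omega_permutes]) (use q in \<open>auto simp: omega_def\<close>)
  then have main: "groth u = demazure_prefix (Suc q) ?G"
    "monk_sum n (Suc (Suc q)) u = demazure_minus_prefix (Suc q) ?G"
    unfolding u_eq[symmetric] by blast+
  \<comment> \<open>After position $p + 1$ the entries of $\omega_n$ are in place, and they are smaller than $u(1)$.\<close>
  have no_cover: "\<not> cover1 n u b" if "Suc (Suc q) < b" for b
  proof
    assume c: "cover1 n u b"
    then have "b \<le> n" "u 1 < u b" unfolding cover1_iff[OF u] by blast+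
    moreover have "u b = n + 1 - b" using r_gt[OF that \<open>b \<le> n\<close>] unfolding u_eq[symmetric] .
    ultimately show False using that q by linarith
  qed
  have stable: "monk_sum n m u = monk_sum n (Suc (Suc q)) u" if "Suc (Suc q) \<le> m" for m
    using that by (induction m rule: dec_induct) (simp_all add: no_cover)
  have "X (Suc q) * demazure (Suc q) ?G = ?G"
    unfolding groth_omega using q by (intro monomial_demazure(2)) auto
  then have "(1 - X (Suc q)) * demazure (Suc q) ?G = demazure (Suc q) ?G - ?G"
    by (simp add: left_diff_distrib)
  then have "(1 - X 1) * groth u = demazure_minus_prefix (Suc q) ?G"
    unfolding main(1) demazure_prefix.simps one_minus_X1_demazure_prefix by simp
  then show ?thesis unfolding stable[of n, OF Suc_leI[OF q(2)]] main(2) .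
qed

text \<open>
  The case of a decreasing tail spreads to all tails because the operators $\pi_i$ with $i \ge
  2$ commute with both sides.
\<close>

theorem one_minus_X1_mult_groth:
  assumes "w permutes {1..n}" "w 1 < n"
  shows "(1 - X 1) * groth w = monk_sum n n w"
proof -
  have "1 \<le> (2::nat)" by simp
  with assms(1) show ?thesis
  proof (induction rule: permutes_descending_induct)
    case (base u)
    then show ?case
      using assms(2) by (intro one_minus_X1_mult_groth_decreasing_tail) auto
  next
    case (step u i)
    have S: "u \<in> S_inf" using step(1) by (rule S_infI)
    have act: "demazure_act i u = u \<circ> simple_transp i" using step(4) by (simp add: demazure_act_def)
    have "(1 - X 1) * groth (u \<circ> simple_transp i) = demazure i ((1 - X 1) * groth u)"
      unfolding groth_descent[OF S step(4)] using step(2)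
      by (intro demazure_symmetric_mult[symmetric]) (simp add: swap_vars_diff)
    also have "\<dots> = monk_sum n n (u \<circ> simple_transp i)"
      unfolding step(6) using demazure_monk_sum[OF step(1-3)] step(3) act by simp
    finally show ?case .
  qed
qed

section \<open>Increasing chains and marked chains\<close>

lemma chain1_append: "chain1 n w (xs @ ys) \<longleftrightarrow> chain1 n w xs \<and> chain1 n (chain_end w xs) ys"
  by (induction xs arbitrary: w) auto

lemma chain_end_append: "chain_end w (xs @ ys) = chain_end (chain_end w xs) ys"
  by (induction xs arbitrary: w) auto

lemma chain1_labels: "chain1 n w bs \<Longrightarrow> set bs \<subseteq> {2..n}"
  by (induction bs arbitrary: w) (auto simp: cover1_def)

lemma cover1_step:
  assumes "cover1 n w b"
  shows "w \<circ> transpose 1 b permutes {1..n}" "w 1 < (w \<circ> transpose 1 b) 1"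
proof -
  have w: "w permutes {1..n}" using assms by (simp add: cover1_def)
  have "transpose 1 b permutes {1..n}"
    using assms by (intro permutes_swap_id) (auto simp: cover1_def)
  then show "w \<circ> transpose 1 b permutes {1..n}" by (rule permutes_compose[OF _ w])
  show "w 1 < (w \<circ> transpose 1 b) 1" using assms unfolding cover1_iff[OF w] by simp
qed

lemma chain_end_permutes:
  "w permutes {1..n} \<Longrightarrow> chain1 n w bs \<Longrightarrow> chain_end w bs permutes {1..n}"
  by (induction bs arbitrary: w) (simp_all add: cover1_step(1) del: One_nat_def)

lemma chain_end_first_le: "chain1 n w bs \<Longrightarrow> w 1 \<le> chain_end w bs 1"
proof (induction bs arbitrary: w)
  case (Cons b bs)
  then have "w 1 < (w \<circ> transpose 1 b) 1" "(w \<circ> transpose 1 b) 1 \<le> chain_end (w \<circ> transpose 1 b) bs 1"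
    using cover1_step(2)[of n w b] by (simp_all only: chain1.simps)
  then show ?case by (simp only: chain_end.simps)
qed simp

lemma chain_end_first_less: "chain1 n w bs \<Longrightarrow> bs \<noteq> [] \<Longrightarrow> w 1 < chain_end w bs 1"
proof (cases bs)
  case (Cons b cs)
  assume "chain1 n w bs"
  then have "cover1 n w b" "chain1 n (w \<circ> transpose 1 b) cs" by (simp_all add: Cons)
  from cover1_step(2)[OF this(1)] chain_end_first_le[OF this(2)]
  show ?thesis unfolding Cons chain_end.simps by linarith
qed simp

definition bounded_chains :: "nat \<Rightarrow> nat \<Rightarrow> (nat \<Rightarrow> nat) \<Rightarrow> nat list set" where
  "bounded_chains n m w = {bs. sorted_wrt (>) bs \<and> set bs \<subseteq> {..m} \<and> chain1 n w bs}"

definition segments_from :: "nat \<Rightarrow> (nat \<Rightarrow> nat) \<Rightarrow> nat list set" where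
  "segments_from n w = {bs. bs \<noteq> [] \<and> sorted_wrt (>) bs \<and> chain1 n w bs}"

lemma bounded_chains_0: "bounded_chains n 0 w = {[]}"
proof -
  have "bs = []" if "bs \<in> bounded_chains n 0 w" for bs
    using that chain1_labels[of n w bs] by (cases bs) (auto simp: bounded_chains_def)
  then show ?thesis by (auto simp: bounded_chains_def)
qed

text \<open>
  Labels decrease along the chain, so that the label $m + 1$ can occur only as the first one.
\<close>

lemma bounded_chains_Suc:
  "bounded_chains n (Suc m) w = bounded_chains n m w \<union>
     (if cover1 n w (Suc m) then (#) (Suc m) ` bounded_chains n m (w \<circ> transpose 1 (Suc m)) else {})"
  (is "?L = ?R")
proof (intro equalityI subsetI)
  fix bs assume bs: "bs \<in> ?L"
  show "bs \<in> ?R"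
  proof (cases "set bs \<subseteq> {..m}")
    case True
    then show ?thesis using bs by (simp add: bounded_chains_def)
  next
    case False
    then have top: "Suc m \<in> set bs" using bs by (auto simp: bounded_chains_def le_Suc_eq subset_iff)
    then obtain b cs where bs_eq: "bs = b # cs" by (cases bs) auto
    have all: "\<forall>c\<in>set cs. c < b" "b \<le> Suc m" using bs by (auto simp: bounded_chains_def bs_eq)
    then have "b = Suc m" using top by (auto simp: bs_eq)
    moreover have "set cs \<subseteq> {..m}" using all(1) \<open>b = Suc m\<close> by auto
    ultimately show ?thesis using bs by (simp add: bs_eq bounded_chains_def)
  qed
next
  fix bs assume "bs \<in> ?R"
  then show "bs \<in> ?L"
    by (auto simp: bounded_chains_def le_Suc_eq less_Suc_eq_le subset_iff split: if_splits)
qed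

lemma finite_bounded_chains: "finite (bounded_chains n m w)"
  by (induction m arbitrary: w) (simp_all add: bounded_chains_0 bounded_chains_Suc)

lemma monk_sum_eq_chain_sum:
  "monk_sum n m w = (\<Sum>bs\<in>bounded_chains n m w. (- 1) ^ length bs * groth (chain_end w bs))"
proof (induction m arbitrary: w)
  case 0
  show ?case by (simp add: bounded_chains_0)
next
  case (Suc m)
  let ?u = "w \<circ> transpose 1 (Suc m)"
  show ?case
  proof (cases "cover1 n w (Suc m)")
    case True
    have disj: "bounded_chains n m w \<inter> (#) (Suc m) ` bounded_chains n m ?u = {}"
      by (auto simp: bounded_chains_def)
    have "(\<Sum>bs\<in>(#) (Suc m) ` bounded_chains n m ?u. (- 1) ^ length bs * groth (chain_end w bs))
        = (\<Sum>bs\<in>bounded_chains n m ?u. - ((- 1) ^ length bs * groth (chain_end ?u bs)))"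
      by (subst sum.reindex) auto
    also have "\<dots> = - monk_sum n m ?u" unfolding Suc.IH sum_negf ..
    finally show ?thesis
      unfolding bounded_chains_Suc if_P[OF True] monk_sum.simps
        sum.union_disjoint[OF finite_bounded_chains finite_imageI[OF finite_bounded_chains] disj] Suc.IH[of w]
      by simp
  next
    case False
    then show ?thesis unfolding bounded_chains_Suc monk_sum.simps if_not_P[OF False] Suc.IH by simp
  qed
qed

lemma bounded_chains_full: "bounded_chains n n w = insert [] (segments_from n w)"
  using chain1_labels by (fastforce simp: bounded_chains_def segments_from_def)

lemma finite_segments_from: "finite (segments_from n w)"
  using finite_bounded_chains[of n n w] by (simp add: bounded_chains_full)

text \<open>
  The empty chain accounts for the term $\mathcal G_w$ of $(1 - x_1) \mathcal G_w$; the other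
  chains give the product with $x_1$. For $w(1) = n$ there is no chain in $\mathcal S_n$, and
  the product is a Grothendieck polynomial of $\mathcal S_{n+1}$.
\<close>

theorem X1_mult_groth:
  assumes "w permutes {1..n}" "w 1 < n"
  shows "X 1 * groth w
    = (\<Sum>bs\<in>segments_from n w. (- 1) ^ (length bs - 1) * groth (chain_end w bs))"
proof -
  have "[] \<notin> segments_from n w" by (simp add: segments_from_def)
  then have "(1 - X 1) * groth w
      = groth w + (\<Sum>bs\<in>segments_from n w. (- 1) ^ length bs * groth (chain_end w bs))"
    unfolding one_minus_X1_mult_groth[OF assms] monk_sum_eq_chain_sum bounded_chains_full
    using finite_segments_from by simp
  moreover have "X 1 * groth w = groth w - (1 - X 1) * groth w"
    by (simp add: left_diff_distrib)
  ultimately have "X 1 * groth w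
      = - (\<Sum>bs\<in>segments_from n w. (- 1) ^ length bs * groth (chain_end w bs))"
    by simp
  also have "\<dots> = (\<Sum>bs\<in>segments_from n w. (- 1) ^ (length bs - 1) * groth (chain_end w bs))"
    unfolding sum_negf[symmetric]
  proof (intro sum.cong refl)
    fix bs assume "bs \<in> segments_from n w"
    then obtain b cs where "bs = b # cs" by (auto simp: segments_from_def neq_Nil_conv)
    then show "- ((- 1) ^ length bs * groth (chain_end w bs))
        = (- 1) ^ (length bs - 1) * groth (chain_end w bs)" by simp
  qed
  finally show ?thesis .
qed

lemma segments_fromD:
  assumes "w permutes {1..n}" "bs \<in> segments_from n w"
  shows "chain_end w bs permutes {1..n}" "w 1 < chain_end w bs 1" "chain_end w bs 1 \<le> n"
proof -
  have bs: "bs \<noteq> []" "chain1 n w bs" using assms(2) by (auto simp: segments_from_def)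
  show p: "chain_end w bs permutes {1..n}" using chain_end_permutes[OF assms(1) bs(2)] .
  show "w 1 < chain_end w bs 1" using chain_end_first_less[OF bs(2,1)] .
  show "chain_end w bs 1 \<le> n"
    using permutes_le[OF p, of 1] permutes_ge[OF p, of 1] chain1_labels[OF bs(2)] bs(1)
    by (cases bs) auto
qed

definition marked_segment :: "nat list \<Rightarrow> (nat \<times> bool) list" where
  "marked_segment bs = (hd bs, True) # map (\<lambda>b. (b, False)) (tl bs)"

lemma map_fst_marked_segment: "bs \<noteq> [] \<Longrightarrow> map fst (marked_segment bs) = bs"
  by (cases bs) (auto simp: marked_segment_def comp_def)

lemma num_marked_append: "num_marked (xs @ ys) = num_marked xs + num_marked ys"
  by (simp add: num_marked_def)

lemma num_marked_segment: "num_marked (marked_segment bs) = 1"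
  by (simp add: marked_segment_def num_marked_def filter_map comp_def)

lemma length_marked_segment: "bs \<noteq> [] \<Longrightarrow> length (marked_segment bs) = length bs"
  by (cases bs) (auto simp: marked_segment_def)

lemma num_marked_le: "num_marked \<gamma> \<le> length \<gamma>"
  by (simp add: num_marked_def)

lemma segments_marked_segment:
  assumes "bs \<noteq> []" "\<gamma> \<noteq> [] \<longrightarrow> snd (hd \<gamma>)"
  shows "segments (marked_segment bs @ \<gamma>) = bs # segments \<gamma>"
proof -
  let ?P = "\<lambda>c :: nat \<times> bool. \<not> snd c"
  have "takeWhile ?P (map (\<lambda>b. (b, False)) cs @ \<gamma>) = map (\<lambda>b. (b, False)) cs"
    "dropWhile ?P (map (\<lambda>b. (b, False)) cs @ \<gamma>) = \<gamma>" for cs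
    using assms(2) by (induction cs; cases \<gamma>; simp)+
  then show ?thesis
    using assms(1) by (cases bs) (simp_all add: marked_segment_def comp_def)
qed

lemma marked_chain_Nil [simp]: "marked_chain n w []"
  by (simp add: marked_chain_def)

lemma marked_chain_append:
  assumes "bs \<in> segments_from n w" "marked_chain n (chain_end w bs) \<gamma>"
  shows "marked_chain n w (marked_segment bs @ \<gamma>)"
proof -
  have bs: "bs \<noteq> []" "sorted_wrt (>) bs" "chain1 n w bs" using assms(1) by (auto simp: segments_from_def)
  have \<gamma>: "chain1 n (chain_end w bs) (map fst \<gamma>)" "\<gamma> \<noteq> [] \<longrightarrow> snd (hd \<gamma>)"
    "\<forall>cs\<in>set (segments \<gamma>). sorted_wrt (>) cs" using assms(2) by (auto simp: marked_chain_def)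
  have "snd (hd (marked_segment bs @ \<gamma>))" by (simp add: marked_segment_def)
  then show ?thesis
    unfolding marked_chain_def segments_marked_segment[OF bs(1) \<gamma>(2)] map_append
      map_fst_marked_segment[OF bs(1)] chain1_append
    using bs \<gamma> by simp
qed

text \<open>
  The first cover is marked and starts the first segment; the segment ends before the next
  marked cover, where the remaining chain is again a marked chain.
\<close>

lemma marked_chain_cases:
  assumes "marked_chain n w \<gamma>" "\<gamma> \<noteq> []"
  obtains bs \<delta> where "bs \<in> segments_from n w" "marked_chain n (chain_end w bs) \<delta>"
    "\<gamma> = marked_segment bs @ \<delta>"
proof -
  let ?P = "\<lambda>c :: nat \<times> bool. \<not> snd c"
  obtain b \<epsilon> where \<gamma>: "\<gamma> = (b, True) # \<epsilon>"
    using assms by (cases \<gamma>) (auto simp: marked_chain_def)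
  let ?bs = "b # map fst (takeWhile ?P \<epsilon>)" and ?d = "dropWhile ?P \<epsilon>"
  have "map (\<lambda>b. (b, False)) (map fst (takeWhile ?P \<epsilon>)) = takeWhile ?P \<epsilon>"
    by (induction \<epsilon>) auto
  then have eq: "\<gamma> = marked_segment ?bs @ ?d"
    unfolding \<gamma> marked_segment_def by simp
  have hd: "?d \<noteq> [] \<longrightarrow> snd (hd ?d)" using hd_dropWhile[of ?P \<epsilon>] by blast
  have m: "chain1 n w (map fst (marked_segment ?bs @ ?d))"
    "\<forall>cs\<in>set (segments (marked_segment ?bs @ ?d)). sorted_wrt (>) cs"
    using assms(1) unfolding marked_chain_def eq[symmetric] by blast+
  have "chain1 n w ?bs" "chain1 n (chain_end w ?bs) (map fst ?d)"
    using m(1) unfolding map_append map_fst_marked_segment[OF list.distinct(2)] chain1_append by blast+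
  moreover note all = m(2)[unfolded segments_marked_segment[OF list.distinct(2) hd]]
  have "sorted_wrt (>) ?bs" by (rule bspec[OF all list.set_intros(1)])
  moreover have "\<forall>cs\<in>set (segments ?d). sorted_wrt (>) cs" using all by (meson list.set_intros(2))
  ultimately have "?bs \<in> segments_from n w" "marked_chain n (chain_end w ?bs) ?d"
    using hd by (simp_all only: segments_from_def marked_chain_def mem_Collect_eq) simp_all
  then show ?thesis using eq that by blast
qed

text \<open>
  The first segment can be recovered from the whole chain as the head of its list of segments.
\<close>

lemma marked_segment_append_inject:
  assumes "bs \<in> segments_from n w" "marked_chain n (chain_end w bs) \<gamma>"
    "bs' \<in> segments_from n w" "marked_chain n (chain_end w bs') \<gamma>'"
    "marked_segment bs @ \<gamma> = marked_segment bs' @ \<gamma>'"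
  shows "bs = bs' \<and> \<gamma> = \<gamma>'"
proof -
  have seg: "segments (marked_segment bs @ \<gamma>) = bs # segments \<gamma>"
    if "bs \<in> segments_from n w" "marked_chain n (chain_end w bs) \<gamma>" for bs \<gamma>
    by (rule segments_marked_segment) (use that in \<open>auto simp: segments_from_def marked_chain_def\<close>)
  have "bs = bs'" using seg[OF assms(1,2)] seg[OF assms(3,4)] unfolding assms(5) by simp
  then show ?thesis using assms(5) by simp
qed

section \<open>Marked chains ending at $n.v$\<close>

lemma prepend_inject:
  assumes "v permutes {1..n - 1}" "v' permutes {1..n - 1}" "prepend n v = prepend n v'"
  shows "v = v'"
proof
  fix i
  show "v i = v' i"
  proof (cases "i \<in> {1..n - 1}")
    case True
    then have "i \<noteq> 0" "Suc i \<le> n" by auto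
    then show ?thesis using fun_cong[OF assms(3), of "Suc i"] by (simp add: prepend_def)
  next
    case False
    then show ?thesis using assms by (simp add: permutes_not_in)
  qed
qed

lemma ex_prepend:
  assumes "w permutes {1..n}" "w 1 = n" "1 \<le> n"
  obtains v where "v permutes {1..n - 1}" "w = prepend n v"
proof
  let ?v = "\<lambda>i. if i \<in> {1..n - 1} then w (Suc i) else i"
  show "?v permutes {1..n - 1}"
  proof (rule bij_imp_permutes)
    have inj: "inj_on ?v {1..n - 1}"
      using S_inf_inj[OF S_infI[OF assms(1)]] by (auto simp: inj_on_def)
    have "?v i \<in> {1..n - 1}" if "i \<in> {1..n - 1}" for i
    proof -
      have "w (Suc i) \<in> {1..n}" using that permutes_in_image[OF assms(1), of "Suc i"] by auto
      moreover have "w (Suc i) \<noteq> w 1" using that S_inf_inj[OF S_infI[OF assms(1)]] by auto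
      ultimately show ?thesis using that assms(2) by auto
    qed
    then have "?v ` {1..n - 1} \<subseteq> {1..n - 1}" by blast
    then show "bij_betw ?v {1..n - 1} {1..n - 1}"
      using inj endo_inj_surj[of "{1..n - 1}" ?v] by (simp add: bij_betw_def)
  qed (rule if_not_P)
  show "w = prepend n ?v"
  proof
    fix i
    consider "i = 1" | "i \<in> {2..n}" | "i \<notin> {1..n}" by force
    then show "w i = prepend n ?v i"
    proof cases
      case 3
      then show ?thesis using permutes_not_in[OF assms(1)] assms(3) by (auto simp: prepend_def)
    qed (use assms in \<open>auto simp: prepend_def\<close>)
  qed
qed

text \<open>
  A cover would raise the first entry above $n$.
\<close>

lemma chains_to_top_prepend:
  assumes "v permutes {1..n - 1}" "1 \<le> n"
  shows "marked_chains_to_top n (prepend n v) = {([], v)}"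
proof -
  let ?w = "prepend n v"
  have p: "?w permutes {1..n}" by (rule prepend_permutes[OF assms])
  have w1: "?w 1 = n" by (simp add: prepend_def)
  have "\<gamma> = []" if m: "marked_chain n ?w \<gamma>" for \<gamma>
  proof (rule ccontr)
    assume "\<gamma> \<noteq> []"
    then obtain bs where "bs \<in> segments_from n ?w" using marked_chain_cases[OF m] by metis
    then show False using segments_fromD[OF p] w1 by fastforce
  qed
  then have nil: "\<gamma> = []" if "(\<gamma>, v') \<in> marked_chains_to_top n ?w" for \<gamma> v'
    using that by (simp add: marked_chains_to_top_def)
  show ?thesis
  proof (intro equalityI subsetI)
    fix p assume p: "p \<in> marked_chains_to_top n ?w"
    obtain \<gamma> v' where p_eq: "p = (\<gamma>, v')" by force
    with p nil have "\<gamma> = []" by blast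
    then have "v' permutes {1..n - 1}" "?w = prepend n v'"
      using p by (simp_all add: p_eq marked_chains_to_top_def)
    with prepend_inject[OF assms(1)] have "v = v'" by blast
    then show "p \<in> {([], v)}" using p_eq \<open>\<gamma> = []\<close> by simp
  qed (use assms(1) in \<open>simp add: marked_chains_to_top_def\<close>)
qed

lemma chains_to_top_step:
  assumes "\<nexists>v. v permutes {1..n - 1} \<and> w = prepend n v"
  shows "marked_chains_to_top n w = (\<lambda>(bs, \<gamma>, v). (marked_segment bs @ \<gamma>, v)) `
    (SIGMA bs:segments_from n w. marked_chains_to_top n (chain_end w bs))" (is "?L = ?f ` ?R")
proof (intro equalityI subsetI)
  fix p assume "p \<in> ?L"
  then obtain \<gamma> v where p: "p = (\<gamma>, v)" "marked_chain n w \<gamma>" "v permutes {1..n - 1}"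
    "chain_end w (map fst \<gamma>) = prepend n v" by (auto simp: marked_chains_to_top_def)
  have "\<gamma> \<noteq> []" using p(3,4) assms by auto
  then obtain bs \<delta> where d: "bs \<in> segments_from n w" "marked_chain n (chain_end w bs) \<delta>"
    "\<gamma> = marked_segment bs @ \<delta>" using marked_chain_cases[OF p(2)] by metis
  have "bs \<noteq> []" using d(1) by (simp add: segments_from_def)
  then have "chain_end (chain_end w bs) (map fst \<delta>) = prepend n v"
    using p(4) unfolding d(3) by (simp add: map_fst_marked_segment chain_end_append)
  then have "(bs, \<delta>, v) \<in> ?R" using d p(3) by (simp add: marked_chains_to_top_def)
  moreover have "p = ?f (bs, \<delta>, v)" using p(1) d(3) by simp
  ultimately show "p \<in> ?f ` ?R" by blast
next
  fix p assume "p \<in> ?f ` ?R"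
  then obtain bs \<gamma> v where p: "p = (marked_segment bs @ \<gamma>, v)" "bs \<in> segments_from n w"
    "(\<gamma>, v) \<in> marked_chains_to_top n (chain_end w bs)" by auto
  have "bs \<noteq> []" using p(2) by (simp add: segments_from_def)
  then show "p \<in> ?L"
    using p marked_chain_append[OF p(2)]
    by (simp add: marked_chains_to_top_def map_fst_marked_segment chain_end_append)
qed

lemma chains_to_top_step_inj:
  "inj_on (\<lambda>(bs, \<gamma>, v). (marked_segment bs @ \<gamma>, v))
     (SIGMA bs:segments_from n w. marked_chains_to_top n (chain_end w bs))"
proof (rule inj_onI)
  fix p q
  assume pq: "p \<in> (SIGMA bs:segments_from n w. marked_chains_to_top n (chain_end w bs))"
    "q \<in> (SIGMA bs:segments_from n w. marked_chains_to_top n (chain_end w bs))"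
    "(case p of (bs, \<gamma>, v) \<Rightarrow> (marked_segment bs @ \<gamma>, v))
      = (case q of (bs, \<gamma>, v) \<Rightarrow> (marked_segment bs @ \<gamma>, v))"
  obtain bs \<gamma> v bs' \<gamma>' v' where eq: "p = (bs, \<gamma>, v)" "q = (bs', \<gamma>', v')"
    by (metis prod.exhaust)
  have "bs = bs' \<and> \<gamma> = \<gamma>'"
    using pq unfolding eq
    by (intro marked_segment_append_inject[of bs n w]) (auto simp: marked_chains_to_top_def)
  then show "p = q" using pq(3) unfolding eq by simp
qed

text \<open>
  Segments raise the first entry, which cannot exceed $n$, and $n$ as the first entry means the
  form $n.v$.
\<close>

lemma rising_first_value_induct [consumes 2, case_names top rise]:
  assumes "w permutes {1..n}" "1 \<le> n"
    and top: "\<And>v. v permutes {1..n - 1} \<Longrightarrow> P (prepend n v)"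
    and rise: "\<And>w. w permutes {1..n} \<Longrightarrow> w 1 < n \<Longrightarrow>
      \<nexists>v. v permutes {1..n - 1} \<and> w = prepend n v \<Longrightarrow>
      (\<And>bs. bs \<in> segments_from n w \<Longrightarrow> P (chain_end w bs)) \<Longrightarrow> P w"
  shows "P w"
  using assms(1)
proof (induction "n - w 1" arbitrary: w rule: less_induct)
  case less
  have le: "w 1 \<le> n" using permutes_le[OF less.prems assms(2)] .
  show ?case
  proof (cases "w 1 = n")
    case True
    from less.prems True assms(2) obtain v where "v permutes {1..n - 1}" "w = prepend n v"
      by (rule ex_prepend)
    then show ?thesis using top by simp
  next
    case False
    have "P (chain_end w bs)" if "bs \<in> segments_from n w" for bs
    proof (rule less.hyps)
      show "n - chain_end w bs 1 < n - w 1" "chain_end w bs permutes {1..n}"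
        using segments_fromD[OF less.prems that] by auto
    qed
    moreover have "\<nexists>v. v permutes {1..n - 1} \<and> w = prepend n v"
      using False by (auto simp: prepend_def)
    ultimately show ?thesis using False le by (intro rise[OF less.prems]) auto
  qed
qed

lemma finite_chains_to_top:
  assumes "w permutes {1..n}" "1 \<le> n"
  shows "finite (marked_chains_to_top n w)"
  using assms
proof (induction rule: rising_first_value_induct)
  case (top v)
  then show ?case using chains_to_top_prepend assms(2) by simp
next
  case (rise w)
  show ?case
    unfolding chains_to_top_step[OF rise(3)]
    by (intro finite_imageI finite_SigmaI finite_segments_from rise(4))
qed

text \<open>
  There are as many marks as segments, and each segment raises the first entry by at least one.
  This bound keeps the exponents $n - 1 - m(\gamma)$ from being truncated.
\<close>

lemma num_marked_bound:
  assumes "w permutes {1..n}" "1 \<le> n" "(\<gamma>, v) \<in> marked_chains_to_top n w"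
  shows "num_marked \<gamma> \<le> n - w 1"
proof -
  from assms(1,2) have "\<forall>p\<in>marked_chains_to_top n w. num_marked (fst p) \<le> n - w 1"
  proof (induction rule: rising_first_value_induct)
    case (top v)
    show ?case unfolding chains_to_top_prepend[OF top assms(2)] by (simp add: num_marked_def)
  next
    case (rise w)
    have "num_marked (marked_segment bs @ \<delta>) \<le> n - w 1"
      if "bs \<in> segments_from n w" "(\<delta>, v) \<in> marked_chains_to_top n (chain_end w bs)" for bs \<delta> v
    proof -
      have "num_marked \<delta> \<le> n - chain_end w bs 1" using rise(4)[OF that(1)] that(2) by force
      then show ?thesis
        unfolding num_marked_append num_marked_segment
        using segments_fromD(2,3)[OF rise(1) that(1)] by linarith
    qed
    then show ?case unfolding chains_to_top_step[OF rise(3)] by auto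
  qed
  then show ?thesis using assms(3) by force
qed

text \<open>
  The signed sum over marked chains, with a weight that depends on the number of marks and on
  the end. Powers of $y$ times Grothendieck polynomials as weights give the second expansion of
  the theorem; indicator functions of one number of marks and one end give the structure
  constants.
\<close>

definition marked_chain_sum ::
  "nat \<Rightarrow> (nat \<Rightarrow> (nat \<Rightarrow> nat) \<Rightarrow> 'a::comm_ring_1) \<Rightarrow> (nat \<Rightarrow> nat) \<Rightarrow> 'a" where
  "marked_chain_sum n h w = (\<Sum>(\<gamma>, v)\<in>marked_chains_to_top n w.
     (- 1) ^ (length \<gamma> - num_marked \<gamma>) * h (num_marked \<gamma>) v)"

lemma marked_chain_sum_prepend:
  "v permutes {1..n - 1} \<Longrightarrow> 1 \<le> n \<Longrightarrow> marked_chain_sum n h (prepend n v) = h 0 v"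
  by (simp add: marked_chain_sum_def chains_to_top_prepend num_marked_def del: One_nat_def)

text \<open>
  Splitting off the first segment: it contributes one mark, and all its covers but the first are
  unmarked and contribute a sign.
\<close>

lemma marked_chain_sum_step:
  assumes w: "w permutes {1..n}" "1 \<le> n" and no: "\<nexists>v. v permutes {1..n - 1} \<and> w = prepend n v"
  shows "marked_chain_sum n h w = (\<Sum>bs\<in>segments_from n w.
    (- 1) ^ (length bs - 1) * marked_chain_sum n (\<lambda>k. h (Suc k)) (chain_end w bs))"
proof -
  have fin: "finite (marked_chains_to_top n (chain_end w bs))" if "bs \<in> segments_from n w" for bs
    using segments_fromD[OF w(1) that] w(2) by (intro finite_chains_to_top)
  have weight: "(- 1) ^ (length (marked_segment bs @ \<gamma>) - num_marked (marked_segment bs @ \<gamma>))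
        * h (num_marked (marked_segment bs @ \<gamma>)) v
      = (- 1) ^ (length bs - 1) * ((- 1) ^ (length \<gamma> - num_marked \<gamma>) * h (Suc (num_marked \<gamma>)) v)"
    if "bs \<in> segments_from n w" for bs \<gamma> v
  proof -
    have bs: "bs \<noteq> []" using that by (simp add: segments_from_def)
    then have "0 < length bs" by simp
    then have "length (marked_segment bs @ \<gamma>) - num_marked (marked_segment bs @ \<gamma>)
        = (length bs - 1) + (length \<gamma> - num_marked \<gamma>)"
      unfolding length_append length_marked_segment[OF bs] num_marked_append num_marked_segment
      using num_marked_le[of \<gamma>] by linarith
    then show ?thesis
      by (simp add: num_marked_append num_marked_segment power_add mult.assoc)
  qed
  have "marked_chain_sum n h w
      = (\<Sum>(bs, \<gamma>, v)\<in>(SIGMA bs:segments_from n w. marked_chains_to_top n (chain_end w bs)).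
          (- 1) ^ (length bs - 1) * ((- 1) ^ (length \<gamma> - num_marked \<gamma>) * h (Suc (num_marked \<gamma>)) v))"
    unfolding marked_chain_sum_def chains_to_top_step[OF no] sum.reindex[OF chains_to_top_step_inj]
    by (intro sum.cong refl) (auto simp: weight simp del: length_append One_nat_def)
  also have "\<dots> = (\<Sum>bs\<in>segments_from n w. \<Sum>(\<gamma>, v)\<in>marked_chains_to_top n (chain_end w bs).
          (- 1) ^ (length bs - 1) * ((- 1) ^ (length \<gamma> - num_marked \<gamma>) * h (Suc (num_marked \<gamma>)) v))"
    using fin by (subst sum.Sigma[OF finite_segments_from]) auto
  also have "\<dots> = (\<Sum>bs\<in>segments_from n w.
    (- 1) ^ (length bs - 1) * marked_chain_sum n (\<lambda>k. h (Suc k)) (chain_end w bs))"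
    unfolding marked_chain_sum_def sum_distrib_left by (intro sum.cong refl) auto
  finally show ?thesis .
qed

section \<open>The two expansions\<close>

lemma subst_y_first_shift: "subst_y_first (shift_vars f) = f"
proof -
  have "(\<lambda>i. if Suc i = 1 then Y else X (Suc i - 1)) = X"
    by (rule ext) (simp add: Y_def)
  then show ?thesis
    by (simp add: subst_y_first_def shift_vars_def poly_subst_comp poly_subst_ident)
qed

lemma subst_y_first_groth_prepend:
  assumes "v permutes {1..n - 1}" "1 \<le> n"
  shows "subst_y_first (groth (prepend n v)) = Y ^ (n - 1) * groth v"
proof -
  have "subst_y_first (X 1 ^ (n - 1) * shift_vars (groth v)) = Y ^ (n - 1) * subst_y_first (shift_vars (groth v))"
    by (simp add: subst_y_first_def poly_subst_hom)
  then show ?thesis unfolding groth_prepend[OF assms] subst_y_first_shift .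
qed

text \<open>
  By the product formula, both sides satisfy the same recursion after multiplication by $y$,
  which can be cancelled.
\<close>

lemma subst_y_first_groth:
  assumes "w permutes {1..n}" "1 \<le> n"
  shows "subst_y_first (groth w) = marked_chain_sum n (\<lambda>k v. Y ^ (n - 1 - k) * groth v) w"
  using assms
proof (induction rule: rising_first_value_induct)
  case (top v)
  show ?case
    unfolding subst_y_first_groth_prepend[OF top assms(2)] marked_chain_sum_prepend[OF top assms(2)]
    by simp
next
  case (rise w)
  let ?h = "\<lambda>k v. Y ^ (n - 1 - k) * groth v"
  have mult: "Y * marked_chain_sum n (\<lambda>k. ?h (Suc k)) (chain_end w bs) = marked_chain_sum n ?h (chain_end w bs)"
    if "bs \<in> segments_from n w" for bs
  proof -
    note bs = segments_fromD[OF rise(1) that]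
    have "Y * ?h (Suc k) v = ?h k v" if "(\<gamma>, v) \<in> marked_chains_to_top n (chain_end w bs)" "k = num_marked \<gamma>" for \<gamma> v k
    proof -
      have "1 \<le> w 1" using permutes_in_image[OF rise(1), of 1] assms(2) by simp
      then have "Suc k \<le> n - 1" using num_marked_bound[OF bs(1) assms(2) that(1)] that(2) bs(2,3) by linarith
      then have "n - 1 - k = Suc (n - 1 - Suc k)" by linarith
      then show ?thesis by (simp only: power_Suc mult.assoc)
    qed
    then show ?thesis
      unfolding marked_chain_sum_def sum_distrib_left
      by (intro sum.cong refl) (auto simp: mult.left_commute[of Y])
  qed
  have "Y * subst_y_first (groth w) = subst_y_first (X 1 * groth w)"
    by (simp add: subst_y_first_def poly_subst_hom)
  also have "\<dots> = (\<Sum>bs\<in>segments_from n w. (- 1) ^ (length bs - 1) * subst_y_first (groth (chain_end w bs)))"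
    unfolding X1_mult_groth[OF rise(1,2)] by (simp add: subst_y_first_def poly_subst_hom)
  also have "\<dots> = (\<Sum>bs\<in>segments_from n w. (- 1) ^ (length bs - 1)
      * (Y * marked_chain_sum n (\<lambda>k. ?h (Suc k)) (chain_end w bs)))"
    by (intro sum.cong refl) (simp only: rise(4) mult)
  also have "\<dots> = Y * marked_chain_sum n ?h w"
    unfolding marked_chain_sum_step[OF rise(1) assms(2) rise(3), of ?h] sum_distrib_left
    by (intro sum.cong refl) (simp only: mult.left_commute)
  finally show ?case by (simp add: Y_def)
qed

text \<open>
  The condition that determines the structure constants, for an arbitrary polynomial in place of
  a product.
\<close>

definition groth_expansion :: "((nat \<Rightarrow> nat) \<Rightarrow> int) \<Rightarrow> zpoly \<Rightarrow> bool" where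
  "groth_expansion e f \<longleftrightarrow> finite {w. e w \<noteq> 0} \<and> {w. e w \<noteq> 0} \<subseteq> S_inf \<and>
     f = (\<Sum>w | e w \<noteq> 0. of_int (e w) * groth w)"

lemma groth_expansionI:
  assumes "finite A" "A \<subseteq> S_inf" "\<And>w. w \<notin> A \<Longrightarrow> e w = 0" "f = (\<Sum>w\<in>A. of_int (e w) * groth w)"
  shows "groth_expansion e f"
proof -
  have sub: "{w. e w \<noteq> 0} \<subseteq> A" using assms(3) by blast
  then have "(\<Sum>w | e w \<noteq> 0. of_int (e w) * groth w) = (\<Sum>w\<in>A. of_int (e w) * groth w)"
    using assms(1) by (intro sum.mono_neutral_left) auto
  then show ?thesis
    unfolding groth_expansion_def using sub assms finite_subset by auto
qed

lemma groth_expansion_superset: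
  assumes "groth_expansion e f" "finite A" "{w. e w \<noteq> 0} \<subseteq> A"
  shows "f = (\<Sum>w\<in>A. of_int (e w) * groth w)"
proof -
  have "f = (\<Sum>w | e w \<noteq> 0. of_int (e w) * groth w)" using assms(1) by (simp add: groth_expansion_def)
  also have "\<dots> = (\<Sum>w\<in>A. of_int (e w) * groth w)"
    using assms(2,3) by (intro sum.mono_neutral_left) auto
  finally show ?thesis .
qed

lemma groth_expansion_groth: "u \<in> S_inf \<Longrightarrow> groth_expansion (\<lambda>w. if w = u then 1 else 0) (groth u)"
  by (rule groth_expansionI[of "{u}"]) auto

lemma groth_expansion_sum:
  assumes "finite B" "\<And>b. b \<in> B \<Longrightarrow> groth_expansion (e b) (f b)"
  shows "groth_expansion (\<lambda>w. \<Sum>b\<in>B. k b * e b w) (\<Sum>b\<in>B. of_int (k b) * f b)"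
proof -
  let ?A = "\<Union>b\<in>B. {w. e b w \<noteq> 0}"
  have A: "finite ?A" "?A \<subseteq> S_inf" using assms by (auto simp: groth_expansion_def)
  have "(\<Sum>b\<in>B. of_int (k b) * f b) = (\<Sum>b\<in>B. of_int (k b) * (\<Sum>w\<in>?A. of_int (e b w) * groth w))"
    using A(1) assms(2) by (intro sum.cong refl arg_cong2[of _ _ _ _ "(*)"] groth_expansion_superset) auto
  also have "\<dots> = (\<Sum>w\<in>?A. of_int (\<Sum>b\<in>B. k b * e b w) * groth w)"
    by (simp add: sum_distrib_left sum_distrib_right mult.assoc sum.swap[of _ ?A])
  finally show ?thesis
    using A by (intro groth_expansionI[of ?A]) (auto intro!: sum.neutral)
qed

lemma groth_expansion_unique:
  assumes "groth_expansion e f" "groth_expansion e' f"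
  shows "e = e'"
proof
  fix u
  have supp: "finite {w. e w \<noteq> 0}" "{w. e w \<noteq> 0} \<subseteq> S_inf"
    "finite {w. e' w \<noteq> 0}" "{w. e' w \<noteq> 0} \<subseteq> S_inf"
    using assms unfolding groth_expansion_def by blast+
  define A where "A = {w. e w \<noteq> 0} \<union> {w. e' w \<noteq> 0}"
  have A: "finite A" "A \<subseteq> S_inf" "{w. e w \<noteq> 0} \<subseteq> A" "{w. e' w \<noteq> 0} \<subseteq> A"
    using supp by (auto simp: A_def)
  have "f = (\<Sum>w\<in>A. of_int (e w) * groth w)"
    by (rule groth_expansion_superset[OF assms(1) A(1,3)])
  moreover have "f = (\<Sum>w\<in>A. of_int (e' w) * groth w)"
    by (rule groth_expansion_superset[OF assms(2) A(1,4)])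
  ultimately have "(\<Sum>w\<in>A. of_int (e w) * groth w) = (\<Sum>w\<in>A. of_int (e' w) * groth w)"
    by (rule trans[OF sym])
  then have "(\<Sum>w\<in>A. of_int (e w) * groth w) - (\<Sum>w\<in>A. of_int (e' w) * groth w) = 0"
    by (simp only: right_minus_eq)
  then have "(\<Sum>w\<in>A. of_int (e w - e' w) * groth w) = 0"
    unfolding of_int_diff left_diff_distrib sum_subtractf .
  from groth_linear_independent[OF A(1,2) this] have *: "\<And>w. w \<in> A \<Longrightarrow> e w - e' w = 0" by blast
  show "e u = e' u"
  proof (cases "u \<in> A")
    case True
    then show ?thesis using *[of u] by simp
  next
    case False
    then show ?thesis by (simp add: A_def)
  qed
qed

lemma struct_const_eq:
  assumes "groth_expansion e (groth u * groth v)"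
  shows "struct_const w u v = e w"
proof -
  have "(THE c. groth_expansion c (groth u * groth v)) = e"
    by (rule the_equality, rule assms, rule groth_expansion_unique[OF _ assms])
  then show ?thesis unfolding struct_const_def groth_expansion_def by (rule fun_cong)
qed

text \<open>
  Induction on $p$, one segment for each factor $x_1$. Once the chain has reached $n.v_0$,
  further factors lead to $\mathcal G_{(n+k).v_0}$, whose permutation is not of the form $n.v$;
  so a chain counts towards $n.v$ only if it has exactly $p$ marks.
\<close>

lemma X1_power_mult_groth_expansion:
  assumes "w permutes {1..n}" "1 \<le> n"
  shows "\<exists>e. groth_expansion e (X 1 ^ p * groth w) \<and> (\<forall>v. v permutes {1..n - 1} \<longrightarrow>
    e (prepend n v) = marked_chain_sum n (\<lambda>k v'. if k = p \<and> v' = v then 1 else 0) w)"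
  using assms(1)
proof (induction p arbitrary: w)
  case 0
  let ?e = "\<lambda>u. if u = w then 1 else (0::int)"
  have "?e (prepend n v) = marked_chain_sum n (\<lambda>k v'. if k = 0 \<and> v' = v then 1 else 0) w"
    if v: "v permutes {1..n - 1}" for v
  proof (cases "\<exists>v. v permutes {1..n - 1} \<and> w = prepend n v")
    case True
    then obtain v0 where v0: "v0 permutes {1..n - 1}" "w = prepend n v0" by blast
    have "prepend n v = prepend n v0 \<longleftrightarrow> v0 = v" using prepend_inject[OF v v0(1)] by blast
    then show ?thesis
      unfolding v0(2) marked_chain_sum_prepend[OF v0(1) assms(2)] by simp
  next
    case False
    then have "marked_chain_sum n (\<lambda>k v'. if k = 0 \<and> v' = v then 1 else (0::int)) w = 0"
      unfolding marked_chain_sum_step[OF 0 assms(2) False] by (simp add: marked_chain_sum_def)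
    then show ?thesis using False v by auto
  qed
  then show ?case using groth_expansion_groth[OF S_infI[OF 0]] by auto
next
  case (Suc p)
  show ?case
  proof (cases "\<exists>v. v permutes {1..n - 1} \<and> w = prepend n v")
    case True
    then obtain v0 where v0: "v0 permutes {1..n - 1}" "w = prepend n v0" by blast
    \<comment> \<open>Multiplying by $x_1^{p+1}$ raises the prepended entry from $n$ to $n + p + 1$.\<close>
    let ?u = "prepend (n + Suc p) v0"
    have v0': "v0 permutes {1..n + Suc p - 1}" by (rule permutes_mono[OF v0(1)]) simp
    have exponent: "n + Suc p - 1 = Suc p + (n - 1)" using assms(2) by simp
    have "groth ?u = X 1 ^ (n + Suc p - 1) * shift_vars (groth v0)"
      using v0' by (rule groth_prepend) simp
    also have "\<dots> = X 1 ^ Suc p * groth w"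
      unfolding exponent v0(2) groth_prepend[OF v0(1) assms(2)] power_add mult.assoc ..
    finally have G: "groth ?u = X 1 ^ Suc p * groth w" .
    have "?u permutes {1..n + Suc p}" using v0' by (rule prepend_permutes) simp
    from groth_expansion_groth[OF S_infI[OF this]]
    have "groth_expansion (\<lambda>u. if u = ?u then 1 else 0) (X 1 ^ Suc p * groth w)" unfolding G .
    moreover have "prepend n v \<noteq> ?u" for v
    proof
      assume "prepend n v = ?u"
      then have "prepend n v 1 = ?u 1" by simp
      then show False by (simp add: prepend_def)
    qed
    moreover have "marked_chain_sum n (\<lambda>k v'. if k = Suc p \<and> v' = v then 1 else (0::int)) w = 0" for v
      unfolding v0(2) marked_chain_sum_prepend[OF v0(1) assms(2)] by simp
    ultimately show ?thesis by (intro exI[of _ "\<lambda>u. if u = ?u then 1 else 0"] conjI allI impI) simp_all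
  next
    case False
    have "w 1 \<noteq> n" using False ex_prepend[OF Suc.prems _ assms(2)] by blast
    then have w1: "w 1 < n" using permutes_le[OF Suc.prems assms(2)] by simp
    define E where "E bs = (SOME e. groth_expansion e (X 1 ^ p * groth (chain_end w bs)) \<and>
      (\<forall>v. v permutes {1..n - 1} \<longrightarrow> e (prepend n v)
        = marked_chain_sum n (\<lambda>k v'. if k = p \<and> v' = v then 1 else 0) (chain_end w bs)))" for bs
    have E: "groth_expansion (E bs) (X 1 ^ p * groth (chain_end w bs))"
      "\<And>v. v permutes {1..n - 1} \<Longrightarrow> E bs (prepend n v)
        = marked_chain_sum n (\<lambda>k v'. if k = p \<and> v' = v then 1 else 0) (chain_end w bs)"
      if "bs \<in> segments_from n w" for bs
      using someI_ex[OF Suc.IH[OF segments_fromD(1)[OF Suc.prems that]]] unfolding E_def[symmetric] by blast+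
    let ?e = "\<lambda>u. \<Sum>bs\<in>segments_from n w. (- 1) ^ (length bs - 1) * E bs u"
    have "X 1 ^ Suc p * groth w = X 1 ^ p * (X 1 * groth w)"
      by (simp only: power_Suc mult_ac)
    also have "\<dots> = (\<Sum>bs\<in>segments_from n w.
        of_int ((- 1) ^ (length bs - 1)) * (X 1 ^ p * groth (chain_end w bs)))"
      unfolding X1_mult_groth[OF Suc.prems w1] sum_distrib_left
      by (intro sum.cong refl) (simp add: mult.left_commute)
    finally have eq: "X 1 ^ Suc p * groth w = (\<Sum>bs\<in>segments_from n w.
        of_int ((- 1) ^ (length bs - 1)) * (X 1 ^ p * groth (chain_end w bs)))" .
    have "groth_expansion ?e (X 1 ^ Suc p * groth w)"
      unfolding eq by (rule groth_expansion_sum[OF finite_segments_from E(1)])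
    moreover have "?e (prepend n v)
        = marked_chain_sum n (\<lambda>k v'. if k = Suc p \<and> v' = v then 1 else 0) w"
      if v: "v permutes {1..n - 1}" for v
      unfolding marked_chain_sum_step[OF Suc.prems assms(2) False]
      by (intro sum.cong refl) (simp add: E(2)[OF _ v])
    ultimately show ?thesis by blast
  qed
qed

lemma groth_r_perm: "groth (r_perm 1 p) = X 1 ^ p"
proof -
  have "r_perm 1 p = prepend (Suc p) id"
    by (rule ext) (auto simp: r_perm_def prepend_def)
  then show ?thesis
    using groth_prepend[of id "Suc p"] by (simp add: permutes_id groth_id shift_vars_def)
qed

text \<open>
  The factor $\mathcal G_{r_{[1,p]}}$ is $x_1^p$, as $r_{[1,p]} = (p+1).\mathrm{id}$.
\<close>

lemma struct_const_r_perm: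
  assumes "w permutes {1..n}" "1 \<le> n" "v permutes {1..n - 1}"
  shows "struct_const (prepend n v) w (r_perm 1 p)
    = marked_chain_sum n (\<lambda>k v'. if k = p \<and> v' = v then 1 else 0) w"
proof -
  obtain e where e: "groth_expansion e (X 1 ^ p * groth w)"
    "e (prepend n v) = marked_chain_sum n (\<lambda>k v'. if k = p \<and> v' = v then 1 else 0) w"
    using X1_power_mult_groth_expansion[OF assms(1,2), of p] assms(3) by blast
  have "groth_expansion e (groth w * groth (r_perm 1 p))"
    using e(1) by (simp only: groth_r_perm mult.commute)
  from struct_const_eq[OF this, of "prepend n v"] show ?thesis unfolding e(2) .
qed

theorem theorem5p4:
  fixes n :: nat and w :: "nat \<Rightarrow> nat"
  assumes "n \<ge> 1" and "w permutes {1..n}"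
  shows "(\<forall>v. v permutes {1..n - 1} \<and> w = prepend n v \<longrightarrow>
            subst_y_first (groth w) = Y ^ (n - 1) * groth v) \<and>
         ((\<nexists>v. v permutes {1..n - 1} \<and> w = prepend n v) \<longrightarrow>
            subst_y_first (groth w) =
              (\<Sum>j\<in>{1..<n}. \<Sum>v | v permutes {1..n - 1}.
                 of_int (struct_const (prepend n v) w (r_perm 1 (n - j))) *
                 Y ^ (j - 1) * groth v) \<and>
            subst_y_first (groth w) =
              (\<Sum>(\<gamma>, v)\<in>marked_chains_to_top n w.
                 (- 1) ^ (length \<gamma> - num_marked \<gamma>) *
                 Y ^ (n - 1 - num_marked \<gamma>) * groth v))"
proof (intro conjI impI allI)
  fix v assume "v permutes {1..n - 1} \<and> w = prepend n v"
  then show "subst_y_first (groth w) = Y ^ (n - 1) * groth v"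
    using subst_y_first_groth_prepend assms(1) by blast
next
  show chains: "subst_y_first (groth w) = (\<Sum>(\<gamma>, v)\<in>marked_chains_to_top n w.
      (- 1) ^ (length \<gamma> - num_marked \<gamma>) * Y ^ (n - 1 - num_marked \<gamma>) * groth v)"
    using subst_y_first_groth[OF assms(2,1)] by (simp add: marked_chain_sum_def mult.assoc)
  assume no: "\<nexists>v. v permutes {1..n - 1} \<and> w = prepend n v"
  let ?V = "{v. v permutes {1..n - 1}}"
  let ?sgn = "\<lambda>\<gamma>. (- 1) ^ (length \<gamma> - num_marked \<gamma>) :: zpoly"
  have fin: "finite ?V" by (intro finite_permutations) simp
  \<comment> \<open>A marked chain with $m$ marks is counted only for $j = n - m$, a legal index as $1 \<le> m \<le> n - 1$.\<close>
  have pick: "(\<Sum>j\<in>{1..<n}. \<Sum>v\<in>?V. (if num_marked \<gamma> = n - j \<and> v' = v then 1 else 0) * (Y ^ (j - 1) * groth v))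
      = Y ^ (n - 1 - num_marked \<gamma>) * groth v'"
    if \<gamma>: "(\<gamma>, v') \<in> marked_chains_to_top n w" for \<gamma> v'
  proof -
    have v': "v' \<in> ?V" and "\<gamma> \<noteq> []" and mc: "marked_chain n w \<gamma>"
      using \<gamma> no by (auto simp: marked_chains_to_top_def)
    then have "snd (hd \<gamma>)" by (simp add: marked_chain_def)
    with \<open>\<gamma> \<noteq> []\<close> have pos: "1 \<le> num_marked \<gamma>"
      by (cases \<gamma>) (auto simp: num_marked_def)
    have "1 \<le> w 1" using permutes_in_image[OF assms(2), of 1] assms(1) by simp
    then have le: "num_marked \<gamma> \<le> n - 1" using num_marked_bound[OF assms(2,1) \<gamma>] by linarith
    have "(\<Sum>j\<in>{1..<n}. \<Sum>v\<in>?V. (if num_marked \<gamma> = n - j \<and> v' = v then 1 else 0) * (Y ^ (j - 1) * groth v))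
        = (\<Sum>j\<in>{1..<n}. \<Sum>v\<in>?V. if v = v' then (if j = n - num_marked \<gamma> then Y ^ (j - 1) * groth v' else 0) else 0)"
      using le pos by (intro sum.cong refl) auto
    also have "\<dots> = (\<Sum>j\<in>{1..<n}. if j = n - num_marked \<gamma> then Y ^ (j - 1) * groth v' else 0)"
      using fin v' by (simp add: sum.delta)
    also have "\<dots> = Y ^ (n - num_marked \<gamma> - 1) * groth v'"
      using le pos by (simp add: sum.delta) linarith
    also have "n - num_marked \<gamma> - 1 = n - 1 - num_marked \<gamma>" by simp
    finally show ?thesis .
  qed
  have "(\<Sum>j\<in>{1..<n}. \<Sum>v\<in>?V. of_int (struct_const (prepend n v) w (r_perm 1 (n - j))) * Y ^ (j - 1) * groth v)
      = (\<Sum>j\<in>{1..<n}. \<Sum>v\<in>?V. \<Sum>(\<gamma>, v')\<in>marked_chains_to_top n w.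
          ?sgn \<gamma> * ((if num_marked \<gamma> = n - j \<and> v' = v then 1 else 0) * (Y ^ (j - 1) * groth v)))"
  proof (intro sum.cong refl)
    fix j v assume "v \<in> ?V"
    then have "struct_const (prepend n v) w (r_perm 1 (n - j))
        = marked_chain_sum n (\<lambda>k v'. if k = n - j \<and> v' = v then 1 else 0) w"
      using struct_const_r_perm[OF assms(2,1)] by blast
    then show "of_int (struct_const (prepend n v) w (r_perm 1 (n - j))) * Y ^ (j - 1) * groth v
        = (\<Sum>(\<gamma>, v')\<in>marked_chains_to_top n w.
            ?sgn \<gamma> * ((if num_marked \<gamma> = n - j \<and> v' = v then 1 else 0) * (Y ^ (j - 1) * groth v)))"
      by (simp only: marked_chain_sum_def of_int_sum sum_distrib_right)
        (auto intro!: sum.cong simp: mult.assoc)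
  qed
  also have "\<dots> = (\<Sum>(\<gamma>, v')\<in>marked_chains_to_top n w. \<Sum>j\<in>{1..<n}. \<Sum>v\<in>?V.
          ?sgn \<gamma> * ((if num_marked \<gamma> = n - j \<and> v' = v then 1 else 0) * (Y ^ (j - 1) * groth v)))"
    by (simp only: case_prod_unfold sum.swap[of _ "marked_chains_to_top n w"])
  also have "\<dots> = (\<Sum>(\<gamma>, v')\<in>marked_chains_to_top n w. ?sgn \<gamma> * Y ^ (n - 1 - num_marked \<gamma>) * groth v')"
    by (intro sum.cong refl) (auto simp: sum_distrib_left[symmetric] pick mult.assoc simp del: One_nat_def)
  finally show "subst_y_first (groth w) = (\<Sum>j\<in>{1..<n}. \<Sum>v\<in>?V.
      of_int (struct_const (prepend n v) w (r_perm 1 (n - j))) * Y ^ (j - 1) * groth v)"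
    unfolding chains by simp
qed

end
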